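(* Let $M$ be a smooth manifold of dimension $n$ endowed with a symmetric affine connection, and for $f\in\mathrm{Diff}(M)$ let $\mathcal{L}(f)$ be the linear differential operator of order at most three on $C^\infty(T^*M)$ defined in the context. The map $$f\mapsto \mathcal{L}(f^{-1})$$ defines a non-trivial 1-cocycle on $\mathrm{Diff}(M)$ with values in $\mathcal{D}^3(C^\infty(T^*M))$.
   Context: **Lifted connection.** Let $\Gamma_{ij}^k$ ($i,j,k=1,\dots,n$) be the Christoffel symbols of the fixed symmetric affine connection on $M$. Let $(x^i,\xi_i)$ be the local coordinates on $T^*M$ induced by local coordinates $(x^i)$ on $M$. Boldface indices $\mathbf{i},\mathbf{j},\dots$ run over $1,\dots,2n$; an index is written $i$ if it runs over $1,\dots,n$ (base directions $x^i$) and $\bar i$ if it runs over $n+1,\dots,2n$ (fibre directions $\xi_i$). Summation over repeated indices is understood. The lifted symmetric affine connection on $T^*M$ has Christoffel symbols $$\tilde\Gamma_{ij}^k=\Gamma_{ij}^k,\quad \tilde\Gamma_{i\bar j}^k=0,\quad \tilde\Gamma_{\bar i j}^k=0,\quad \tilde\Gamma_{\bar i\bar j}^k=0,$$ $$\tilde\Gamma_{ij}^{\bar k}=\xi_a\left(\partial_k\Gamma_{ij}^a-\partial_i\Gamma_{jk}^a-\partial_j\Gamma_{ik}^a+2\Gamma_{kt}^a\Gamma_{ij}^t\right),$$ $$\tilde\Gamma_{i\bar j}^{\bar k}=-\Gamma_{ik}^j,\quad \tilde\Gamma_{\bar i j}^{\bar k}=-\Gamma_{kj}^i,\quad \tilde\Gamma_{\bar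 i\bar j}^{\bar k}=0.$$ Its covariant derivative is denoted $\tilde\nabla$; $\tilde\nabla_{\mathbf i}\tilde\nabla_{\mathbf j}$ and $\tilde\nabla_{\mathbf i}\tilde\nabla_{\mathbf j}\tilde\nabla_{\mathbf k}$ applied to a function denote the components of its iterated covariant derivatives. **Symplectic lift and the tensor $C$.** For $f\in\mathrm{Diff}(M)$, $\tilde f$ is its symplectic (cotangent) lift to $T^*M$, in coordinates $\tilde f(x,\xi)=\left(f^1(x),\dots,f^n(x),\frac{\partial x^i}{\partial f^1}\xi_i,\dots,\frac{\partial x^i}{\partial f^n}\xi_i\right)$. Put $C(\tilde f):=\tilde f^*(\tilde\Gamma)-\tilde\Gamma$, the difference of the pulled-back connection and the connection $\tilde\Gamma$; it is a tensor field of type $(2,1)$ on $T^*M$ with components $C_{\mathbf{ij}}^{\mathbf k}(\tilde f)$ (two lower indices, one upper index). **Bivector.** $\mathrm{g}^{\mathbf{ij}}$ is the standard bivector on $T^*M$ dual to the standard symplectic form, whose components are $\mathrm{g}_{ij}=\mathrm{g}_{\bar i\bar j}=0$, $\mathrm{g}_{i\bar j}=\delta_{ij}=-\mathrm{g}_{\bar j i}$. **The operator.** For $f\in\mathrm{Diff}(M)$, $$\mathcal{L}(f):=\mathrm{Sym}_{\mathbf j,\mathbf i,\mathbf k}\left(C_{\mathbf{ml}}^{\mathbf j}(\tilde f)\,\mathrm{g}^{\mathbf{im}}\,\mathrm{g}^{\mathbf{kl}}\right)\tilde\nabla_{\mathbf i}\tilde\nabla_{\mathbf j}\tilde\nabla_{\mathbf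 k}-\frac32\,\mathrm{Sym}_{\mathbf n,\mathbf m,\mathbf i}\left(C_{\mathbf{lk}}^{\mathbf n}(\tilde f)\,\mathrm{g}^{\mathbf{ml}}\,\mathrm{g}^{\mathbf{ik}}\right)C_{\mathbf{mn}}^{\mathbf j}(\tilde f)\,\tilde\nabla_{\mathbf i}\tilde\nabla_{\mathbf j},$$ where $\mathrm{Sym}$ denotes symmetrization (average over all permutations) in the three listed free indices of the expression in parentheses, performed before contraction with the remaining factors. **Module structure and cocycles.** $\mathrm{Diff}(M)$ acts on $C^\infty(T^*M)$ by $f^*\cdot Q:=Q\circ\tilde f^{-1}$. $\mathcal{D}^3(C^\infty(T^*M))$ is the space of linear differential operators of order at most $3$ on $C^\infty(T^*M)$, with the action $f^*T:=f^*\circ T\circ(f^{-1})^*$. A 1-cocycle on $\mathrm{Diff}(M)$ with values in this module is a map $c$ with $c(f\circ h)=c(f)+f^*c(h)$ for all $f,h\in\mathrm{Diff}(M)$; it is trivial if there is $A\in\mathcal{D}^3(C^\infty(T^*M))$ with $c(f)=f^*A-A$ for all $f$, and non-trivial otherwise. *)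

theory Defs
  imports "HOL-Analysis.Analysis"
begin

section \<open>Smooth functions on open subsets of Euclidean space\<close>

text \<open>
  \<open>Ck_on k S f\<close> means that \<open>f\<close> is of class $C^k$ on \<open>S\<close>; it is meant for open \<open>S\<close>.
\<close>

primrec Ck_on :: "nat \<Rightarrow> 'a::real_normed_vector set \<Rightarrow> ('a \<Rightarrow> 'b::real_normed_vector) \<Rightarrow> bool" where
  "Ck_on 0 S f \<longleftrightarrow> continuous_on S f"
| "Ck_on (Suc k) S f \<longleftrightarrow>
     (\<forall>x\<in>S. f differentiable (at x)) \<and> (\<forall>v. Ck_on k S (\<lambda>x. frechet_derivative f (at x) v))"

definition smooth_on :: "'a::real_normed_vector set \<Rightarrow> ('a \<Rightarrow> 'b::real_normed_vector) \<Rightarrow> bool" where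
  "smooth_on S f \<longleftrightarrow> (\<forall>k. Ck_on k S f)"

definition partial :: "'m::finite \<Rightarrow> (real^'m \<Rightarrow> real) \<Rightarrow> real^'m \<Rightarrow> real" where
  "partial i h u = frechet_derivative h (at u) (axis i 1)"


section \<open>Connections in coordinates\<close>

text \<open>
  Christoffel symbols are written with the upper index first: \<open>\<Gamma> k i j u\<close> is
  $\Gamma_{ij}^k(u)$. The pull-back of \<open>\<Gamma>\<close> under a local diffeomorphism \<open>F\<close> is
  $\frac{\partial u^k}{\partial F^c}\bigl(\Gamma_{ab}^c(F(u))\,\partial_i F^a\,\partial_j F^b
  + \partial_i\partial_j F^c\bigr)$.
\<close>

type_synonym 'm christoffel = "'m \<Rightarrow> 'm \<Rightarrow> 'm \<Rightarrow> real^'m \<Rightarrow> real"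

definition pullback_conn ::
  "(real^'m \<Rightarrow> real^'m) \<Rightarrow> 'm::finite christoffel \<Rightarrow> 'm christoffel" where
  "pullback_conn F \<Gamma> k i j u =
     (\<Sum>c\<in>UNIV. matrix_inv (jacobian F (at u)) $ k $ c *
        ((\<Sum>a\<in>UNIV. \<Sum>b\<in>UNIV.
            \<Gamma> c a b (F u) * partial i (\<lambda>v. F v $ a) u * partial j (\<lambda>v. F v $ b) u)
         + partial i (partial j (\<lambda>v. F v $ c)) u))"

definition cov1 :: "'m::finite \<Rightarrow> (real^'m \<Rightarrow> real) \<Rightarrow> real^'m \<Rightarrow> real" where
  "cov1 i q u = partial i q u"

definition cov2 :: "'m::finite christoffel \<Rightarrow> 'm \<Rightarrow> 'm \<Rightarrow> (real^'m \<Rightarrow> real) \<Rightarrow> real^'m \<Rightarrow> real" where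
  "cov2 \<Gamma> i j q u = partial i (cov1 j q) u - (\<Sum>l\<in>UNIV. \<Gamma> l i j u * cov1 l q u)"

definition cov3 ::
  "'m::finite christoffel \<Rightarrow> 'm \<Rightarrow> 'm \<Rightarrow> 'm \<Rightarrow> (real^'m \<Rightarrow> real) \<Rightarrow> real^'m \<Rightarrow> real" where
  "cov3 \<Gamma> i j k q u = partial i (cov2 \<Gamma> j k q) u
     - (\<Sum>l\<in>UNIV. \<Gamma> l i j u * cov2 \<Gamma> l k q u)
     - (\<Sum>l\<in>UNIV. \<Gamma> l i k u * cov2 \<Gamma> j l q u)"


section \<open>Smooth manifolds, diffeomorphisms and connections\<close>

text \<open>
  The manifold is the whole type \<open>'a\<close>. A chart is a pair of its domain and its coordinate map
  (whose values outside the domain are irrelevant). Atlases need not be maximal.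
\<close>

type_synonym ('a, 'n) chart = "'a set \<times> ('a \<Rightarrow> real^'n)"

definition chart_inv :: "('a, 'n::finite) chart \<Rightarrow> real^'n \<Rightarrow> 'a" where
  "chart_inv c = inv_into (fst c) (snd c)"

definition local_map ::
  "('a \<Rightarrow> 'a) \<Rightarrow> ('a, 'n::finite) chart \<Rightarrow> ('a, 'n) chart \<Rightarrow> real^'n \<Rightarrow> real^'n" where
  "local_map f c d = snd d \<circ> f \<circ> chart_inv c"

definition smooth_atlas ::
  "('a::{t2_space,second_countable_topology}, 'n::finite) chart set \<Rightarrow> bool" where
  "smooth_atlas A \<longleftrightarrow>
     (\<Union>c\<in>A. fst c) = UNIV \<and>
     (\<forall>c\<in>A. open (fst c) \<and> open (snd c ` fst c) \<and>
        homeomorphism (fst c) (snd c ` fst c) (snd c) (chart_inv c)) \<and>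
     (\<forall>c\<in>A. \<forall>d\<in>A. smooth_on (snd c ` (fst c \<inter> fst d)) (local_map id c d))"

definition chart_at :: "('a, 'n::finite) chart set \<Rightarrow> 'a \<Rightarrow> ('a, 'n) chart" where
  "chart_at A x = (SOME c. c \<in> A \<and> x \<in> fst c)"

definition smooth_map ::
  "('a::topological_space, 'n::finite) chart set \<Rightarrow> ('a \<Rightarrow> 'a) \<Rightarrow> bool" where
  "smooth_map A f \<longleftrightarrow> continuous_on UNIV f \<and>
     (\<forall>c\<in>A. \<forall>d\<in>A. smooth_on (snd c ` (fst c \<inter> f -` fst d)) (local_map f c d))"

definition Diff :: "('a::topological_space, 'n::finite) chart set \<Rightarrow> ('a \<Rightarrow> 'a) set" where
  "Diff A = {f. bij f \<and> smooth_map A f \<and> smooth_map A (inv f)}"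

text \<open>
  An affine connection is given by its Christoffel symbols \<open>G c\<close> in every chart \<open>c\<close> of the
  atlas, as functions of the coordinates, subject to the transformation law on overlaps.
\<close>

definition symmetric_connection ::
  "('a, 'n::finite) chart set \<Rightarrow> (('a, 'n) chart \<Rightarrow> 'n christoffel) \<Rightarrow> bool" where
  "symmetric_connection A G \<longleftrightarrow>
     (\<forall>c\<in>A. \<forall>k i j. smooth_on (snd c ` fst c) (G c k i j)) \<and>
     (\<forall>c\<in>A. \<forall>k i j. \<forall>u\<in>snd c ` fst c. G c k i j u = G c k j i u) \<and>
     (\<forall>c\<in>A. \<forall>d\<in>A. \<forall>k i j. \<forall>u\<in>snd c ` (fst c \<inter> fst d).
        G c k i j u = pullback_conn (local_map id c d) (G d) k i j u)"


section \<open>The cotangent bundle\<close>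

text \<open>
  A covector at \<open>x\<close> assigns to every chart \<open>c\<close> around \<open>x\<close> a vector of components such that the
  covariant transformation law $\alpha_i = \frac{\partial y^j}{\partial x^i}\,\beta_j$ holds;
  it is zero on all other charts, so that covectors are equal iff their components are.
\<close>

type_synonym ('a, 'n) cov = "('a, 'n) chart \<Rightarrow> real^'n"

definition covectors :: "('a, 'n::finite) chart set \<Rightarrow> 'a \<Rightarrow> ('a, 'n) cov set" where
  "covectors A x = {\<alpha>.
     (\<forall>c. \<not> (c \<in> A \<and> x \<in> fst c) \<longrightarrow> \<alpha> c = 0) \<and>
     (\<forall>c\<in>A. \<forall>d\<in>A. x \<in> fst c \<and> x \<in> fst d \<longrightarrow>
        \<alpha> c = transpose (jacobian (local_map id c d) (at (snd c x))) *v \<alpha> d)}"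

definition cotangent :: "('a, 'n::finite) chart set \<Rightarrow> ('a \<times> ('a, 'n) cov) set" where
  "cotangent A = (SIGMA x:UNIV. covectors A x)"

text \<open>
  The $2n$ coordinate directions of the cotangent bundle are indexed by \<open>'n + 'n\<close>:
  \<open>Inl i\<close> is the base index $i$ and \<open>Inr i\<close> is the fibre index $\bar i$.
\<close>

definition base_part :: "real^('n + 'n) \<Rightarrow> real^'n::finite" where
  "base_part w = (\<chi> i. w $ Inl i)"

definition fibre_part :: "real^('n + 'n) \<Rightarrow> real^'n::finite" where
  "fibre_part w = (\<chi> i. w $ Inr i)"

definition cot_coord ::
  "('a, 'n::finite) chart \<Rightarrow> 'a \<times> ('a, 'n) cov \<Rightarrow> real^('n + 'n)" where
  "cot_coord c z = (\<chi> b. case b of Inl i \<Rightarrow> snd c (fst z) $ i | Inr i \<Rightarrow> snd z c $ i)"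

definition cot_dom ::
  "('a, 'n::finite) chart set \<Rightarrow> ('a, 'n) chart \<Rightarrow> ('a \<times> ('a, 'n) cov) set" where
  "cot_dom A c = {z \<in> cotangent A. fst z \<in> fst c}"

definition cot_inv ::
  "('a, 'n::finite) chart set \<Rightarrow> ('a, 'n) chart \<Rightarrow> real^('n + 'n) \<Rightarrow> 'a \<times> ('a, 'n) cov" where
  "cot_inv A c = inv_into (cot_dom A c) (cot_coord c)"

text \<open>
  The fibre components of the lift of \<open>f\<close> at \<open>(x, \<alpha>)\<close> are
  $\frac{\partial x^j}{\partial f^i}\,\alpha_j$. They do not depend on the chart chosen
  around \<open>x\<close>.
\<close>

definition cot_lift ::
  "('a, 'n::finite) chart set \<Rightarrow> ('a \<Rightarrow> 'a) \<Rightarrow> 'a \<times> ('a, 'n) cov \<Rightarrow> 'a \<times> ('a, 'n) cov" where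
  "cot_lift A f z = (f (fst z), \<lambda>d.
     if d \<in> A \<and> f (fst z) \<in> fst d then
       (let c = chart_at A (fst z) in
        transpose (jacobian (local_map (inv f) d c) (at (snd d (f (fst z))))) *v snd z c)
     else 0)"

definition lift_local ::
  "('a, 'n::finite) chart set \<Rightarrow> ('a \<Rightarrow> 'a) \<Rightarrow> ('a, 'n) chart \<Rightarrow> ('a, 'n) chart \<Rightarrow>
     real^('n + 'n) \<Rightarrow> real^('n + 'n)" where
  "lift_local A f c d = cot_coord d \<circ> cot_lift A f \<circ> cot_inv A c"

fun lifted_conn :: "'n::finite christoffel \<Rightarrow> ('n + 'n) christoffel" where
  "lifted_conn \<Gamma> (Inl k) (Inl i) (Inl j) w = \<Gamma> k i j (base_part w)"
| "lifted_conn \<Gamma> (Inl k) (Inl i) (Inr j) w = 0"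
| "lifted_conn \<Gamma> (Inl k) (Inr i) (Inl j) w = 0"
| "lifted_conn \<Gamma> (Inl k) (Inr i) (Inr j) w = 0"
| "lifted_conn \<Gamma> (Inr k) (Inl i) (Inl j) w =
     (\<Sum>a\<in>UNIV. fibre_part w $ a *
        (partial k (\<Gamma> a i j) (base_part w) - partial i (\<Gamma> a j k) (base_part w)
         - partial j (\<Gamma> a i k) (base_part w)
         + 2 * (\<Sum>t\<in>UNIV. \<Gamma> a k t (base_part w) * \<Gamma> t i j (base_part w))))"
| "lifted_conn \<Gamma> (Inr k) (Inl i) (Inr j) w = - \<Gamma> j i k (base_part w)"
| "lifted_conn \<Gamma> (Inr k) (Inr i) (Inl j) w = - \<Gamma> i k j (base_part w)"
| "lifted_conn \<Gamma> (Inr k) (Inr i) (Inr j) w = 0"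

text \<open>
  \<open>C_comp A G f c d k i j w\<close> is the component $C_{ij}^k(\tilde f)$ at the point with coordinates
  \<open>w\<close> in the chart induced by \<open>c\<close>, computed with the chart induced by \<open>d\<close> around its image.
  The result does not depend on \<open>d\<close>, and is tensorial in \<open>c\<close>.
\<close>

definition C_comp ::
  "('a, 'n::finite) chart set \<Rightarrow> (('a, 'n) chart \<Rightarrow> 'n christoffel) \<Rightarrow> ('a \<Rightarrow> 'a) \<Rightarrow>
     ('a, 'n) chart \<Rightarrow> ('a, 'n) chart \<Rightarrow> ('n + 'n) christoffel" where
  "C_comp A G f c d k i j w =
     pullback_conn (lift_local A f c d) (lifted_conn (G d)) k i j w - lifted_conn (G c) k i j w"

fun symp_form_comp :: "'n + 'n \<Rightarrow> 'n + 'n \<Rightarrow> real" where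
  "symp_form_comp (Inl i) (Inl j) = 0"
| "symp_form_comp (Inl i) (Inr j) = (if i = j then 1 else 0)"
| "symp_form_comp (Inr j) (Inl i) = (if i = j then - 1 else 0)"
| "symp_form_comp (Inr i) (Inr j) = 0"

text \<open>
  The other common convention for the dual bivector differs by a sign; below it always
  occurs quadratically.
\<close>

definition bivector :: "'n::finite + 'n \<Rightarrow> 'n + 'n \<Rightarrow> real" where
  "bivector i j =
     matrix_inv ((\<chi> a b. symp_form_comp a b) :: real^('n + 'n)^('n + 'n)) $ i $ j"


section \<open>Functions and differential operators on the cotangent bundle\<close>

text \<open>
  Functions on the cotangent bundle are extended by zero, so that equality of functions is
  equality on the bundle.
\<close>

definition C_inf :: "('a, 'n::finite) chart set \<Rightarrow> ('a \<times> ('a, 'n) cov \<Rightarrow> real) set" where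
  "C_inf A = {Q. (\<forall>c\<in>A. smooth_on (cot_coord c ` cot_dom A c) (Q \<circ> cot_inv A c)) \<and>
                 (\<forall>z. z \<notin> cotangent A \<longrightarrow> Q z = 0)}"

type_synonym ('a, 'n) cot_op =
  "('a \<times> ('a, 'n) cov \<Rightarrow> real) \<Rightarrow> 'a \<times> ('a, 'n) cov \<Rightarrow> real"

text \<open>
  Operators matter only on \<open>C_inf A\<close>. An operator of order at most \<open>k\<close> is, in every induced
  chart, a combination of iterated partial derivatives of length at most \<open>k\<close> with smooth
  coefficients; in particular it is linear.
\<close>

definition diff_ops :: "('a, 'n::finite) chart set \<Rightarrow> nat \<Rightarrow> ('a, 'n) cot_op set" where
  "diff_ops A k = {T. (\<forall>Q\<in>C_inf A. T Q \<in> C_inf A) \<and>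
     (\<forall>c\<in>A. \<exists>a :: ('n + 'n) list \<Rightarrow> real^('n + 'n) \<Rightarrow> real.
        (\<forall>is. length is \<le> k \<longrightarrow> smooth_on (cot_coord c ` cot_dom A c) (a is)) \<and>
        (\<forall>Q\<in>C_inf A. \<forall>z\<in>cot_dom A c.
           T Q z = (\<Sum>is\<in>{is. length is \<le> k}.
              a is (cot_coord c z) * foldr partial is (Q \<circ> cot_inv A c) (cot_coord c z))))}"

definition act_fun ::
  "('a, 'n::finite) chart set \<Rightarrow> ('a \<Rightarrow> 'a) \<Rightarrow> ('a, 'n) cot_op" where
  "act_fun A f Q z =
     (if z \<in> cotangent A then Q (inv_into (cotangent A) (cot_lift A f) z) else 0)"

definition act_op ::
  "('a, 'n::finite) chart set \<Rightarrow> ('a \<Rightarrow> 'a) \<Rightarrow> ('a, 'n) cot_op \<Rightarrow> ('a, 'n) cot_op" where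
  "act_op A f T = act_fun A f \<circ> T \<circ> act_fun A (inv f)"

definition one_cocycle ::
  "('a::topological_space, 'n::finite) chart set \<Rightarrow> nat \<Rightarrow>
     (('a \<Rightarrow> 'a) \<Rightarrow> ('a, 'n) cot_op) \<Rightarrow> bool" where
  "one_cocycle A k c \<longleftrightarrow>
     (\<forall>f\<in>Diff A. c f \<in> diff_ops A k) \<and>
     (\<forall>f\<in>Diff A. \<forall>h\<in>Diff A. \<forall>Q\<in>C_inf A. \<forall>z\<in>cotangent A.
        c (f \<circ> h) Q z = c f Q z + act_op A f (c h) Q z)"

definition trivial_cocycle ::
  "('a::topological_space, 'n::finite) chart set \<Rightarrow> nat \<Rightarrow>
     (('a \<Rightarrow> 'a) \<Rightarrow> ('a, 'n) cot_op) \<Rightarrow> bool" where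
  "trivial_cocycle A k c \<longleftrightarrow>
     (\<exists>B\<in>diff_ops A k. \<forall>f\<in>Diff A. \<forall>Q\<in>C_inf A. \<forall>z\<in>cotangent A.
        c f Q z = act_op A f B Q z - B Q z)"


section \<open>The operator\<close>

definition sym3 :: "('m \<Rightarrow> 'm \<Rightarrow> 'm \<Rightarrow> real) \<Rightarrow> 'm \<Rightarrow> 'm \<Rightarrow> 'm \<Rightarrow> real" where
  "sym3 T a b c = (T a b c + T a c b + T b a c + T b c a + T c a b + T c b a) / 6"

text \<open>
  The value is computed in arbitrarily chosen charts around the base point and its image under
  \<open>f\<close>; it does not depend on this choice.
\<close>

definition L_op ::
  "('a, 'n::finite) chart set \<Rightarrow> (('a, 'n) chart \<Rightarrow> 'n christoffel) \<Rightarrow>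
     ('a \<Rightarrow> 'a) \<Rightarrow> ('a, 'n) cot_op" where
  "L_op A G f Q z =
     (if z \<in> cotangent A then
        let c = chart_at A (fst z);
            d = chart_at A (f (fst z));
            w = cot_coord c z;
            q = Q \<circ> cot_inv A c;
            \<Gamma> = lifted_conn (G c);
            C = (\<lambda>k i j. C_comp A G f c d k i j w);
            g = bivector
        in (\<Sum>i\<in>UNIV. \<Sum>j\<in>UNIV. \<Sum>k\<in>UNIV.
              sym3 (\<lambda>j i k. \<Sum>m\<in>UNIV. \<Sum>l\<in>UNIV. C j m l * g i m * g k l) j i k
              * cov3 \<Gamma> i j k q w)
           - 3 / 2 * (\<Sum>i\<in>UNIV. \<Sum>j\<in>UNIV. \<Sum>m\<in>UNIV. \<Sum>n\<in>UNIV.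
              sym3 (\<lambda>n m i. \<Sum>l\<in>UNIV. \<Sum>k\<in>UNIV. C n l k * g m l * g i k) n m i
              * C j m n * cov2 \<Gamma> i j q w)
      else 0)"

end

theory Submission
  imports Defs
begin


text \<open>
  The lifted connection is the Levi-Civita connection of the Riemann extension of $\Gamma$, hence
  natural, so $C(\tilde f)$ is the difference of the lifts of $f^*\Gamma$ and $\Gamma$. Writing
  $\partial^i$ for $\partial/\partial\xi_i$, the operator becomes $W(f^*\Gamma) - W(\Gamma)$ with
  $$W(\Gamma) = 3\,\Gamma^i_{jk}\,\partial_i\partial^j\partial^k
    + \xi_a(2\,\Gamma^a_{kt}\Gamma^t_{ij} - \partial_k\Gamma^a_{ij})\,\partial^k\partial^i\partial^j
    + 3\,\Gamma^n_{mi}\Gamma^m_{nj}\,\partial^i\partial^j.$$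
  While $W$ depends on the coordinates, $W(\Gamma') - W(\Gamma)$ does not, and the cocycle identity
  is the additivity of differences.

  If the cocycle were the coboundary of $B$, take a diffeomorphism $F$ that is the identity to first
  but not to second order at a point $p$. The lift of $F$ changes $(x^a - p^a)\,\xi_a\xi_a$ only by terms
  vanishing to fourth order at $(p, 0)$, which $B$ does not see there, whereas the operator
  takes the value $6\,\partial_a\partial_a F^a(p)$.
\<close>


section \<open>Directional derivatives and smooth functions\<close>

text \<open>The factor 3/2 makes the operator a difference. With \<delta> = \<Gamma>' - \<Gamma>,
  the connection terms inside the third covariant derivatives contribute 6 \<delta>\<Gamma> to the
  coefficient of the fibre Hessian, the quadratic term of the operator contributes 3
  \<delta>\<delta>, and after contraction 3 (2 \<delta>\<Gamma> + \<delta>\<delta>) is 3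
  (\<Gamma>'\<Gamma>' - \<Gamma>\<Gamma>). The obstacle is that no single term of W is invariant:
  base derivatives of a fibre Hessian, derivatives of \<Gamma> and traces of \<Gamma>\<Gamma> all
  pick up second derivatives of the coordinate change. Naturality is therefore stated for pairs of
  connections, whose common inhomogeneous terms drop out, and the remaining corrections of all three
  terms cancel only jointly. Coordinate changes of the bundle are lifts of the identity between two
  charts, so independence of the chart is a special case of naturality. The value 6 is the
  coefficient 3 times the factor 2 from differentiating \<xi>_a \<xi>_a twice; with the cut-off
  needed to extend everything to the manifold, it is further multiplied by the bump.\<close>

definition dd :: "'a::real_normed_vector \<Rightarrow> ('a \<Rightarrow> 'b::real_normed_vector) \<Rightarrow> 'a \<Rightarrow> 'b" where
  "dd v f x = frechet_derivative f (at x) v"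

lemma dd_eqI: "(f has_derivative f') (at x) \<Longrightarrow> dd v f x = f' v"
  unfolding dd_def using frechet_derivative_at by metis

lemma has_derivative_dd: "f differentiable (at x) \<Longrightarrow> (f has_derivative (\<lambda>v. dd v f x)) (at x)"
  unfolding dd_def by (simp add: frechet_derivative_works[symmetric])

lemma dd_linear: "f differentiable (at x) \<Longrightarrow> linear (\<lambda>v. dd v f x)"
  using has_derivative_dd has_derivative_linear by blast

lemma Ck_on_Suc: "Ck_on (Suc k) S f \<longleftrightarrow> (\<forall>x\<in>S. f differentiable (at x)) \<and> (\<forall>v. Ck_on k S (dd v f))"
  by (simp add: dd_def[abs_def])

declare Ck_on.simps(2) [simp del]

lemma partial_dd: "partial i h = dd (axis i 1) h"
  by (simp add: partial_def[abs_def] dd_def[abs_def])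

text \<open>\<open>frechet_derivative\<close> is a choice governed by the predicate
  \<open>has_derivative\<close>, so functions that agree near the point get the same value, whether
  or not a derivative exists.\<close>

lemma dd_cong:
  assumes "open S" "x \<in> S" "\<And>y. y \<in> S \<Longrightarrow> f y = g y"
  shows "dd v f x = dd v g x"
proof -
  have "(f has_derivative f') (at x) \<longleftrightarrow> (g has_derivative f') (at x)" for f'
    using assms by (metis has_derivative_transform_within_open)
  then show ?thesis
    by (simp add: dd_def frechet_derivative_def)
qed

lemma differentiable_cong:
  assumes "open S" "x \<in> S" "\<And>y. y \<in> S \<Longrightarrow> f y = g y" "f differentiable (at x)"
  shows "g differentiable (at x)"
  using assms unfolding differentiable_def by (metis has_derivative_transform_within_open)

lemma Ck_on_cong:
  assumes "open S" "\<And>y. y \<in> S \<Longrightarrow> f y = g y" "Ck_on k S f"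
  shows "Ck_on k S g"
  using assms(2,3)
proof (induction k arbitrary: f g)
  case 0
  then show ?case by (simp cong: continuous_on_cong)
next
  case (Suc k)
  have "g differentiable (at x)" if "x \<in> S" for x
    using differentiable_cong[OF assms(1) that Suc.prems(1)] Suc.prems(2) that by (auto simp: Ck_on_Suc)
  moreover have "Ck_on k S (dd v g)" for v
    using Suc.IH[of "dd v f" "dd v g"] dd_cong[OF assms(1) _ Suc.prems(1)] Suc.prems(2)
    by (auto simp: Ck_on_Suc)
  ultimately show ?case by (auto simp: Ck_on_Suc)
qed

lemma Ck_on_subset: "Ck_on k S f \<Longrightarrow> T \<subseteq> S \<Longrightarrow> Ck_on k T f"
  by (induction k arbitrary: f) (auto simp: Ck_on_Suc intro: continuous_on_subset)

lemma Ck_on_SucD: "Ck_on (Suc k) S f \<Longrightarrow> Ck_on k S f"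
proof (induction k arbitrary: f)
  case 0
  then show ?case
    by (auto simp: Ck_on_Suc intro!: continuous_at_imp_continuous_on differentiable_imp_continuous_within)
next
  case (Suc k)
  then show ?case by (auto simp: Ck_on_Suc)
qed

lemma Ck_on_local:
  assumes "\<And>x. x \<in> S \<Longrightarrow> \<exists>T. open T \<and> x \<in> T \<and> Ck_on k T f"
  shows "Ck_on k S f"
  using assms
proof (induction k arbitrary: f)
  case 0
  then show ?case
    by (metis Ck_on.simps(1) continuous_at_imp_continuous_on continuous_on_eq_continuous_at)
next
  case (Suc k)
  have "f differentiable (at x)" if "x \<in> S" for x
    using Suc.prems[OF that] by (auto simp: Ck_on_Suc)
  moreover have "Ck_on k S (dd v f)" for v
    by (rule Suc.IH) (use Suc.prems in \<open>meson Ck_on_Suc\<close>)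
  ultimately show ?case by (simp add: Ck_on_Suc)
qed

lemma Ck_on_const: "Ck_on k S (\<lambda>x. c)"
proof (induction k arbitrary: c)
  case (Suc k)
  have "dd v (\<lambda>x. c) = (\<lambda>x. 0)" for v :: 'a
    by (rule ext, rule dd_eqI) simp
  then show ?case using Suc by (simp add: Ck_on_Suc)
qed simp

lemma dd_const [simp]: "dd v (\<lambda>x. c) = (\<lambda>x. 0)"
  by (rule ext, rule dd_eqI) simp

lemma dd_bounded_linear: "bounded_linear f \<Longrightarrow> dd v f = (\<lambda>x. f v)"
  by (rule ext, rule dd_eqI) (simp add: bounded_linear_imp_has_derivative)

lemma Ck_on_bounded_linear: "bounded_linear f \<Longrightarrow> Ck_on k S f"
  by (cases k) (auto simp: Ck_on_Suc dd_bounded_linear Ck_on_const linear_continuous_on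
      bounded_linear_imp_differentiable)

lemma dd_add:
  assumes "f differentiable (at x)" "g differentiable (at x)"
  shows "dd v (\<lambda>x. f x + g x) x = dd v f x + dd v g x"
  by (rule dd_eqI) (intro has_derivative_add has_derivative_dd assms)

lemma dd_diff:
  assumes "f differentiable (at x)" "g differentiable (at x)"
  shows "dd v (\<lambda>x. f x - g x) x = dd v f x - dd v g x"
  by (rule dd_eqI) (intro has_derivative_diff has_derivative_dd assms)

lemma dd_sum:
  assumes "\<And>i. i \<in> I \<Longrightarrow> f i differentiable (at x)"
  shows "dd v (\<lambda>x. \<Sum>i\<in>I. f i x) x = (\<Sum>i\<in>I. dd v (f i) x)"
  by (rule dd_eqI) (intro has_derivative_sum has_derivative_dd assms)

lemma dd_bilinear:
  assumes "bounded_bilinear pr" "f differentiable (at x)" "g differentiable (at x)"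
  shows "dd v (\<lambda>x. pr (f x) (g x)) x = pr (dd v f x) (g x) + pr (f x) (dd v g x)"
  using dd_eqI[OF bounded_bilinear.FDERIV[OF assms(1) has_derivative_dd[OF assms(2)] has_derivative_dd[OF assms(3)]]]
  by (simp add: add.commute)

lemma dd_mult:
  fixes f g :: "'a::real_normed_vector \<Rightarrow> 'b::real_normed_algebra"
  assumes "f differentiable (at x)" "g differentiable (at x)"
  shows "dd v (\<lambda>x. f x * g x) x = dd v f x * g x + f x * dd v g x"
  by (rule dd_bilinear[OF bounded_bilinear_mult assms])

lemma dd_compose:
  assumes "g differentiable (at x)" "f differentiable (at (g x))"
  shows "dd v (\<lambda>x. f (g x)) x = dd (dd v g x) f (g x)"
  by (rule dd_eqI) (intro has_derivative_compose[OF has_derivative_dd has_derivative_dd] assms)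

lemma dd_linear_compose:
  assumes "bounded_linear L" "f differentiable (at x)"
  shows "dd v (\<lambda>x. L (f x)) x = L (dd v f x)"
  by (rule dd_eqI) (intro bounded_linear.has_derivative[OF assms(1)] has_derivative_dd assms)

lemma differentiable_bilinear:
  assumes "bounded_bilinear pr" "f differentiable (at x)" "g differentiable (at x)"
  shows "(\<lambda>x. pr (f x) (g x)) differentiable (at x)"
  using bounded_bilinear.FDERIV[OF assms(1) has_derivative_dd[OF assms(2)] has_derivative_dd[OF assms(3)]]
  by (auto simp: differentiable_def)

lemma Ck_on_add: "open S \<Longrightarrow> Ck_on k S f \<Longrightarrow> Ck_on k S g \<Longrightarrow> Ck_on k S (\<lambda>x. f x + g x)"
proof (induction k arbitrary: f g)
  case 0
  then show ?case by (simp add: continuous_on_add)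
next
  case (Suc k)
  have "Ck_on k S (dd v (\<lambda>x. f x + g x))" for v
  proof (rule Ck_on_cong[OF \<open>open S\<close>])
    show "Ck_on k S (\<lambda>x. dd v f x + dd v g x)"
      by (intro Suc.IH) (use Suc.prems in \<open>simp_all add: Ck_on_Suc\<close>)
    show "dd v f y + dd v g y = dd v (\<lambda>x. f x + g x) y" if "y \<in> S" for y
      using dd_add[of f y g v] Suc.prems that by (simp add: Ck_on_Suc)
  qed
  then show ?case using Suc.prems by (simp add: Ck_on_Suc)
qed

text \<open>Multiplication, scalar multiplication and the inner product are all instances, so the
  product rule is proved once for an arbitrary bounded bilinear \<open>pr\<close>.\<close>

lemma Ck_on_bilinear:
  assumes "bounded_bilinear pr" "open S"
  shows "Ck_on k S f \<Longrightarrow> Ck_on k S g \<Longrightarrow> Ck_on k S (\<lambda>x. pr (f x) (g x))"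
proof (induction k arbitrary: f g)
  case 0
  then show ?case using assms by (simp add: bounded_bilinear.continuous_on)
next
  case (Suc k)
  have "Ck_on k S (dd v (\<lambda>x. pr (f x) (g x)))" for v
  proof (rule Ck_on_cong[OF assms(2)])
    have "Ck_on k S (dd v f)" "Ck_on k S (dd v g)" using Suc.prems by (simp_all add: Ck_on_Suc)
    then show "Ck_on k S (\<lambda>x. pr (dd v f x) (g x) + pr (f x) (dd v g x))"
      using Ck_on_SucD[OF Suc.prems(1)] Ck_on_SucD[OF Suc.prems(2)]
      by (intro Ck_on_add assms(2) Suc.IH)
    show "pr (dd v f y) (g y) + pr (f y) (dd v g y) = dd v (\<lambda>x. pr (f x) (g x)) y" if "y \<in> S" for y
      using dd_bilinear[OF assms(1), of f y g v] Suc.prems that by (simp add: Ck_on_Suc)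
  qed
  then show ?case using Suc.prems by (simp add: Ck_on_Suc differentiable_bilinear[OF assms(1)])
qed

lemma Ck_on_sum: "open S \<Longrightarrow> (\<And>i. i \<in> I \<Longrightarrow> Ck_on k S (f i)) \<Longrightarrow> Ck_on k S (\<lambda>x. \<Sum>i\<in>I. f i x)"
  by (induction I rule: infinite_finite_induct) (auto intro: Ck_on_const Ck_on_add)

lemma dd_expand:
  fixes f :: "'a::euclidean_space \<Rightarrow> 'b::real_normed_vector"
  assumes "f differentiable (at x)"
  shows "dd v f x = (\<Sum>b\<in>Basis. (v \<bullet> b) *\<^sub>R dd b f x)"
proof -
  interpret linear "\<lambda>v. dd v f x" by (rule dd_linear[OF assms])
  have "dd v f x = dd (\<Sum>b\<in>Basis. (v \<bullet> b) *\<^sub>R b) f x" by (simp add: euclidean_representation)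
  then show ?thesis by (simp add: sum scaleR)
qed

text \<open>The chain rule produces a derivative of \<open>f\<close> in the direction
  \<open>dd v g y\<close>, which varies with \<open>y\<close>. Expanding it in the basis leaves
  derivatives in fixed directions, to which the induction hypothesis applies; this is why
  \<open>g\<close> takes values in a Euclidean space.\<close>

lemma Ck_on_compose:
  fixes g :: "'a::real_normed_vector \<Rightarrow> 'b::euclidean_space"
  assumes "open S" "open T" "\<And>x. x \<in> S \<Longrightarrow> g x \<in> T"
  shows "Ck_on k T f \<Longrightarrow> Ck_on k S g \<Longrightarrow> Ck_on k S (\<lambda>x. f (g x))"
proof (induction k arbitrary: f)
  case 0
  then show ?case using assms
    by (auto intro!: continuous_on_compose2[of T f S g])
next
  case (Suc k)
  have d: "f differentiable (at (g x))" "g differentiable (at x)" if "x \<in> S" for x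
    using Suc.prems assms that by (auto simp: Ck_on_Suc)
  have "Ck_on k S (dd v (\<lambda>x. f (g x)))" for v
  proof (rule Ck_on_cong[OF assms(1)])
    show "(\<Sum>b\<in>Basis. (dd v g y \<bullet> b) *\<^sub>R dd b f (g y)) = dd v (\<lambda>x. f (g x)) y" if "y \<in> S" for y
      using dd_compose[OF d(2,1)[OF that], of v] dd_expand[OF d(1)[OF that], of "dd v g y"] by simp
    show "Ck_on k S (\<lambda>y. \<Sum>b\<in>Basis. (dd v g y \<bullet> b) *\<^sub>R dd b f (g y))"
    proof (intro Ck_on_sum assms Ck_on_bilinear[OF bounded_bilinear_scaleR]
        Ck_on_bilinear[OF bounded_bilinear_inner] Ck_on_const)
      show "Ck_on k S (dd v g)" using Suc.prems by (auto simp: Ck_on_Suc)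
      show "Ck_on k S (\<lambda>y. dd b f (g y))" for b
        using Suc.IH[of "dd b f"] Suc.prems Ck_on_SucD by (auto simp: Ck_on_Suc)
    qed
  qed
  then show ?case using d by (auto simp: Ck_on_Suc intro: differentiable_compose)
qed

section \<open>Smooth functions on open sets\<close>

lemma smooth_on_iff:
  "smooth_on S f \<longleftrightarrow> (\<forall>x\<in>S. f differentiable (at x)) \<and> (\<forall>v. smooth_on S (dd v f))"
proof
  assume "smooth_on S f"
  then have "Ck_on (Suc k) S f" for k by (simp add: smooth_on_def)
  then show "(\<forall>x\<in>S. f differentiable (at x)) \<and> (\<forall>v. smooth_on S (dd v f))"
    by (auto simp: smooth_on_def Ck_on_Suc)
next
  assume "(\<forall>x\<in>S. f differentiable (at x)) \<and> (\<forall>v. smooth_on S (dd v f))"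
  then have "Ck_on (Suc k) S f" for k by (auto simp: smooth_on_def Ck_on_Suc)
  then show "smooth_on S f" unfolding smooth_on_def using Ck_on_SucD by blast
qed

lemma smooth_on_dd: "smooth_on S f \<Longrightarrow> smooth_on S (dd v f)"
  using smooth_on_iff by blast

lemma smooth_on_differentiable: "smooth_on S f \<Longrightarrow> x \<in> S \<Longrightarrow> f differentiable (at x)"
  using smooth_on_iff by blast

lemma smooth_on_continuous_on: "smooth_on S f \<Longrightarrow> continuous_on S f"
  unfolding smooth_on_def using Ck_on.simps(1) by blast

lemma smooth_on_cong:
  "open S \<Longrightarrow> smooth_on S f \<Longrightarrow> (\<And>y. y \<in> S \<Longrightarrow> f y = g y) \<Longrightarrow> smooth_on S g"
  unfolding smooth_on_def using Ck_on_cong by blast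

lemma smooth_on_subset: "smooth_on S f \<Longrightarrow> T \<subseteq> S \<Longrightarrow> smooth_on T f"
  unfolding smooth_on_def using Ck_on_subset by blast

text \<open>Smoothness on the manifold is checked point by point, in charts that depend on the
  point; this glues the results.\<close>

lemma smooth_on_local:
  assumes "\<And>x. x \<in> S \<Longrightarrow> \<exists>T. open T \<and> x \<in> T \<and> smooth_on T f"
  shows "smooth_on S f"
  using assms Ck_on_local unfolding smooth_on_def by metis

lemma smooth_on_const: "smooth_on S (\<lambda>x. c)"
  by (simp add: smooth_on_def Ck_on_const)

lemma smooth_on_bounded_linear: "bounded_linear f \<Longrightarrow> smooth_on S f"
  by (simp add: smooth_on_def Ck_on_bounded_linear)

lemma smooth_on_ident: "smooth_on S (\<lambda>x. x)"
  by (simp add: smooth_on_bounded_linear bounded_linear_ident)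

lemma smooth_on_bilinear:
  "bounded_bilinear pr \<Longrightarrow> open S \<Longrightarrow> smooth_on S f \<Longrightarrow> smooth_on S g \<Longrightarrow> smooth_on S (\<lambda>x. pr (f x) (g x))"
  by (simp add: smooth_on_def Ck_on_bilinear)

lemma smooth_on_add:
  "open S \<Longrightarrow> smooth_on S f \<Longrightarrow> smooth_on S g \<Longrightarrow> smooth_on S (\<lambda>x. f x + g x)"
  by (simp add: smooth_on_def Ck_on_add)

lemma smooth_on_mult:
  fixes f g :: "'a::real_normed_vector \<Rightarrow> 'b::real_normed_algebra"
  shows "open S \<Longrightarrow> smooth_on S f \<Longrightarrow> smooth_on S g \<Longrightarrow> smooth_on S (\<lambda>x. f x * g x)"
  by (rule smooth_on_bilinear[OF bounded_bilinear_mult])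

lemma smooth_on_scaleR:
  "open S \<Longrightarrow> smooth_on S f \<Longrightarrow> smooth_on S g \<Longrightarrow> smooth_on S (\<lambda>x. f x *\<^sub>R g x)"
  by (rule smooth_on_bilinear[OF bounded_bilinear_scaleR])

lemma smooth_on_sum:
  "open S \<Longrightarrow> (\<And>i. i \<in> I \<Longrightarrow> smooth_on S (f i)) \<Longrightarrow> smooth_on S (\<lambda>x. \<Sum>i\<in>I. f i x)"
  by (simp add: smooth_on_def Ck_on_sum)

lemma smooth_on_compose:
  fixes g :: "'a::real_normed_vector \<Rightarrow> 'b::euclidean_space"
  assumes "open S" "open T" "\<And>x. x \<in> S \<Longrightarrow> g x \<in> T" "smooth_on T f" "smooth_on S g"
  shows "smooth_on S (\<lambda>x. f (g x))"
  using assms Ck_on_compose unfolding smooth_on_def by metis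

lemma smooth_on_linear_compose:
  assumes "bounded_linear (L :: 'b::euclidean_space \<Rightarrow> 'c::real_normed_vector)" "open S" "smooth_on S f"
  shows "smooth_on S (\<lambda>x. L (f x))"
  by (rule smooth_on_compose[where T = UNIV]) (use assms smooth_on_bounded_linear in auto)

lemma smooth_on_diff:
  assumes "open S" "smooth_on S f" "smooth_on S g"
  shows "smooth_on S (\<lambda>x. f x - g x)"
  using smooth_on_add[OF assms(1,2) smooth_on_scaleR[OF assms(1) smooth_on_const[of _ "- 1"] assms(3)]]
  by simp

lemma smooth_on_component:
  fixes f :: "'a::real_normed_vector \<Rightarrow> real^'n::finite"
  assumes "open S" "smooth_on S f"
  shows "smooth_on S (\<lambda>x. f x $ i)"
  by (rule smooth_on_linear_compose[OF bounded_linear_vec_nth assms])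

lemma smooth_on_vec:
  fixes f :: "'a::real_normed_vector \<Rightarrow> real^'n::finite"
  assumes "open S" "\<And>i. smooth_on S (\<lambda>x. f x $ i)"
  shows "smooth_on S f"
proof -
  have "smooth_on S (\<lambda>x. \<Sum>i\<in>UNIV. f x $ i *\<^sub>R axis i 1 :: real^'n)"
    by (intro smooth_on_sum smooth_on_scaleR assms smooth_on_const)
  moreover have "(\<Sum>i\<in>UNIV. f x $ i *\<^sub>R axis i 1) = f x" for x
    using basis_expansion[of "f x"] by (simp add: scalar_mult_eq_scaleR)
  ultimately show ?thesis by simp
qed

text \<open>The derivative -v / x^2 is a constant times the product of \<open>inverse\<close> with
  itself, so class C^k passes on to class C^(k+1).\<close>

lemma Ck_on_inverse: "Ck_on k {x::real. x \<noteq> 0} inverse"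
proof (induction k)
  case 0
  then show ?case by (auto intro: continuous_on_inverse)
next
  case (Suc k)
  have o: "open {x::real. x \<noteq> 0}" by (simp add: open_Collect_neq)
  have d: "(inverse has_derivative (\<lambda>v. - (inverse x * v * inverse x))) (at x)" if "x \<noteq> 0" for x :: real
    using that by (auto intro!: derivative_eq_intros)
  have "Ck_on k {x::real. x \<noteq> 0} (dd v inverse)" for v :: real
  proof (rule Ck_on_cong[OF o])
    show "Ck_on k {x::real. x \<noteq> 0} (\<lambda>x. (- v) * (inverse x * inverse x))"
      by (intro Ck_on_bilinear[OF bounded_bilinear_mult o] Suc Ck_on_const)
  qed (simp add: dd_eqI[OF d])
  then show ?case using d by (auto simp: Ck_on_Suc differentiable_def)
qed

lemma smooth_on_inverse:
  fixes f :: "'a::real_normed_vector \<Rightarrow> real"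
  assumes "open S" "smooth_on S f" "\<And>x. x \<in> S \<Longrightarrow> f x \<noteq> 0"
  shows "smooth_on S (\<lambda>x. inverse (f x))"
  by (rule smooth_on_compose[where T = "{x. x \<noteq> 0}"])
    (use assms Ck_on_inverse in \<open>auto simp: open_Collect_neq smooth_on_def\<close>)

lemma dd_component:
  fixes f :: "'a::real_normed_vector \<Rightarrow> real^'n::finite"
  assumes "f differentiable (at x)"
  shows "dd v (\<lambda>x. f x $ i) x = dd v f x $ i"
  by (rule dd_linear_compose[OF bounded_linear_vec_nth assms])

lemma dd_scaleR_left: "f differentiable (at x) \<Longrightarrow> dd (c *\<^sub>R v) f x = c *\<^sub>R dd v f x"
  using linear_cmul[OF dd_linear] by blast

lemma dd_add_left: "f differentiable (at x) \<Longrightarrow> dd (v + w) f x = dd v f x + dd w f x"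
  using linear_add[OF dd_linear] by blast

lemma dd_expand_axis:
  fixes f :: "real^'n::finite \<Rightarrow> 'b::real_normed_vector"
  assumes "f differentiable (at x)"
  shows "dd v f x = (\<Sum>i\<in>UNIV. v $ i *\<^sub>R dd (axis i 1) f x)"
proof -
  interpret linear "\<lambda>v. dd v f x" by (rule dd_linear[OF assms])
  have "dd v f x = dd (\<Sum>i\<in>UNIV. (v $ i) *\<^sub>R axis i 1) f x"
    using basis_expansion[of v] by (simp add: scalar_mult_eq_scaleR)
  then show ?thesis by (simp only: sum scaleR)
qed

text \<open>Both iterated derivatives are limits of the same second difference quotient.\<close>

lemma second_difference_mvt:
  fixes f :: "'a::real_normed_vector \<Rightarrow> real"
  assumes "s > 0" "t > 0"
    and d1: "\<And>a b. 0 \<le> a \<Longrightarrow> a \<le> s \<Longrightarrow> 0 \<le> b \<Longrightarrow> b \<le> t \<Longrightarrow> f differentiable (at (x + a *\<^sub>R v + b *\<^sub>R w))"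
    and d2: "\<And>a b. 0 \<le> a \<Longrightarrow> a \<le> s \<Longrightarrow> 0 \<le> b \<Longrightarrow> b \<le> t \<Longrightarrow> dd v f differentiable (at (x + a *\<^sub>R v + b *\<^sub>R w))"
  shows "\<exists>a b. 0 < a \<and> a < s \<and> 0 < b \<and> b < t \<and>
    f (x + s *\<^sub>R v + t *\<^sub>R w) - f (x + s *\<^sub>R v) - f (x + t *\<^sub>R w) + f x
      = s * t * dd w (dd v f) (x + a *\<^sub>R v + b *\<^sub>R w)"
proof -
  define g where "g a = f (x + a *\<^sub>R v + t *\<^sub>R w) - f (x + a *\<^sub>R v)" for a
  define g' where "g' a = dd v f (x + a *\<^sub>R v + t *\<^sub>R w) - dd v f (x + a *\<^sub>R v)" for a
  have line: "((\<lambda>a. h (y + a *\<^sub>R u)) has_real_derivative dd u h (y + a *\<^sub>R u)) (at a)"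
    if "h differentiable (at (y + a *\<^sub>R u))" for h :: "'a \<Rightarrow> real" and y u a
  proof -
    have "((\<lambda>a. y + a *\<^sub>R u) has_derivative (\<lambda>r. r *\<^sub>R u)) (at a)"
      by (auto intro!: derivative_eq_intros)
    from has_derivative_compose[OF this has_derivative_dd[OF that]]
    have "((\<lambda>a. h (y + a *\<^sub>R u)) has_derivative (\<lambda>r. dd (r *\<^sub>R u) h (y + a *\<^sub>R u))) (at a)" .
    then show ?thesis using that
      by (simp add: has_field_derivative_def dd_scaleR_left mult.commute[of _ "dd u h (y + a *\<^sub>R u)"] mult_commute_abs)
  qed
  have eq: "x + a *\<^sub>R v + b *\<^sub>R w = (x + b *\<^sub>R w) + a *\<^sub>R v" for a b by simp
  have g: "(g has_real_derivative g' a) (at a)" if "0 \<le> a" "a \<le> s" for a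
  proof -
    have 1: "f differentiable (at ((x + t *\<^sub>R w) + a *\<^sub>R v))"
      using d1[of a t] that assms by (simp add: eq)
    have 2: "f differentiable (at (x + a *\<^sub>R v))"
      using d1[of a 0] that assms by simp
    show ?thesis unfolding g_def g'_def eq
      by (intro DERIV_diff line 1 2)
  qed
  from MVT2[OF \<open>s > 0\<close> g] obtain a where a: "0 < a" "a < s" "g s - g 0 = s * g' a" by auto
  have k: "((\<lambda>b. dd v f (x + a *\<^sub>R v + b *\<^sub>R w)) has_real_derivative
      dd w (dd v f) (x + a *\<^sub>R v + b *\<^sub>R w)) (at b)" if "0 \<le> b" "b \<le> t" for b
    using line[of "dd v f" "x + a *\<^sub>R v" b w] d2[of a b] a that by simp
  from MVT2[OF \<open>t > 0\<close> k] obtain b where b: "0 < b" "b < t"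
    "dd v f (x + a *\<^sub>R v + t *\<^sub>R w) - dd v f (x + a *\<^sub>R v + 0 *\<^sub>R w) = t * dd w (dd v f) (x + a *\<^sub>R v + b *\<^sub>R w)"
    by auto
  then have "g' a = t * dd w (dd v f) (x + a *\<^sub>R v + b *\<^sub>R w)" by (simp add: g'_def)
  then have "g s - g 0 = s * t * dd w (dd v f) (x + a *\<^sub>R v + b *\<^sub>R w)" using a by simp
  then show ?thesis using a b unfolding g_def
    by (intro exI[of _ a] exI[of _ b]) (simp add: algebra_simps)
qed

text \<open>Schwarz's theorem: on a parallelogram so small that both mixed derivatives differ from
  their values at \<open>x\<close> by less than half the gap between these values, the same second
  difference equals \<open>s * s\<close> times either of them at suitable points, which is
  impossible for a positive gap.\<close>

lemma dd_commute_real: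
  fixes f :: "'a::real_normed_vector \<Rightarrow> real"
  assumes "open S" "x \<in> S" "smooth_on S f"
  shows "dd w (dd v f) x = dd v (dd w f) x"
proof (rule ccontr)
  assume ne: "dd w (dd v f) x \<noteq> dd v (dd w f) x"
  define e where "e = \<bar>dd w (dd v f) x - dd v (dd w f) x\<bar> / 2"
  have e: "e > 0" using ne by (simp add: e_def)
  have c: "isCont (dd w (dd v f)) x" "isCont (dd v (dd w f)) x"
    using smooth_on_continuous_on[OF smooth_on_dd[OF smooth_on_dd[OF assms(3)]]]
      assms(1,2) continuous_on_eq_continuous_at by blast+
  have ev: "\<forall>\<^sub>F y in nhds x. y \<in> S" using assms eventually_nhds by blast
  have "\<forall>\<^sub>F y in nhds x. dist (dd w (dd v f) y) (dd w (dd v f) x) < e"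
       "\<forall>\<^sub>F y in nhds x. dist (dd v (dd w f) y) (dd v (dd w f) x) < e"
    using c e unfolding isCont_def tendsto_at_iff_tendsto_nhds by (auto simp: tendsto_iff)
  with ev have "\<forall>\<^sub>F y in nhds x. y \<in> S \<and> dist (dd w (dd v f) y) (dd w (dd v f) x) < e \<and>
      dist (dd v (dd w f) y) (dd v (dd w f) x) < e"
    by eventually_elim auto
  then obtain r where r: "r > 0" "\<And>y. dist y x < r \<Longrightarrow> y \<in> S \<and> dist (dd w (dd v f) y) (dd w (dd v f) x) < e \<and>
      dist (dd v (dd w f) y) (dd v (dd w f) x) < e"
    unfolding eventually_nhds_metric by blast
  \<comment> \<open>The denominator keeps every x + a v + b w with a, b in [0, s] within distance r
    / 2 of x; the summand 1 avoids division by zero.\<close>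
  define s where "s = r / (2 * (norm v + norm w + 1))"
  have s: "s > 0" using r(1) by (simp add: s_def add_nonneg_pos)
  have near: "dist (x + a *\<^sub>R v + b *\<^sub>R w) x < r" if "0 \<le> a" "a \<le> s" "0 \<le> b" "b \<le> s" for a b
  proof -
    have "norm (a *\<^sub>R v + b *\<^sub>R w) \<le> s * norm v + s * norm w"
      using that by (intro norm_triangle_le add_mono) (auto simp: mult_right_mono)
    also have "\<dots> \<le> s * (norm v + norm w + 1)" using s by (simp add: algebra_simps)
    also have "\<dots> = r / 2"
    proof -
      have "norm v + norm w + 1 > 0" by (simp add: add_nonneg_pos)
      then show ?thesis by (simp add: s_def field_simps)
    qed
    finally show ?thesis using r(1) by (simp add: dist_norm add.assoc)
  qed
  have dS: "f differentiable (at y)" "dd u f differentiable (at y)" if "y \<in> S" for u y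
    using assms(3) that smooth_on_dd smooth_on_differentiable by blast+
  obtain a b where ab: "0 < a" "a < s" "0 < b" "b < s"
    "f (x + s *\<^sub>R v + s *\<^sub>R w) - f (x + s *\<^sub>R v) - f (x + s *\<^sub>R w) + f x
      = s * s * dd w (dd v f) (x + a *\<^sub>R v + b *\<^sub>R w)"
    using second_difference_mvt[of s s f x v w] s near r(2) dS by blast
  have near': "dist (x + a *\<^sub>R w + b *\<^sub>R v) x < r" if "0 \<le> a" "a \<le> s" "0 \<le> b" "b \<le> s" for a b
    using near[of b a] that by (simp add: algebra_simps)
  obtain a' b' where ab': "0 < a'" "a' < s" "0 < b'" "b' < s"
    "f (x + s *\<^sub>R w + s *\<^sub>R v) - f (x + s *\<^sub>R w) - f (x + s *\<^sub>R v) + f x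
      = s * s * dd v (dd w f) (x + a' *\<^sub>R w + b' *\<^sub>R v)"
    using second_difference_mvt[of s s f x w v] s near' r(2) dS by blast
  have "s * s * dd w (dd v f) (x + a *\<^sub>R v + b *\<^sub>R w) = s * s * dd v (dd w f) (x + a' *\<^sub>R w + b' *\<^sub>R v)"
    using ab(5) ab'(5) by (simp add: algebra_simps)
  then have eq: "dd w (dd v f) (x + a *\<^sub>R v + b *\<^sub>R w) = dd v (dd w f) (x + a' *\<^sub>R w + b' *\<^sub>R v)"
    using s by simp
  have "dist (dd w (dd v f) (x + a *\<^sub>R v + b *\<^sub>R w)) (dd w (dd v f) x) < e"
    using r(2)[OF near] ab by auto
  moreover have "dist (dd v (dd w f) (x + a' *\<^sub>R w + b' *\<^sub>R v)) (dd v (dd w f) x) < e"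
    using r(2)[OF near'] ab' by auto
  ultimately have "\<bar>dd w (dd v f) x - dd v (dd w f) x\<bar> < 2 * e"
    using eq by (simp add: dist_real_def)
  then show False by (simp add: e_def)
qed

lemma dd_commute:
  fixes f :: "'a::real_normed_vector \<Rightarrow> real^'n::finite"
  assumes "open S" "x \<in> S" "smooth_on S f"
  shows "dd w (dd v f) x = dd v (dd w f) x"
proof -
  have *: "dd a (dd b f) x $ i = dd a (dd b (\<lambda>x. f x $ i)) x" for a b i
  proof -
    have "dd a (dd b (\<lambda>x. f x $ i)) x = dd a (\<lambda>x. dd b f x $ i) x"
      by (rule dd_cong[OF assms(1,2)]) (use assms(3) in \<open>auto intro!: dd_component smooth_on_differentiable\<close>)
    also have "\<dots> = dd a (dd b f) x $ i"
      using assms by (intro dd_component smooth_on_differentiable smooth_on_dd)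
    finally show ?thesis by simp
  qed
  show ?thesis
    by (simp add: vec_eq_iff * dd_commute_real[OF assms(1,2) smooth_on_component[OF assms(1,3)]])
qed


section \<open>Sums over base and fibre indices, and Jacobians\<close>

lemma sum_UNIV_Plus:
  fixes f :: "'n::finite + 'n \<Rightarrow> 'b::comm_monoid_add"
  shows "(\<Sum>b\<in>UNIV. f b) = (\<Sum>i\<in>UNIV. f (Inl i)) + (\<Sum>i\<in>UNIV. f (Inr i))"
  by (simp add: UNIV_Plus_UNIV[symmetric] sum.Plus del: UNIV_Plus_UNIV)

lemma all_Plus: "(\<forall>b. P b) \<longleftrightarrow> (\<forall>i. P (Inl i)) \<and> (\<forall>i. P (Inr i))"
  by (metis sum.exhaust)

lemma smooth_on_inner:
  "open S \<Longrightarrow> smooth_on S f \<Longrightarrow> smooth_on S g \<Longrightarrow> smooth_on S (\<lambda>x. f x \<bullet> g x)"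
  by (rule smooth_on_bilinear[OF bounded_bilinear_inner])

lemma smooth_on_Suc_partial: "smooth_on S f \<Longrightarrow> smooth_on S (partial i f)"
  by (simp add: partial_dd smooth_on_dd)

lemma jacobian_dd:
  fixes f :: "real^'m::finite \<Rightarrow> real^'k::finite"
  assumes "f differentiable (at x)"
  shows "jacobian f (at x) *v X = dd X f x"
  using jacobian_works assms dd_eqI by metis

lemma jacobian_component: "jacobian f (at x) $ i $ j = dd (axis j 1) f x $ i"
  by (simp add: jacobian_def dd_def matrix_def)


section \<open>Pull-backs of connections\<close>

text \<open>The index functions may live on any parameter space, so that one contraction serves for
  Christoffel symbols with a fixed upper index and for the components of a metric.\<close>

definition bil :: "('m::finite \<Rightarrow> 'm \<Rightarrow> 'a \<Rightarrow> real) \<Rightarrow> 'a \<Rightarrow> real^'m \<Rightarrow> real^'m \<Rightarrow> real" where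
  "bil h u X Y = (\<Sum>i\<in>UNIV. \<Sum>j\<in>UNIV. h i j u * X $ i * Y $ j)"

text \<open>The Christoffel symbols as a vector-valued bilinear map; vectors X, Y in place of
  indices turn most index sums into linear algebra.\<close>

definition cvec :: "'m::finite christoffel \<Rightarrow> real^'m \<Rightarrow> real^'m \<Rightarrow> real^'m \<Rightarrow> real^'m" where
  "cvec \<Gamma> u X Y = (\<chi> k. bil (\<Gamma> k) u X Y)"

lemma bil_axis: "bil h u (axis i 1) (axis j 1) = h i j u"
proof -
  have "h a b u * axis i 1 $ a * axis j 1 $ b = (if b = j then (if a = i then h i j u else 0) else 0)" for a b
    by (simp add: axis_def)
  then show ?thesis by (simp add: bil_def)
qed

lemma cvec_axis: "cvec \<Gamma> u (axis i 1) (axis j 1) $ k = \<Gamma> k i j u"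
  by (simp add: cvec_def bil_axis)

lemma bil_linear:
  "linear (\<lambda>X. bil h u X Y)" "linear (\<lambda>Y. bil h u X Y)"
  by (auto simp: linear_iff bil_def algebra_simps sum.distrib sum_distrib_left)

lemma cvec_linear:
  "linear (\<lambda>X. cvec h u X Y)" "linear (\<lambda>Y. cvec h u X Y)"
  using linear_add[OF bil_linear(1)] linear_cmul[OF bil_linear(1)]
    linear_add[OF bil_linear(2)] linear_cmul[OF bil_linear(2)]
  by (auto simp: linear_iff cvec_def vec_eq_iff)

lemma bil_commute: "(\<And>i j. h i j u = h j i u) \<Longrightarrow> bil h u X Y = bil h u Y X"
  unfolding bil_def by (subst sum.swap) (simp add: mult_ac)

lemma cvec_commute: "(\<And>k i j. \<Gamma> k i j u = \<Gamma> k j i u) \<Longrightarrow> cvec \<Gamma> u X Y = cvec \<Gamma> u Y X"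
  unfolding cvec_def vec_eq_iff by (simp add: bil_commute[of "\<Gamma> _" u X Y])

text \<open>The product rule for a bilinear form evaluated along a map \<open>F\<close> on moving
  vectors, the shape in which a pulled-back metric is differentiated.\<close>

lemma dd_bil:
  fixes F :: "'a::euclidean_space \<Rightarrow> 'b::euclidean_space"
  assumes h: "\<And>i j. h i j differentiable (at (F w))"
    and F: "F differentiable (at w)" and A: "A differentiable (at w)" and B: "B differentiable (at w)"
  shows "dd Z (\<lambda>w. bil h (F w) (A w) (B w)) w =
    bil (\<lambda>i j. dd (dd Z F w) (h i j)) (F w) (A w) (B w)
    + bil h (F w) (dd Z A w) (B w) + bil h (F w) (A w) (dd Z B w)"
proof -
  have comp: "(\<lambda>w. A w $ i) differentiable (at w)" "(\<lambda>w. B w $ i) differentiable (at w)" for i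
    using A B by (auto simp: differentiable_def intro: bounded_linear.has_derivative[OF bounded_linear_vec_nth])
  have hF: "(\<lambda>w. h i j (F w)) differentiable (at w)" for i j
    using differentiable_compose[OF h F] .
  show ?thesis unfolding bil_def
    by (simp add: dd_sum dd_mult dd_compose[OF F h] dd_component[OF A] dd_component[OF B] comp hF
        algebra_simps sum.distrib)
qed

text \<open>The inverse and both open sets are arguments, so that smoothness of the inverse is part
  of the data and the notion is symmetric under exchanging the two maps.\<close>

definition diffeo_on ::
  "(real^'m::finite \<Rightarrow> real^'m) \<Rightarrow> (real^'m \<Rightarrow> real^'m) \<Rightarrow> (real^'m) set \<Rightarrow> (real^'m) set \<Rightarrow> bool" where
  "diffeo_on \<phi> \<psi> S T \<longleftrightarrow> open S \<and> open T \<and> smooth_on S \<phi> \<and> smooth_on T \<psi> \<and>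
     (\<forall>x\<in>S. \<phi> x \<in> T \<and> \<psi> (\<phi> x) = x) \<and> (\<forall>y\<in>T. \<psi> y \<in> S \<and> \<phi> (\<psi> y) = y)"

lemma diffeo_on_sym: "diffeo_on \<phi> \<psi> S T \<Longrightarrow> diffeo_on \<psi> \<phi> T S"
  by (auto simp: diffeo_on_def)

lemma diffeo_onD:
  assumes "diffeo_on \<phi> \<psi> S T"
  shows "open S" "open T" "smooth_on S \<phi>" "smooth_on T \<psi>"
    "x \<in> S \<Longrightarrow> \<phi> x \<in> T" "x \<in> S \<Longrightarrow> \<psi> (\<phi> x) = x"
    "x \<in> S \<Longrightarrow> \<phi> differentiable (at x)" "x \<in> S \<Longrightarrow> \<psi> differentiable (at (\<phi> x))"
  using assms by (auto simp: diffeo_on_def intro: smooth_on_differentiable)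

lemma diffeo_on_compose:
  assumes "diffeo_on \<phi> \<psi> S T" "diffeo_on \<phi>' \<psi>' T R"
  shows "diffeo_on (\<lambda>x. \<phi>' (\<phi> x)) (\<lambda>x. \<psi> (\<psi>' x)) S R"
  using assms unfolding diffeo_on_def
  by (auto intro: smooth_on_compose[of S T \<phi> \<phi>'] smooth_on_compose[of R T \<psi>' \<psi>])

lemma dd_inverse:
  assumes "diffeo_on \<phi> \<psi> S T" "x \<in> S"
  shows "dd (dd X \<phi> x) \<psi> (\<phi> x) = X"
proof -
  note D = diffeo_onD[OF assms(1)]
  have "dd (dd X \<phi> x) \<psi> (\<phi> x) = dd X (\<lambda>x. \<psi> (\<phi> x)) x"
    using dd_compose[OF D(7,8)[OF assms(2)]] by simp
  also have "\<dots> = dd X (\<lambda>x. x) x" by (rule dd_cong[OF D(1) assms(2)]) (rule D(6))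
  also have "\<dots> = X" by (simp add: dd_bounded_linear bounded_linear_ident)
  finally show ?thesis .
qed

lemma dd_inverse':
  assumes "diffeo_on \<phi> \<psi> S T" "x \<in> S"
  shows "dd (dd X \<psi> (\<phi> x)) \<phi> x = X"
  using dd_inverse[OF diffeo_on_sym[OF assms(1)] diffeo_onD(5)[OF assms]] diffeo_onD(6)[OF assms] by simp

text \<open>A chain rule in which the direction \<open>A x\<close> itself varies: expanded in the
  axes, each summand is a product of a moving coefficient and a derivative in a fixed
  direction.\<close>

lemma dd_dd_compose:
  fixes f :: "real^'m::finite \<Rightarrow> 'b::real_normed_vector" and g :: "'a::real_normed_vector \<Rightarrow> real^'m"
  assumes "open S" "x \<in> S" "open T" "smooth_on T f" "\<And>x. x \<in> S \<Longrightarrow> g x \<in> T"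
    and g: "g differentiable (at x)" and A: "A differentiable (at x)"
  shows "dd X (\<lambda>x. dd (A x) f (g x)) x = dd (dd X A x) f (g x) + dd (dd X g x) (dd (A x) f) (g x)"
proof -
  have y: "g x \<in> T" using assms by auto
  have h2: "dd (axis i 1) f differentiable (at (g x))" for i
    using smooth_on_differentiable[OF smooth_on_dd[OF assms(4)] y] .
  have h1: "(\<lambda>x. dd (axis i 1) f (g x)) differentiable (at x)" for i
    by (rule differentiable_compose[OF h2 g])
  have c: "(\<lambda>x. A x $ i) differentiable (at x)" for i
    using A by (auto simp: differentiable_def intro: bounded_linear.has_derivative[OF bounded_linear_vec_nth])
  have e: "dd V f y = (\<Sum>i\<in>UNIV. V $ i *\<^sub>R dd (axis i 1) f y)" if "y \<in> T" for V y
    using dd_expand_axis smooth_on_differentiable[OF assms(4) that] by blast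
  have sc: "(\<lambda>y. r *\<^sub>R dd (axis i 1) f y) differentiable (at (g x))" for r i
    by (rule differentiable_bilinear[OF bounded_bilinear_scaleR]) (simp_all add: h2)
  have "dd X (\<lambda>x. dd (A x) f (g x)) x = dd X (\<lambda>x. \<Sum>i\<in>UNIV. A x $ i *\<^sub>R dd (axis i 1) f (g x)) x"
    by (rule dd_cong[OF assms(1,2)]) (rule e[OF assms(5)])
  also have "\<dots> = (\<Sum>i\<in>UNIV. dd X A x $ i *\<^sub>R dd (axis i 1) f (g x)
      + A x $ i *\<^sub>R dd (dd X g x) (dd (axis i 1) f) (g x))"
  proof (subst dd_sum)
    show "(\<lambda>x. A x $ i *\<^sub>R dd (axis i 1) f (g x)) differentiable at x" for i
      by (rule differentiable_bilinear[OF bounded_bilinear_scaleR c h1])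
    show "(\<Sum>i\<in>UNIV. dd X (\<lambda>x. A x $ i *\<^sub>R dd (axis i 1) f (g x)) x) =
      (\<Sum>i\<in>UNIV. dd X A x $ i *\<^sub>R dd (axis i 1) f (g x)
        + A x $ i *\<^sub>R dd (dd X g x) (dd (axis i 1) f) (g x))"
      by (rule sum.cong[OF refl], subst dd_bilinear[OF bounded_bilinear_scaleR c h1])
        (simp only: dd_component[OF A] dd_compose[OF g h2])
  qed
  also have "\<dots> = dd (dd X A x) f (g x)
      + (\<Sum>i\<in>UNIV. A x $ i *\<^sub>R dd (dd X g x) (dd (axis i 1) f) (g x))"
    by (simp only: sum.distrib e[OF y, of "dd X A x"])
  also have "(\<Sum>i\<in>UNIV. A x $ i *\<^sub>R dd (dd X g x) (dd (axis i 1) f) (g x))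
      = dd (dd X g x) (\<lambda>y. \<Sum>i\<in>UNIV. A x $ i *\<^sub>R dd (axis i 1) f y) (g x)"
    by (subst dd_sum) (simp_all add: dd_linear_compose[OF bounded_linear_scaleR_right h2] sc)
  also have "\<dots> = dd (dd X g x) (dd (A x) f) (g x)"
    by (rule dd_cong[OF assms(3) y]) (rule e[symmetric])
  finally show ?thesis .
qed

text \<open>Differentiating the identity d\<psi> (d\<phi> Y) = Y in the direction X.\<close>

lemma dd_dd_inverse:
  assumes "diffeo_on \<phi> \<psi> S T" "x \<in> S"
  shows "dd (dd X \<phi> x) (dd (dd Y \<phi> x) \<psi>) (\<phi> x) = - dd (dd X (dd Y \<phi>) x) \<psi> (\<phi> x)"
proof -
  note D = diffeo_onD[OF assms(1)]
  have "0 = dd X (\<lambda>x. Y) x" by simp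
  also have "\<dots> = dd X (\<lambda>x. dd (dd Y \<phi> x) \<psi> (\<phi> x)) x"
    by (rule dd_cong[OF D(1) assms(2)]) (simp add: dd_inverse[OF assms(1)])
  also have "\<dots> = dd (dd X (dd Y \<phi>) x) \<psi> (\<phi> x) + dd (dd X \<phi> x) (dd (dd Y \<phi> x) \<psi>) (\<phi> x)"
    by (rule dd_dd_compose[OF D(1) assms(2) D(2,4,5) D(7)[OF assms(2)]
        smooth_on_differentiable[OF smooth_on_dd[OF D(3)] assms(2)]])
  finally show ?thesis by (simp add: eq_neg_iff_add_eq_0 add.commute)
qed

lemma jacobian_inverse:
  assumes "diffeo_on \<phi> \<psi> S T" "x \<in> S"
  shows "jacobian \<psi> (at (\<phi> x)) ** jacobian \<phi> (at x) = mat 1"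
    "jacobian \<phi> (at x) ** jacobian \<psi> (at (\<phi> x)) = mat 1"
  using dd_inverse[OF assms] dd_inverse'[OF assms] diffeo_onD(7,8)[OF assms]
  by (simp_all add: matrix_eq matrix_vector_mul_assoc[symmetric] jacobian_dd)

lemma matrix_inv_jacobian:
  assumes "diffeo_on \<phi> \<psi> S T" "x \<in> S"
  shows "matrix_inv (jacobian \<phi> (at x)) = jacobian \<psi> (at (\<phi> x))"
proof -
  note J = jacobian_inverse[OF assms]
  have i: "invertible (jacobian \<phi> (at x))" using J unfolding invertible_def by blast
  have inv: "jacobian \<phi> (at x) ** matrix_inv (jacobian \<phi> (at x)) = mat 1"
    using someI_ex[OF i[unfolded invertible_def]] unfolding matrix_inv_def by blast
  have "matrix_inv (jacobian \<phi> (at x)) = (jacobian \<psi> (at (\<phi> x)) ** jacobian \<phi> (at x)) ** matrix_inv (jacobian \<phi> (at x))"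
    by (simp add: J)
  also have "\<dots> = jacobian \<psi> (at (\<phi> x))"
    by (simp only: matrix_mul_assoc[symmetric] inv matrix_mul_rid)
  finally show ?thesis .
qed

lemma dd_dd_component:
  fixes f :: "real^'m::finite \<Rightarrow> real^'k::finite"
  assumes "open S" "smooth_on S f" "x \<in> S"
  shows "dd a (dd b (\<lambda>v. f v $ c)) x = dd a (dd b f) x $ c"
proof -
  have "dd a (dd b (\<lambda>v. f v $ c)) x = dd a (\<lambda>v. dd b f v $ c) x"
    by (rule dd_cong[OF assms(1,3)]) (auto intro: dd_component smooth_on_differentiable[OF assms(2)])
  then show ?thesis
    using dd_component[OF smooth_on_differentiable[OF smooth_on_dd[OF assms(2)] assms(3)]] by simp
qed

section \<open>The transformation law of Christoffel symbols in vector form\<close>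

lemma pullback_conn_eq:
  assumes "diffeo_on \<phi> \<psi> S T" "x \<in> S"
  shows "pullback_conn \<phi> \<Gamma> k i j x =
    dd (cvec \<Gamma> (\<phi> x) (dd (axis i 1) \<phi> x) (dd (axis j 1) \<phi> x) + dd (axis i 1) (dd (axis j 1) \<phi>) x) \<psi> (\<phi> x) $ k"
proof -
  note D = diffeo_onD[OF assms(1)]
  have "dd V \<psi> (\<phi> x) $ k = (\<Sum>c\<in>UNIV. jacobian \<psi> (at (\<phi> x)) $ k $ c * V $ c)" for V
    using jacobian_dd[OF D(8)[OF assms(2)], of V] by (metis matrix_vector_mul_component inner_vec_def inner_real_def)
  then show ?thesis
    unfolding pullback_conn_def matrix_inv_jacobian[OF assms]
    by (simp add: partial_dd dd_component[OF D(7)[OF assms(2)]] dd_dd_component[OF D(1,3) assms(2)] cvec_def bil_def)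
qed

text \<open>The standard device below: a multilinear identity is reduced to axis vectors by applying
  this once per argument.\<close>

lemma linear_eq_axis:
  fixes f g :: "real^'m::finite \<Rightarrow> 'b::real_vector"
  assumes "linear f" "linear g" "\<And>i. f (axis i 1) = g (axis i 1)"
  shows "f X = g X"
proof -
  interpret f: linear f by fact
  interpret g: linear g by fact
  have X: "X = (\<Sum>i\<in>UNIV. (X $ i) *\<^sub>R axis i 1)"
    using basis_expansion[of X] by (simp add: scalar_mult_eq_scaleR)
  show ?thesis by (subst (1 2) X) (simp only: f.sum f.scaleR g.sum g.scaleR assms(3))
qed

text \<open>The transformation law without indices is d\<phi> (\<Gamma>' (X, Y)) = \<Gamma> (d\<phi>
  X, d\<phi> Y) + D^2 \<phi> (X, Y), here solved for the pulled-back connection \<Gamma>'. Both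
  sides are bilinear, so the component formula suffices.\<close>

lemma cvec_pullback:
  assumes "diffeo_on \<phi> \<psi> S T" "x \<in> S"
  shows "cvec (pullback_conn \<phi> \<Gamma>) x X Y =
    dd (cvec \<Gamma> (\<phi> x) (dd X \<phi> x) (dd Y \<phi> x) + dd X (dd Y \<phi>) x) \<psi> (\<phi> x)"
proof -
  note D = diffeo_onD[OF assms(1)]
  have d: "\<phi> differentiable (at x)" "dd Y \<phi> differentiable (at x)" "\<psi> differentiable (at (\<phi> x))" for Y
    using D assms(2) smooth_on_differentiable[OF smooth_on_dd[OF D(3)]] by auto
  note l = linear_add[OF cvec_linear(1)] linear_add[OF cvec_linear(2)]
     linear_cmul[OF cvec_linear(1)] linear_cmul[OF cvec_linear(2)] dd_add_left dd_scaleR_left d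
  have dl: "dd X (dd (Y + Z) \<phi>) x = dd X (dd Y \<phi>) x + dd X (dd Z \<phi>) x"
    "dd X (dd (c *\<^sub>R Y) \<phi>) x = c *\<^sub>R dd X (dd Y \<phi>) x" for X Y Z c
  proof -
    have "dd X (dd (Y + Z) \<phi>) x = dd X (\<lambda>x. dd Y \<phi> x + dd Z \<phi> x) x"
      by (rule dd_cong[OF D(1) assms(2)]) (simp add: dd_add_left D(7))
    then show "dd X (dd (Y + Z) \<phi>) x = dd X (dd Y \<phi>) x + dd X (dd Z \<phi>) x" by (simp add: dd_add d)
    have "dd X (dd (c *\<^sub>R Y) \<phi>) x = dd X (\<lambda>x. c *\<^sub>R dd Y \<phi> x) x"
      by (rule dd_cong[OF D(1) assms(2)]) (simp add: dd_scaleR_left D(7))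
    then show "dd X (dd (c *\<^sub>R Y) \<phi>) x = c *\<^sub>R dd X (dd Y \<phi>) x"
      by (simp add: dd_linear_compose[OF bounded_linear_scaleR_right] d)
  qed
  have lin1: "linear (\<lambda>X. dd (cvec \<Gamma> (\<phi> x) (dd X \<phi> x) (dd Y \<phi> x) + dd X (dd Y \<phi>) x) \<psi> (\<phi> x))" for Y
    by (simp add: linear_iff l algebra_simps)
  have lin2: "linear (\<lambda>Y. dd (cvec \<Gamma> (\<phi> x) (dd X \<phi> x) (dd Y \<phi> x) + dd X (dd Y \<phi>) x) \<psi> (\<phi> x))" for X
    by (simp add: linear_iff l dl algebra_simps)
  have "cvec (pullback_conn \<phi> \<Gamma>) x (axis i 1) (axis j 1) =
    dd (cvec \<Gamma> (\<phi> x) (dd (axis i 1) \<phi> x) (dd (axis j 1) \<phi> x) + dd (axis i 1) (dd (axis j 1) \<phi>) x) \<psi> (\<phi> x)" for i j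
    by (simp add: vec_eq_iff cvec_axis pullback_conn_eq[OF assms])
  then have "cvec (pullback_conn \<phi> \<Gamma>) x X (axis j 1) =
    dd (cvec \<Gamma> (\<phi> x) (dd X \<phi> x) (dd (axis j 1) \<phi> x) + dd X (dd (axis j 1) \<phi>) x) \<psi> (\<phi> x)" for X j
    by (rule linear_eq_axis[OF cvec_linear(1) lin1])
  then show ?thesis
    by (rule linear_eq_axis[OF cvec_linear(2) lin2])
qed

lemma christoffel_eqI:
  "(\<And>X Y. cvec \<Gamma> u X Y = cvec \<Gamma>' u' X Y) \<Longrightarrow> \<Gamma> k i j u = \<Gamma>' k i j u'"
  by (metis cvec_axis)

lemma cvec_cong: "(\<And>k i j. \<Gamma> k i j u = \<Gamma>' k i j u') \<Longrightarrow> cvec \<Gamma> u X Y = cvec \<Gamma>' u' X Y"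
  by (simp add: cvec_def bil_def)

lemma dd_pullback_conn:
  assumes "diffeo_on \<phi> \<psi> S T" "x \<in> S"
  shows "dd (cvec (pullback_conn \<phi> \<Gamma>) x X Y) \<phi> x =
    cvec \<Gamma> (\<phi> x) (dd X \<phi> x) (dd Y \<phi> x) + dd X (dd Y \<phi>) x"
  by (simp add: cvec_pullback[OF assms] dd_inverse'[OF assms])

text \<open>The second derivative of the composite splits into d\<phi>' (D^2 \<phi>) and D^2 \<phi>'
  (d\<phi>, d\<phi>): the first is the inhomogeneous term of the pull-back by \<phi>, the second
  that of the pull-back by \<phi>'.\<close>

lemma pullback_conn_compose:
  assumes "diffeo_on \<phi> \<psi> S T" "diffeo_on \<phi>' \<psi>' T R" "x \<in> S"
  shows "pullback_conn (\<lambda>x. \<phi>' (\<phi> x)) \<Gamma> k i j x = pullback_conn \<phi> (pullback_conn \<phi>' \<Gamma>) k i j x"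
proof (rule christoffel_eqI)
  fix X Y
  note D = diffeo_onD[OF assms(1)] and D' = diffeo_onD[OF assms(2)]
  note C = diffeo_on_compose[OF assms(1,2)]
  have y: "\<phi> x \<in> T" using D assms by auto
  have d: "dd X (\<lambda>x. \<phi>' (\<phi> x)) z = dd (dd X \<phi> z) \<phi>' (\<phi> z)" if "z \<in> S" for X z
    using dd_compose D(7) D'(7) D(5) that by blast
  have "dd X (dd Y (\<lambda>x. \<phi>' (\<phi> x))) x = dd X (\<lambda>x. dd (dd Y \<phi> x) \<phi>' (\<phi> x)) x"
    by (rule dd_cong[OF D(1) assms(3)]) (simp add: d)
  also have "\<dots> = dd (dd X (dd Y \<phi>) x) \<phi>' (\<phi> x) + dd (dd X \<phi> x) (dd (dd Y \<phi> x) \<phi>') (\<phi> x)"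
    by (rule dd_dd_compose[OF D(1) assms(3) D(2) D'(3) D(5) D(7)[OF assms(3)]
        smooth_on_differentiable[OF smooth_on_dd[OF D(3)] assms(3)]])
  finally have dd2: "dd X (dd Y (\<lambda>x. \<phi>' (\<phi> x))) x =
    dd (dd X (dd Y \<phi>) x) \<phi>' (\<phi> x) + dd (dd X \<phi> x) (dd (dd Y \<phi> x) \<phi>') (\<phi> x)" .
  have inv: "dd V (\<lambda>x. \<psi> (\<psi>' x)) (\<phi>' (\<phi> x)) = dd (dd V \<psi>' (\<phi>' (\<phi> x))) \<psi> (\<phi> x)" for V
    using dd_compose[of \<psi>' "\<phi>' (\<phi> x)" \<psi> V] D'(8)[OF y] D'(6)[OF y] D(8)[OF assms(3)] by simp
  show "cvec (pullback_conn (\<lambda>x. \<phi>' (\<phi> x)) \<Gamma>) x X Y = cvec (pullback_conn \<phi> (pullback_conn \<phi>' \<Gamma>)) x X Y"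
    unfolding cvec_pullback[OF C assms(3)] cvec_pullback[OF assms(1,3)] cvec_pullback[OF assms(2) y]
    using D'(8)[OF y] D(8)[OF assms(3)]
    by (simp add: d[OF assms(3)] dd2 inv dd_add_left dd_inverse[OF assms(2) y])
qed

lemma pullback_conn_commute:
  assumes "diffeo_on \<phi> \<psi> S T" "x \<in> S" "\<And>k i j. \<Gamma> k i j (\<phi> x) = \<Gamma> k j i (\<phi> x)"
  shows "pullback_conn \<phi> \<Gamma> k i j x = pullback_conn \<phi> \<Gamma> k j i x"
  unfolding pullback_conn_eq[OF assms(1,2)]
  by (subst cvec_commute, rule assms(3)) (simp add: dd_commute[OF diffeo_onD(1)[OF assms(1)] assms(2) diffeo_onD(3)[OF assms(1)]])

text \<open>The pull-back takes two derivatives of the map, hence agreement on an open set, but only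
  the value of the connection at the image point.\<close>

lemma pullback_conn_cong:
  assumes "open S" "x \<in> S" "\<And>y. y \<in> S \<Longrightarrow> \<phi> y = \<phi>' y" "\<And>k i j. \<Gamma> k i j (\<phi> x) = \<Gamma>' k i j (\<phi> x)"
  shows "pullback_conn \<phi> \<Gamma> k i j x = pullback_conn \<phi>' \<Gamma>' k i j x"
proof -
  have 1: "jacobian \<phi> (at x) = jacobian \<phi>' (at x)"
    by (simp add: vec_eq_iff jacobian_component dd_cong[OF assms(1-3)])
  have 2: "dd v (\<lambda>v. \<phi> v $ a) y = dd v (\<lambda>v. \<phi>' v $ a) y" if "y \<in> S" for v a y
    by (rule dd_cong[OF assms(1)]) (use assms that in auto)
  have 3: "dd w (dd v (\<lambda>v. \<phi> v $ a)) x = dd w (dd v (\<lambda>v. \<phi>' v $ a)) x" for v a w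
    by (rule dd_cong[OF assms(1,2)]) (use 2 in auto)
  show ?thesis unfolding pullback_conn_def partial_dd 1 using 2 3 assms by simp
qed

text \<open>Replacing the inverse matrix in the definition by the Jacobian of \<psi> makes
  smoothness visible without Cramer's rule.\<close>

lemma smooth_on_pullback_conn:
  assumes "diffeo_on \<phi> \<psi> S T" "\<And>k i j. smooth_on T (\<Gamma> k i j)"
  shows "smooth_on S (pullback_conn \<phi> \<Gamma> k i j)"
proof -
  note D = diffeo_onD[OF assms(1)]
  show ?thesis
  proof (rule smooth_on_cong[OF D(1)])
    show "(\<Sum>c\<in>UNIV. dd (axis c 1) \<psi> (\<phi> x) $ k *
        ((\<Sum>a\<in>UNIV. \<Sum>b\<in>UNIV. \<Gamma> c a b (\<phi> x) * dd (axis i 1) \<phi> x $ a * dd (axis j 1) \<phi> x $ b)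
         + dd (axis i 1) (dd (axis j 1) \<phi>) x $ c)) = pullback_conn \<phi> \<Gamma> k i j x" if "x \<in> S" for x
      unfolding pullback_conn_def matrix_inv_jacobian[OF assms(1) that]
      by (simp add: partial_dd dd_component[OF D(7)[OF that]] dd_dd_component[OF D(1,3) that] jacobian_component)
    show "smooth_on S (\<lambda>x. \<Sum>c\<in>UNIV. dd (axis c 1) \<psi> (\<phi> x) $ k *
        ((\<Sum>a\<in>UNIV. \<Sum>b\<in>UNIV. \<Gamma> c a b (\<phi> x) * dd (axis i 1) \<phi> x $ a * dd (axis j 1) \<phi> x $ b)
         + dd (axis i 1) (dd (axis j 1) \<phi>) x $ c))"
      by (intro smooth_on_sum smooth_on_mult smooth_on_add smooth_on_component smooth_on_dd D(1,3)
          smooth_on_compose[OF D(1,2,5) _ D(3)] assms(2) smooth_on_dd D(4))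
  qed
qed


section \<open>The lifted connection\<close>

lemma bounded_linear_base_part: "bounded_linear base_part"
proof -
  have "linear (base_part :: real^('n + 'n) \<Rightarrow> real^'n::finite)"
    by (auto simp: linear_iff base_part_def vec_eq_iff)
  then show ?thesis by (rule linear_conv_bounded_linear[THEN iffD1])
qed

lemma bounded_linear_fibre_part: "bounded_linear fibre_part"
proof -
  have "linear (fibre_part :: real^('n + 'n) \<Rightarrow> real^'n::finite)"
    by (auto simp: linear_iff fibre_part_def vec_eq_iff)
  then show ?thesis by (rule linear_conv_bounded_linear[THEN iffD1])
qed

lemma base_fibre_simps [simp]:
  "base_part (x + y) = base_part x + base_part y" "fibre_part (x + y) = fibre_part x + fibre_part y"
  "base_part (c *\<^sub>R x) = c *\<^sub>R base_part x" "fibre_part (c *\<^sub>R x) = c *\<^sub>R fibre_part x"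
  "base_part (x - y) = base_part x - base_part y" "fibre_part (x - y) = fibre_part x - fibre_part y"
  by (auto simp: base_part_def fibre_part_def vec_eq_iff)

lemma base_fibre_axis [simp]:
  "base_part (axis (Inl i) 1) = axis i 1" "fibre_part (axis (Inl i) 1) = 0"
  "base_part (axis (Inr i) 1) = 0" "fibre_part (axis (Inr i) 1) = axis i 1"
  by (auto simp: base_part_def fibre_part_def vec_eq_iff axis_def)

lemma base_fibre_eqI: "base_part x = base_part y \<Longrightarrow> fibre_part x = fibre_part y \<Longrightarrow> x = y"
  by (simp add: base_part_def fibre_part_def vec_eq_iff all_Plus)

lemma inner_axis_vec [simp]: "x \<bullet> axis i (1::real) = x $ i" "axis i (1::real) \<bullet> x = x $ i"
  by (simp_all add: inner_axis inner_axis')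

lemma axis_nth_if: "axis i 1 $ j = (if j = i then 1 else 0)"
  by (simp add: axis_def)

lemma vec_eq_inner: "(\<And>V. x \<bullet> V = y \<bullet> V) \<Longrightarrow> x = y" for x y :: "real^'n::finite"
  by (metis inner_axis_vec(1) vec_eq_iff)

text \<open>Induced charts of the cotangent bundle have whole fibres in their image, so the
  coordinate domains upstairs are of this form.\<close>

definition cyl :: "(real^'n::finite) set \<Rightarrow> (real^('n + 'n)) set" where
  "cyl S = {w. base_part w \<in> S}"

lemma cyl_iff [simp]: "w \<in> cyl S \<longleftrightarrow> base_part w \<in> S"
  by (simp add: cyl_def)

lemma open_cyl: "open S \<Longrightarrow> open (cyl S)"
  using open_vimage[OF _ linear_continuous_on[OF bounded_linear_base_part]]
  by (simp add: cyl_def vimage_def)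

lemma smooth_on_base: "smooth_on S base_part" and smooth_on_fibre: "smooth_on S fibre_part"
  by (simp_all add: smooth_on_bounded_linear bounded_linear_base_part bounded_linear_fibre_part)

lemma smooth_on_cyl:
  assumes "open S" "smooth_on S f"
  shows "smooth_on (cyl S) (\<lambda>w. f (base_part w))"
  by (rule smooth_on_compose[OF open_cyl[OF assms(1)] assms(1) _ assms(2) smooth_on_base]) simp

lemma dd_cyl:
  assumes "f differentiable (at (base_part w))"
  shows "dd X (\<lambda>w. f (base_part w)) w = dd (base_part X) f (base_part w)"
  using dd_compose[OF bounded_linear_imp_differentiable[OF bounded_linear_base_part] assms]
  by (simp add: dd_bounded_linear bounded_linear_base_part)

lemma dd_fibre: "dd X fibre_part w = fibre_part X" and dd_base: "dd X base_part w = base_part X"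
  by (simp_all add: dd_bounded_linear bounded_linear_base_part bounded_linear_fibre_part)

text \<open>\<open>\<psi>\<close> is meant to be the inverse of \<open>\<phi>\<close>.\<close>

definition ctl :: "(real^'n::finite \<Rightarrow> real^'n) \<Rightarrow> (real^'n \<Rightarrow> real^'n) \<Rightarrow> real^('n + 'n) \<Rightarrow> real^('n + 'n)" where
  "ctl \<phi> \<psi> w = (\<chi> b. case b of Inl i \<Rightarrow> \<phi> (base_part w) $ i
     | Inr k \<Rightarrow> fibre_part w \<bullet> dd (axis k 1) \<psi> (\<phi> (base_part w)))"

lemma base_ctl [simp]: "base_part (ctl \<phi> \<psi> w) = \<phi> (base_part w)"
  by (simp add: ctl_def base_part_def)

lemma fibre_ctl_component: "fibre_part (ctl \<phi> \<psi> w) $ k = fibre_part w \<bullet> dd (axis k 1) \<psi> (\<phi> (base_part w))"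
  by (simp add: fibre_part_def[where w = "ctl \<phi> \<psi> w"]) (simp add: ctl_def)

text \<open>The intrinsic description of the lift: the image covector paired with V is the original
  covector paired with d\<psi> V. Most later arguments use this pairing in place of
  components.\<close>

lemma fibre_ctl:
  assumes "\<psi> differentiable (at (\<phi> (base_part w)))"
  shows "fibre_part (ctl \<phi> \<psi> w) \<bullet> V = fibre_part w \<bullet> dd V \<psi> (\<phi> (base_part w))"
  unfolding dd_expand_axis[OF assms, of V] inner_sum_right
  by (simp add: inner_vec_def[of "fibre_part (ctl \<phi> \<psi> w)"] fibre_ctl_component mult.commute)

lemma smooth_on_sum_vec:
  fixes f :: "'a::real_normed_vector \<Rightarrow> real^('n + 'n::finite)"
  assumes "open S" "smooth_on S (\<lambda>x. base_part (f x))" "smooth_on S (\<lambda>x. fibre_part (f x))"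
  shows "smooth_on S f"
proof (rule smooth_on_vec[OF assms(1)])
  fix b show "smooth_on S (\<lambda>x. f x $ b)"
    using smooth_on_component[OF assms(1,2)] smooth_on_component[OF assms(1,3)]
    by (cases b) (simp_all add: base_part_def fibre_part_def)
qed

lemma smooth_on_ctl:
  assumes "diffeo_on \<phi> \<psi> S T"
  shows "smooth_on (cyl S) (ctl \<phi> \<psi>)"
proof (rule smooth_on_sum_vec)
  note D = diffeo_onD[OF assms]
  show o: "open (cyl S)" using D by (simp add: open_cyl)
  show "smooth_on (cyl S) (\<lambda>w. base_part (ctl \<phi> \<psi> w))"
    using smooth_on_cyl[OF D(1,3)] by simp
  show "smooth_on (cyl S) (\<lambda>w. fibre_part (ctl \<phi> \<psi> w))"
  proof (rule smooth_on_vec[OF o], unfold fibre_ctl_component)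
    fix k
    have "smooth_on S (\<lambda>x. dd (axis k 1) \<psi> (\<phi> x))"
      by (rule smooth_on_compose[OF D(1,2,5) smooth_on_dd[OF D(4)] D(3)])
    then show "smooth_on (cyl S) (\<lambda>w. fibre_part w \<bullet> dd (axis k 1) \<psi> (\<phi> (base_part w)))"
      by (rule smooth_on_inner[OF o smooth_on_fibre smooth_on_cyl[OF D(1)]])
  qed
qed

lemma diffeo_on_ctl:
  assumes "diffeo_on \<phi> \<psi> S T"
  shows "diffeo_on (ctl \<phi> \<psi>) (ctl \<psi> \<phi>) (cyl S) (cyl T)"
proof -
  \<comment> \<open>Generalised over the maps and sets, so that it can be applied to the
    diffeomorphism and to its inverse.\<close>
  have inv: "ctl \<psi> \<phi> (ctl \<phi> \<psi> w) = w" if "diffeo_on \<phi> \<psi> S T" "w \<in> cyl S" for \<phi> \<psi> S T and w :: "real^('a + 'a)"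
  proof (rule base_fibre_eqI)
    note D = diffeo_onD[OF that(1)]
    have w: "base_part w \<in> S" using that(2) by simp
    show "base_part (ctl \<psi> \<phi> (ctl \<phi> \<psi> w)) = base_part w" using D(6)[OF w] by simp
    have "fibre_part (ctl \<psi> \<phi> (ctl \<phi> \<psi> w)) \<bullet> V = fibre_part w \<bullet> V" for V
      using D(6-8)[OF w] by (simp add: fibre_ctl dd_inverse[OF that(1) w])
    then show "fibre_part (ctl \<psi> \<phi> (ctl \<phi> \<psi> w)) = fibre_part w" by (rule vec_eq_inner)
  qed
  note D = diffeo_onD[OF assms] and D' = diffeo_onD[OF diffeo_on_sym[OF assms]]
  show ?thesis unfolding diffeo_on_def
  proof (intro conjI ballI)
    show "open (cyl S)" "open (cyl T)" using D(1,2) by (simp_all add: open_cyl)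
    show "smooth_on (cyl S) (ctl \<phi> \<psi>)" "smooth_on (cyl T) (ctl \<psi> \<phi>)"
      by (rule smooth_on_ctl[OF assms], rule smooth_on_ctl[OF diffeo_on_sym[OF assms]])
    show "ctl \<phi> \<psi> w \<in> cyl T" "ctl \<psi> \<phi> (ctl \<phi> \<psi> w) = w" if "w \<in> cyl S" for w
      using inv[OF assms that] D(5) that by simp_all
    show "ctl \<psi> \<phi> w \<in> cyl S" "ctl \<phi> \<psi> (ctl \<psi> \<phi> w) = w" if "w \<in> cyl T" for w
      using inv[OF diffeo_on_sym[OF assms] that] D'(5) that by simp_all
  qed
qed

lemma dd_ctl_base:
  assumes "diffeo_on \<phi> \<psi> S T" "w \<in> cyl S"
  shows "base_part (dd X (ctl \<phi> \<psi>) w) = dd (base_part X) \<phi> (base_part w)"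
proof -
  note D = diffeo_onD[OF assms(1)] and C = diffeo_onD[OF diffeo_on_ctl[OF assms(1)]]
  have "base_part (dd X (ctl \<phi> \<psi>) w) = dd X (\<lambda>w. base_part (ctl \<phi> \<psi> w)) w"
    by (rule dd_linear_compose[OF bounded_linear_base_part C(7)[OF assms(2)], symmetric])
  then show ?thesis using dd_cyl[OF D(7), of w X] assms(2) by simp
qed

text \<open>The fibre coordinate of the lift pairs the covector with a derivative of \<psi> at the
  moving base point; the second summand comes from that motion.\<close>

lemma dd_ctl_fibre:
  assumes "diffeo_on \<phi> \<psi> S T" "w \<in> cyl S"
  shows "fibre_part (dd X (ctl \<phi> \<psi>) w) \<bullet> V = fibre_part X \<bullet> dd V \<psi> (\<phi> (base_part w))
    + fibre_part w \<bullet> dd (dd (base_part X) \<phi> (base_part w)) (dd V \<psi>) (\<phi> (base_part w))"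
proof -
  note D = diffeo_onD[OF assms(1)] and C = diffeo_onD[OF diffeo_on_ctl[OF assms(1)]]
  have w: "base_part w \<in> S" using assms by simp
  have s: "dd V \<psi> differentiable (at (\<phi> (base_part w)))"
    using smooth_on_differentiable[OF smooth_on_dd[OF D(4)] D(5)[OF w]] .
  have s': "(\<lambda>x. dd V \<psi> (\<phi> x)) differentiable (at (base_part w))"
    using differentiable_compose[OF s D(7)[OF w]] .
  have s'': "(\<lambda>w. dd V \<psi> (\<phi> (base_part w))) differentiable (at w)"
    using differentiable_compose[OF s' bounded_linear_imp_differentiable[OF bounded_linear_base_part]] .
  have "fibre_part (dd X (ctl \<phi> \<psi>) w) \<bullet> V = dd X (\<lambda>w. fibre_part (ctl \<phi> \<psi> w) \<bullet> V) w"
    using dd_linear_compose[OF bounded_linear_compose[OF bounded_linear_inner_left bounded_linear_fibre_part] C(7)[OF assms(2)], of X V]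
    by simp
  also have "\<dots> = dd X (\<lambda>w. fibre_part w \<bullet> dd V \<psi> (\<phi> (base_part w))) w"
    by (rule dd_cong[OF C(1) assms(2)]) (simp add: fibre_ctl D(8))
  also have "\<dots> = fibre_part X \<bullet> dd V \<psi> (\<phi> (base_part w))
    + fibre_part w \<bullet> dd X (\<lambda>w. dd V \<psi> (\<phi> (base_part w))) w"
    by (subst dd_bilinear[OF bounded_bilinear_inner bounded_linear_imp_differentiable[OF bounded_linear_fibre_part] s''])
      (simp add: dd_fibre)
  also have "dd X (\<lambda>w. dd V \<psi> (\<phi> (base_part w))) w = dd (dd (base_part X) \<phi> (base_part w)) (dd V \<psi>) (\<phi> (base_part w))"
    unfolding dd_cyl[OF s'] by (rule dd_compose[OF D(7)[OF w] s])
  finally show ?thesis .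
qed

text \<open>
  The lifted connection is the Levi-Civita connection of the Riemann extension
  $2\,d\xi_i\,dx^i - 2\,\xi_a \Gamma^a_{ij}\,dx^i\,dx^j$, whose naturality only involves second
  derivatives of the diffeomorphism.
\<close>

definition riem_ext :: "'n::finite christoffel \<Rightarrow> 'n + 'n \<Rightarrow> 'n + 'n \<Rightarrow> real^('n + 'n) \<Rightarrow> real" where
  "riem_ext \<Gamma> I J = (\<lambda>w. case I of
     Inl i \<Rightarrow> (case J of Inl j \<Rightarrow> - 2 * (\<Sum>a\<in>UNIV. fibre_part w $ a * \<Gamma> a i j (base_part w))
                     | Inr j \<Rightarrow> if i = j then 1 else 0)
   | Inr i \<Rightarrow> (case J of Inl j \<Rightarrow> if i = j then 1 else 0 | Inr j \<Rightarrow> 0))"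

abbreviation dconn :: "'n::finite christoffel \<Rightarrow> real^'n \<Rightarrow> 'n christoffel" where
  "dconn \<Gamma> V k i j \<equiv> dd V (\<Gamma> k i j)"

lemmas linear_rules = linear_add[OF bil_linear(1)] linear_cmul[OF bil_linear(1)]
    linear_add[OF bil_linear(2)] linear_cmul[OF bil_linear(2)]
    linear_add[OF cvec_linear(1)] linear_add[OF cvec_linear(2)]
    linear_cmul[OF cvec_linear(1)] linear_cmul[OF cvec_linear(2)]
    linear_0[OF cvec_linear(1)] linear_0[OF cvec_linear(2)]

lemma bil_riem_ext:
  "bil (riem_ext \<Gamma>) w X Y = - 2 * (fibre_part w \<bullet> cvec \<Gamma> (base_part w) (base_part X) (base_part Y))
     + base_part X \<bullet> fibre_part Y + fibre_part X \<bullet> base_part Y" (is "?L X Y = ?R X Y")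
proof -
  have lin: "linear (\<lambda>X. ?R X Y)" "linear (\<lambda>Y. ?R X Y)" for X Y
    by (auto simp: linear_iff linear_rules inner_add_left inner_add_right algebra_simps)
  have "?L (axis I 1) (axis J 1) = ?R (axis I 1) (axis J 1)" for I J
    by (cases I; cases J) (auto simp: bil_axis riem_ext_def linear_rules inner_vec_def[of "fibre_part w"] cvec_axis axis_nth_if)
  then have "?L X (axis J 1) = ?R X (axis J 1)" for X J
    by (rule linear_eq_axis[OF bil_linear(1) lin(1)])
  then show ?thesis by (rule linear_eq_axis[OF bil_linear(2) lin(2)])
qed

lemma cvec_dconn_linear:
  assumes "\<And>k i j. \<Gamma> k i j differentiable (at x)"
  shows "linear (\<lambda>V. cvec (dconn \<Gamma> V) x X Y)"
  by (auto simp: linear_iff cvec_def bil_def vec_eq_iff dd_add_left dd_scaleR_left assms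
      algebra_simps sum.distrib sum_distrib_left)

lemma cvec_axis_cvec:
  "cvec \<Gamma> u (axis k 1) (cvec \<Gamma>' u' X Y) $ a = (\<Sum>t\<in>UNIV. \<Gamma> a k t u * cvec \<Gamma>' u' X Y $ t)"
proof -
  have "\<Gamma> a i j u * axis k 1 $ i * Z $ j = (if i = k then \<Gamma> a k j u * Z $ j else 0)" for i j and Z :: "real^'a"
    by (simp add: axis_def)
  then show ?thesis by (simp add: cvec_def[of \<Gamma>] bil_def[of "\<Gamma> a"]) (subst sum.swap, simp)
qed

lemma base_lifted_conn:
  "base_part (cvec (lifted_conn \<Gamma>) w X Y) = cvec \<Gamma> (base_part w) (base_part X) (base_part Y)"
  by (simp add: vec_eq_iff base_part_def[of "cvec _ _ _ _"])
     (simp add: cvec_def bil_def sum_UNIV_Plus base_part_def)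

text \<open>Trilinear in X, Y, V, hence settled on axis vectors. \<open>V\<close> takes the place of
  the upper fibre index.\<close>

lemma fibre_lifted_conn:
  fixes w :: "real^('n + 'n::finite)"
  defines "x \<equiv> base_part w"
  assumes d: "\<And>k i j. \<Gamma> k i j differentiable (at x)"
  shows "fibre_part (cvec (lifted_conn \<Gamma>) w X Y) \<bullet> V =
    fibre_part w \<bullet> (cvec (dconn \<Gamma> V) x (base_part X) (base_part Y)
      - cvec (dconn \<Gamma> (base_part X)) x (base_part Y) V - cvec (dconn \<Gamma> (base_part Y)) x (base_part X) V
      + 2 *\<^sub>R cvec \<Gamma> x V (cvec \<Gamma> x (base_part X) (base_part Y)))
    - fibre_part Y \<bullet> cvec \<Gamma> x (base_part X) V - fibre_part X \<bullet> cvec \<Gamma> x V (base_part Y)"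
    (is "?L X Y V = ?R X Y V")
proof -
  note l = linear_rules linear_add[OF cvec_dconn_linear] linear_cmul[OF cvec_dconn_linear]
    linear_0[OF cvec_dconn_linear] inner_add_left inner_add_right inner_diff_right d
  have linR: "linear (\<lambda>X. ?R X Y V)" "linear (\<lambda>Y. ?R X Y V)" "linear (\<lambda>V. ?R X Y V)" for X Y V
    by (auto simp: linear_iff l algebra_simps)
  have linL: "linear (\<lambda>X. ?L X Y V)" "linear (\<lambda>Y. ?L X Y V)" "linear (\<lambda>V. ?L X Y V)" for X Y V
    by (auto simp: linear_iff l algebra_simps)
  have "?L (axis I 1) (axis J 1) (axis k 1) = ?R (axis I 1) (axis J 1) (axis k 1)" for I J k
    by (cases I; cases J)
       (simp_all add: fibre_part_def[of "cvec _ _ _ _"] cvec_axis l partial_dd inner_vec_def[of "fibre_part w"]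
          cvec_axis_cvec x_def[symmetric], simp add: algebra_simps sum.distrib sum_subtractf sum_distrib_left)
  then have "?L X (axis J 1) (axis k 1) = ?R X (axis J 1) (axis k 1)" for X J k
    by (rule linear_eq_axis[OF linL(1) linR(1)])
  then have "?L X Y (axis k 1) = ?R X Y (axis k 1)" for X Y k
    by (rule linear_eq_axis[OF linL(2) linR(2)])
  then show ?thesis
    by (rule linear_eq_axis[OF linL(3) linR(3)])
qed

text \<open>The lifted connection preserves the metric. The terms quadratic in \<Gamma> cancel
  because the factor 2 in the lifted connection meets the factor -2 in the metric; of the
  derivatives of \<Gamma> only the one along Z survives, twice. Symmetry of \<Gamma> on an open set
  gives the symmetry of these derivatives.\<close>

lemma riem_ext_compatible:
  fixes w :: "real^('n + 'n::finite)"
  defines "x \<equiv> base_part w"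
  assumes d: "\<And>k i j. \<Gamma> k i j differentiable (at x)"
    and c: "open S" "x \<in> S" "\<And>y k i j. y \<in> S \<Longrightarrow> \<Gamma> k i j y = \<Gamma> k j i y"
  shows "bil (\<lambda>I J. dd Z (riem_ext \<Gamma> I J)) w X Y =
    bil (riem_ext \<Gamma>) w (cvec (lifted_conn \<Gamma>) w Z X) Y + bil (riem_ext \<Gamma>) w X (cvec (lifted_conn \<Gamma>) w Z Y)"
proof -
  note d' = d[unfolded x_def]
  have sym: "cvec \<Gamma> x U V = cvec \<Gamma> x V U" for U V by (rule cvec_commute) (rule c(3)[OF c(2)])
  have dsym: "cvec (dconn \<Gamma> W) x U V = cvec (dconn \<Gamma> W) x V U" for U V W
    by (rule cvec_commute) (rule dd_cong[OF c(1,2) c(3)])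
  have L: "bil (\<lambda>I J. dd Z (riem_ext \<Gamma> I J)) w X Y =
    - 2 * (fibre_part Z \<bullet> cvec \<Gamma> x (base_part X) (base_part Y)
       + fibre_part w \<bullet> cvec (dconn \<Gamma> (base_part Z)) x (base_part X) (base_part Y))" (is "?L X Y = ?R X Y")
  proof -
    have lin: "linear (\<lambda>X. ?R X Y)" "linear (\<lambda>Y. ?R X Y)" for X Y
      by (auto simp: linear_iff linear_rules inner_add_left inner_add_right algebra_simps)
    have f: "(\<lambda>w::real^('n + 'n). fibre_part w $ a) differentiable (at w)" for a
      by (rule bounded_linear_imp_differentiable)
        (rule bounded_linear_compose[OF bounded_linear_vec_nth bounded_linear_fibre_part])
    have df: "dd Z (\<lambda>w::real^('n + 'n). fibre_part w $ a) w = fibre_part Z $ a" for a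
      by (simp add: dd_bounded_linear[OF bounded_linear_compose[OF bounded_linear_vec_nth bounded_linear_fibre_part]])
    have g: "(\<lambda>w. \<Gamma> k i j (base_part w)) differentiable (at w)" for k i j
      by (rule differentiable_compose[OF d' bounded_linear_imp_differentiable[OF bounded_linear_base_part]])
    have m: "(\<lambda>w. fibre_part w $ a * \<Gamma> k i j (base_part w)) differentiable (at w)" for a k i j
      by (rule differentiable_bilinear[OF bounded_bilinear_mult f g])
    have m2: "dd Z (\<lambda>w. fibre_part w $ a * \<Gamma> k i j (base_part w)) w
      = fibre_part Z $ a * \<Gamma> k i j x + fibre_part w $ a * dd (base_part Z) (\<Gamma> k i j) x" for a k i j
      by (simp add: dd_mult[OF f g] df dd_cyl[OF d'] x_def)
    have s: "(\<lambda>w. \<Sum>a\<in>UNIV. fibre_part w $ a * \<Gamma> a i j (base_part w)) differentiable (at w)" for i j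
      by (intro differentiable_sum) (simp_all add: m)
    have "dd Z (\<lambda>w. - (2 * (\<Sum>a\<in>UNIV. fibre_part w $ a * \<Gamma> a i j (base_part w)))) w =
      - 2 * (\<Sum>a\<in>UNIV. dd Z (\<lambda>w. fibre_part w $ a * \<Gamma> a i j (base_part w)) w)" for i j
      using dd_linear_compose[OF bounded_linear_mult_right[of "-2::real"] s] by (simp add: dd_sum[OF m])
    then have "?L (axis I 1) (axis J 1) = ?R (axis I 1) (axis J 1)" for I J
      by (cases I; cases J) (simp_all add: bil_axis riem_ext_def[abs_def] linear_rules
          inner_vec_def[of "fibre_part w"] inner_vec_def[of "fibre_part Z"] cvec_axis m2 sum.distrib algebra_simps)
    then have "?L X (axis J 1) = ?R X (axis J 1)" for X J
      by (rule linear_eq_axis[OF bil_linear(1) lin(1)])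
    then show ?thesis by (rule linear_eq_axis[OF bil_linear(2) lin(2)])
  qed
  have comm: "fibre_part (cvec (lifted_conn \<Gamma>) w Z V) \<bullet> U = U \<bullet> fibre_part (cvec (lifted_conn \<Gamma>) w Z V)" for U V
    by (simp add: inner_commute)
  show ?thesis
    unfolding L bil_riem_ext base_lifted_conn comm[symmetric] fibre_lifted_conn[OF d', folded x_def] x_def[symmetric]
    using sym[of "base_part Z" "base_part X"] sym[of "base_part Z" "base_part Y"] sym[of "base_part X" "base_part Y"]
      sym[of "base_part X" "cvec \<Gamma> x (base_part Z) (base_part Y)"]
      sym[of "base_part Y" "cvec \<Gamma> x (base_part Z) (base_part X)"]
      dsym[of _ "base_part Z" "base_part X"] dsym[of _ "base_part Z" "base_part Y"] dsym[of _ "base_part X" "base_part Y"]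
    by (simp add: inner_add_right inner_diff_right inner_commute[of "base_part X"] inner_commute[of _ "fibre_part Y"] inner_commute[of _ "fibre_part X"])
qed

text \<open>The difference \<open>d\<close> of the two candidates is antisymmetric in its last two
  arguments by compatibility and symmetric in its first two by freedom from torsion; applying the
  two rules alternately, six times in all, gives d = -d. \<open>D\<close> is the common derivative
  of the metric, and the base points may differ because only values are compared.\<close>

lemma levi_civita_unique:
  fixes h :: "'m::finite \<Rightarrow> 'm \<Rightarrow> 'a \<Rightarrow> real"
  assumes s: "\<And>X Y. bil h u X Y = bil h u Y X"
    and nd: "\<And>X. (\<And>Y. bil h u X Y = 0) \<Longrightarrow> X = 0"
    and c: "\<And>X Y. cvec K u' X Y = cvec K u' Y X" "\<And>X Y. cvec K' u'' X Y = cvec K' u'' Y X"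
    and D: "\<And>X Y Z. D Z X Y = bil h u (cvec K u' Z X) Y + bil h u X (cvec K u' Z Y)"
      "\<And>X Y Z. D Z X Y = bil h u (cvec K' u'' Z X) Y + bil h u X (cvec K' u'' Z Y)"
  shows "cvec K u' X Y = cvec K' u'' X Y"
proof -
  define d where "d Z X Y = bil h u (cvec K u' Z X - cvec K' u'' Z X) Y" for Z X Y
  have d: "d Z X Y = bil h u (cvec K u' Z X) Y - bil h u (cvec K' u'' Z X) Y" for Z X Y
    by (simp add: d_def linear_diff[OF bil_linear(1)])
  have 1: "d Z X Y = - d Z Y X" for Z X Y
    using D(1)[of Z X Y] D(2)[of Z X Y] s[of X] by (simp add: d)
  have 2: "d Z X Y = d X Z Y" for Z X Y by (simp add: d c[of Z X])
  have "d Z X Y = 0" for Z X Y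
    using 1[of Z X Y] 2[of Z Y X] 1[of Y Z X] 2[of Y X Z] 1[of X Y Z] 2[of X Z Y] by simp
  then have "cvec K u' X Y - cvec K' u'' X Y = 0" unfolding d_def by (rule nd)
  then show ?thesis by simp
qed

text \<open>Vertical vectors \<open>Y\<close> detect the base part of \<open>X\<close>; once that is
  zero, horizontal ones detect its fibre part.\<close>

lemma riem_ext_nondegenerate:
  assumes "\<And>Y. bil (riem_ext \<Gamma>) w X Y = 0"
  shows "X = 0"
proof -
  have "base_part X $ i = 0" for i
    using assms[of "axis (Inr i) 1"] by (simp add: bil_riem_ext linear_rules)
  then have b: "base_part X = 0" by (simp add: vec_eq_iff)
  have "fibre_part X $ i = 0" for i
    using assms[of "axis (Inl i) 1"] b by (simp add: bil_riem_ext linear_rules)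
  then have "fibre_part X = 0" by (simp add: vec_eq_iff)
  then show ?thesis using b base_fibre_eqI[of X 0] by (simp add: base_part_def fibre_part_def vec_eq_iff)
qed

text \<open>Each of the two mixed pairings of base and fibre parts contributes minus the pairing of
  \<xi> with d\<psi> (D^2 \<phi> (X, Y)). Together this is exactly the inhomogeneous term of the
  pulled-back symbols, with the factor -2 that the metric gives it.\<close>

lemma riem_ext_pullback:
  assumes "diffeo_on \<phi> \<psi> S T" "w \<in> cyl S"
  shows "bil (riem_ext \<Gamma>) (ctl \<phi> \<psi> w) (dd X (ctl \<phi> \<psi>) w) (dd Y (ctl \<phi> \<psi>) w) =
    bil (riem_ext (pullback_conn \<phi> \<Gamma>)) w X Y"
proof -
  note D = diffeo_onD[OF assms(1)]
  let ?x = "base_part w" and ?X = "base_part X" and ?Y = "base_part Y"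
  have w: "?x \<in> S" using assms by simp
  have fib: "fibre_part (dd X (ctl \<phi> \<psi>) w) \<bullet> dd Y' \<phi> ?x =
      fibre_part X \<bullet> Y' - fibre_part w \<bullet> dd (dd (base_part X) (dd Y' \<phi>) ?x) \<psi> (\<phi> ?x)" for X and Y' :: "real^'a"
    unfolding dd_ctl_fibre[OF assms]
    by (simp add: dd_inverse[OF assms(1) w] dd_dd_inverse[OF assms(1) w])
  have comm: "dd ?Y (dd ?X \<phi>) ?x = dd ?X (dd ?Y \<phi>) ?x"
    by (rule dd_commute[OF D(1) w D(3)])
  show ?thesis
    unfolding bil_riem_ext base_ctl fibre_ctl[where \<phi>=\<phi> and \<psi>=\<psi> and w=w, OF D(8)[OF w]] dd_ctl_base[OF assms]
      inner_commute[of "dd _ \<phi> ?x"] fib cvec_pullback[OF assms(1) w] comm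
    by (simp add: dd_add_left D(8)[OF w] inner_add_right inner_commute[of ?X])
qed

lemma smooth_on_riem_ext:
  assumes "open S" "\<And>k i j. smooth_on S (\<Gamma> k i j)"
  shows "smooth_on (cyl S) (riem_ext \<Gamma> I J)"
proof -
  note o = open_cyl[OF assms(1)]
  have f: "smooth_on (cyl S) (\<lambda>w. fibre_part w $ a)" for a :: 'a
    by (rule smooth_on_component[OF o smooth_on_fibre])
  note c = smooth_on_cyl[OF assms(1), of "\<Gamma> k i j" for k i j]
  show ?thesis
    by (cases I; cases J; simp only: riem_ext_def[abs_def] sum.case)
      (intro o assms smooth_on_sum smooth_on_mult smooth_on_const f c)+
qed

lemma lifted_conn_commute:
  assumes "open S" "base_part w \<in> S" "\<And>y k i j. y \<in> S \<Longrightarrow> \<Gamma> k i j y = \<Gamma> k j i y"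
  shows "lifted_conn \<Gamma> K I J w = lifted_conn \<Gamma> K J I w"
proof -
  have "partial l (\<Gamma> k i j) (base_part w) = partial l (\<Gamma> k j i) (base_part w)" for l k i j
    unfolding partial_dd by (rule dd_cong[OF assms(1-3)])
  then show ?thesis
    using assms(3)[OF assms(2)]
    by (cases K; cases I; cases J) (auto intro!: sum.cong)
qed

text \<open>Both connections are symmetric and preserve the Riemann extension of the pulled-back
  \<Gamma>, so they coincide. A direct comparison of components would involve third derivatives of
  \<phi>.\<close>

theorem pullback_lifted_conn:
  assumes "diffeo_on \<phi> \<psi> S T" "w \<in> cyl S"
    and sm: "\<And>k i j. smooth_on T (\<Gamma> k i j)"
    and sy: "\<And>y k i j. y \<in> T \<Longrightarrow> \<Gamma> k i j y = \<Gamma> k j i y"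
  shows "pullback_conn (ctl \<phi> \<psi>) (lifted_conn \<Gamma>) K I J w = lifted_conn (pullback_conn \<phi> \<Gamma>) K I J w"
proof (rule christoffel_eqI)
  fix X Y
  let ?\<Phi> = "ctl \<phi> \<psi>" and ?\<Gamma>' = "pullback_conn \<phi> \<Gamma>"
  note D = diffeo_onD[OF assms(1)] and C = diffeo_onD[OF diffeo_on_ctl[OF assms(1)]]
  have w: "base_part w \<in> S" using assms by simp
  have sm': "smooth_on S (?\<Gamma>' k i j)" for k i j by (rule smooth_on_pullback_conn[OF assms(1) sm])
  have sy': "?\<Gamma>' k i j y = ?\<Gamma>' k j i y" if "y \<in> S" for k i j y
    by (rule pullback_conn_commute[OF assms(1) that]) (rule sy[OF D(5)[OF that]])
  have rd: "riem_ext \<Gamma> I J differentiable (at (?\<Phi> w))" for I J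
    by (rule smooth_on_differentiable[OF smooth_on_riem_ext[OF D(2) sm] C(5)[OF assms(2)]])
  have rd': "riem_ext ?\<Gamma>' I J differentiable (at w)" for I J
    by (rule smooth_on_differentiable[OF smooth_on_riem_ext[OF D(1) sm'] assms(2)])
  have cd: "dd X ?\<Phi> differentiable (at w)" for X
    by (rule smooth_on_differentiable[OF smooth_on_dd[OF C(3)] assms(2)])
  have comm: "dd Z (dd X ?\<Phi>) w = dd X (dd Z ?\<Phi>) w" for X Z
    by (rule dd_commute[OF C(1) assms(2) C(3)])
  have "dd Z (\<lambda>w. bil (riem_ext ?\<Gamma>') w X Y) w = bil (\<lambda>I J. dd Z (riem_ext ?\<Gamma>' I J)) w X Y" for X Y Z
    using dd_bil[of "riem_ext ?\<Gamma>'" "\<lambda>w. w" w "\<lambda>w. X" "\<lambda>w. Y" Z] rd'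
    by (simp add: dd_bounded_linear[OF bounded_linear_ident] linear_0[OF bil_linear(1)] linear_0[OF bil_linear(2)])
  \<comment> \<open>Compatibility is known at the image point; the product rule adds the second
    derivatives of the lift, and these are the inhomogeneous terms of the pulled-back lifted
    connection.\<close>
  moreover have "dd Z (\<lambda>w. bil (riem_ext ?\<Gamma>') w X Y) w =
      bil (riem_ext ?\<Gamma>') w (cvec (pullback_conn ?\<Phi> (lifted_conn \<Gamma>)) w Z X) Y
      + bil (riem_ext ?\<Gamma>') w X (cvec (pullback_conn ?\<Phi> (lifted_conn \<Gamma>)) w Z Y)" for X Y Z
  proof -
    have "dd Z (\<lambda>w. bil (riem_ext ?\<Gamma>') w X Y) w = dd Z (\<lambda>w. bil (riem_ext \<Gamma>) (?\<Phi> w) (dd X ?\<Phi> w) (dd Y ?\<Phi> w)) w"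
      by (rule dd_cong[OF C(1) assms(2)]) (rule riem_ext_pullback[OF assms(1), symmetric])
    also have "\<dots> = bil (\<lambda>I J. dd (dd Z ?\<Phi> w) (riem_ext \<Gamma> I J)) (?\<Phi> w) (dd X ?\<Phi> w) (dd Y ?\<Phi> w)
        + bil (riem_ext \<Gamma>) (?\<Phi> w) (dd Z (dd X ?\<Phi>) w) (dd Y ?\<Phi> w)
        + bil (riem_ext \<Gamma>) (?\<Phi> w) (dd X ?\<Phi> w) (dd Z (dd Y ?\<Phi>) w)"
      by (rule dd_bil[OF rd C(7)[OF assms(2)] cd cd])
    also have "bil (\<lambda>I J. dd (dd Z ?\<Phi> w) (riem_ext \<Gamma> I J)) (?\<Phi> w) (dd X ?\<Phi> w) (dd Y ?\<Phi> w) =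
        bil (riem_ext \<Gamma>) (?\<Phi> w) (cvec (lifted_conn \<Gamma>) (?\<Phi> w) (dd Z ?\<Phi> w) (dd X ?\<Phi> w)) (dd Y ?\<Phi> w)
        + bil (riem_ext \<Gamma>) (?\<Phi> w) (dd X ?\<Phi> w) (cvec (lifted_conn \<Gamma>) (?\<Phi> w) (dd Z ?\<Phi> w) (dd Y ?\<Phi> w))"
      using C(5)[OF assms(2)] by (intro riem_ext_compatible[OF _ D(2) _ sy] smooth_on_differentiable[OF sm]) simp_all
    finally show ?thesis
      unfolding riem_ext_pullback[OF assms(1,2), symmetric] dd_pullback_conn[OF diffeo_on_ctl[OF assms(1)] assms(2)]
      by (simp add: linear_rules)
  qed
  ultimately have D2: "bil (\<lambda>I J. dd Z (riem_ext ?\<Gamma>' I J)) w X Y =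
      bil (riem_ext ?\<Gamma>') w (cvec (pullback_conn ?\<Phi> (lifted_conn \<Gamma>)) w Z X) Y
      + bil (riem_ext ?\<Gamma>') w X (cvec (pullback_conn ?\<Phi> (lifted_conn \<Gamma>)) w Z Y)" for X Y Z by simp
  show "cvec (pullback_conn ?\<Phi> (lifted_conn \<Gamma>)) w X Y = cvec (lifted_conn ?\<Gamma>') w X Y"
  proof (rule levi_civita_unique[where h = "riem_ext ?\<Gamma>'" and u = w, OF _ _ _ _ D2])
    show "bil (riem_ext ?\<Gamma>') w X Y = bil (riem_ext ?\<Gamma>') w Y X" for X Y
      by (rule bil_commute) (auto simp: riem_ext_def sy'[OF w] split: sum.splits)
    show "X = 0" if "\<And>Y. bil (riem_ext ?\<Gamma>') w X Y = 0" for X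
      by (rule riem_ext_nondegenerate[OF that])
    show "cvec (pullback_conn ?\<Phi> (lifted_conn \<Gamma>)) w X Y = cvec (pullback_conn ?\<Phi> (lifted_conn \<Gamma>)) w Y X" for X Y
      by (rule cvec_commute, rule pullback_conn_commute[OF diffeo_on_ctl[OF assms(1)] assms(2)], rule lifted_conn_commute[OF D(2) _ sy])
        (use C(5)[OF assms(2)] in simp_all)
    show "cvec (lifted_conn ?\<Gamma>') w X Y = cvec (lifted_conn ?\<Gamma>') w Y X" for X Y
      by (rule cvec_commute, rule lifted_conn_commute[OF D(1) w sy'])
    show "bil (\<lambda>I J. dd Z (riem_ext ?\<Gamma>' I J)) w X Y =
       bil (riem_ext ?\<Gamma>') w (cvec (lifted_conn ?\<Gamma>') w Z X) Y + bil (riem_ext ?\<Gamma>') w X (cvec (lifted_conn ?\<Gamma>') w Z Y)" for X Y Z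
      using w by (intro riem_ext_compatible[OF _ D(1) _ sy'] smooth_on_differentiable[OF sm']) simp_all
  qed
qed


section \<open>The operator in coordinates\<close>

text \<open>The expression of \<open>L_op\<close> in one chart, with \<open>\<Gamma>'\<close> in the
  role of the pulled-back connection.\<close>

definition L_loc ::
  "'n::finite christoffel \<Rightarrow> 'n christoffel \<Rightarrow> (real^('n + 'n) \<Rightarrow> real) \<Rightarrow> real^('n + 'n) \<Rightarrow> real" where
  "L_loc \<Gamma> \<Gamma>' q w =
     (let C = (\<lambda>k i j. lifted_conn \<Gamma>' k i j w - lifted_conn \<Gamma> k i j w);
          g = bivector
      in (\<Sum>i\<in>UNIV. \<Sum>j\<in>UNIV. \<Sum>k\<in>UNIV.
              sym3 (\<lambda>j i k. \<Sum>m\<in>UNIV. \<Sum>l\<in>UNIV. C j m l * g i m * g k l) j i k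
              * cov3 (lifted_conn \<Gamma>) i j k q w)
           - 3 / 2 * (\<Sum>i\<in>UNIV. \<Sum>j\<in>UNIV. \<Sum>m\<in>UNIV. \<Sum>n\<in>UNIV.
              sym3 (\<lambda>n m i. \<Sum>l\<in>UNIV. \<Sum>k\<in>UNIV. C n l k * g m l * g i k) n m i
              * C j m n * cov2 (lifted_conn \<Gamma>) i j q w))"

lemma symp_form_square:
  "((\<chi> a b. symp_form_comp a b) :: real^('n + 'n)^('n + 'n::finite)) ** (\<chi> a b. - symp_form_comp a b) = mat 1"
proof -
  have "(\<Sum>c\<in>UNIV. symp_form_comp a c * - symp_form_comp c b) = (if a = b then 1 else 0)" for a b :: "'n + 'n"
    by (cases a; cases b) (auto simp: sum_UNIV_Plus if_distrib[of "\<lambda>x. x * _"] if_distrib[of "(*) _"]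
        if_distrib[of uminus] cong: if_cong)
  then show ?thesis by (simp add: matrix_matrix_mult_def mat_def vec_eq_iff)
qed

text \<open>The matrix of the symplectic form squares to -1, so its inverse is its negative.\<close>

lemma bivector_eq: "bivector i j = - symp_form_comp i j"
proof -
  let ?J = "(\<chi> a b. symp_form_comp a b) :: real^('a + 'a)^('a + 'a)" and ?K = "(\<chi> a b. - symp_form_comp a b) :: real^('a + 'a)^('a + 'a)"
  have 1: "?J ** ?K = mat 1" "?K ** ?J = mat 1"
    using symp_form_square matrix_left_right_inverse by blast+
  then have "?J ** matrix_inv ?J = mat 1"
    using someI_ex[of "\<lambda>A'. ?J ** A' = mat 1 \<and> A' ** ?J = mat 1"] unfolding matrix_inv_def by blast
  then have "?K ** (?J ** matrix_inv ?J) = ?K" by (simp only: matrix_mul_rid)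
  then have "matrix_inv ?J = ?K" by (simp only: matrix_mul_assoc 1 matrix_mul_lid)
  then show ?thesis by (simp add: bivector_def)
qed

lemma sum3_rot:
  fixes F :: "'n::finite \<Rightarrow> 'n \<Rightarrow> 'n \<Rightarrow> 'b::comm_monoid_add"
  shows "(\<Sum>k\<in>UNIV. \<Sum>i\<in>UNIV. \<Sum>j\<in>UNIV. F k i j) = (\<Sum>k\<in>UNIV. \<Sum>i\<in>UNIV. \<Sum>j\<in>UNIV. F i j k)"
  by (subst (2) sum.swap, rule sum.cong[OF refl], subst sum.swap) simp

lemma sum3_swap:
  fixes F :: "'n::finite \<Rightarrow> 'n \<Rightarrow> 'n \<Rightarrow> 'b::comm_monoid_add"
  shows "(\<Sum>k\<in>UNIV. \<Sum>i\<in>UNIV. \<Sum>j\<in>UNIV. F k i j) = (\<Sum>k\<in>UNIV. \<Sum>i\<in>UNIV. \<Sum>j\<in>UNIV. F i k j)"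
  by (rule sum.swap)

text \<open>Symmetrising one factor of a full contraction has no effect when the other factor is
  symmetric: each of the six permuted sums becomes the same one after renaming indices.\<close>

lemma sum_sym3:
  fixes V :: "'n::finite \<Rightarrow> 'n \<Rightarrow> 'n \<Rightarrow> real"
  assumes "\<And>i j k. V i j k = V j i k" "\<And>i j k. V i j k = V i k j"
  shows "(\<Sum>i\<in>UNIV. \<Sum>j\<in>UNIV. \<Sum>k\<in>UNIV. sym3 T j i k * V i j k) = (\<Sum>i\<in>UNIV. \<Sum>j\<in>UNIV. \<Sum>k\<in>UNIV. T i j k * V i j k)"
proof -
  let ?S = "\<lambda>F. \<Sum>i\<in>UNIV. \<Sum>j\<in>UNIV. \<Sum>k\<in>UNIV. (F i j k :: real)"
  let ?X = "?S (\<lambda>i j k. T i j k * V i j k)"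
  have 1: "?S (\<lambda>i j k. T j i k * V i j k) = ?X"
    by (subst sum3_swap) (simp add: assms(1))
  have V: "V j k i = V i j k" "V k i j = V i j k" for i j k using assms by metis+
  have 2: "?S (\<lambda>i j k. T j k i * V i j k) = ?X"
    by (subst (2) sum3_rot) (simp add: V)
  have 3: "?S (\<lambda>i j k. T k i j * V i j k) = ?X"
    by (subst sum3_rot) (simp add: V)
  have 4: "?S (\<lambda>i j k. T i k j * V i j k) = ?X"
    by (rule sum.cong[OF refl], subst sum.swap) (simp add: assms(2))
  have 5: "?S (\<lambda>i j k. T k j i * V i j k) = ?X"
    by (subst (1) sum3_swap, subst sum3_rot, intro sum.cong refl) (metis assms)
  have "?S (\<lambda>i j k. sym3 T j i k * V i j k) =
    (?S (\<lambda>i j k. T j i k * V i j k) + ?S (\<lambda>i j k. T j k i * V i j k) + ?S (\<lambda>i j k. T i j k * V i j k)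
     + ?S (\<lambda>i j k. T i k j * V i j k) + ?S (\<lambda>i j k. T k j i * V i j k) + ?S (\<lambda>i j k. T k i j * V i j k)) / 6"
    by (simp add: sym3_def sum.distrib[symmetric] sum_divide_distrib algebra_simps add_divide_distrib)
  then show ?thesis unfolding 1 2 3 4 5 by simp
qed

section \<open>Covariant derivatives of a function for the lifted connection\<close>

definition vhess :: "(real^('n + 'n) \<Rightarrow> real) \<Rightarrow> 'n::finite \<Rightarrow> 'n \<Rightarrow> real^('n + 'n) \<Rightarrow> real" where
  "vhess q j k = dd (axis (Inr j) 1) (dd (axis (Inr k) 1) q)"

definition vthird :: "(real^('n + 'n) \<Rightarrow> real) \<Rightarrow> 'n::finite \<Rightarrow> 'n \<Rightarrow> 'n \<Rightarrow> real^('n + 'n) \<Rightarrow> real" where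
  "vthird q k i j = dd (axis (Inr k) 1) (vhess q i j)"

lemma vhess_commute: "open U \<Longrightarrow> w \<in> U \<Longrightarrow> smooth_on U q \<Longrightarrow> vhess q j k w = vhess q k j w"
  unfolding vhess_def by (rule dd_commute_real)

lemma vthird_commute:
  assumes "open U" "w \<in> U" "smooth_on U q"
  shows "vthird q k i j w = vthird q i k j w" "vthird q k i j w = vthird q k j i w"
proof -
  show "vthird q k i j w = vthird q i k j w" unfolding vthird_def vhess_def
    by (rule dd_commute_real[OF assms(1,2) smooth_on_dd[OF assms(3)]])
  show "vthird q k i j w = vthird q k j i w" unfolding vthird_def
    by (rule dd_cong[OF assms(1,2)]) (rule vhess_commute[OF assms(1) _ assms(3)])
qed

lemma cov1_eq: "cov1 i q = dd (axis i 1) q"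
  by (rule ext) (simp add: cov1_def partial_dd)

lemma cov2_lifted:
  "cov2 (lifted_conn \<Gamma>) (Inr i) (Inr j) q = vhess q i j"
  "cov2 (lifted_conn \<Gamma>) (Inl i) (Inr k) q = (\<lambda>w. dd (axis (Inl i) 1) (dd (axis (Inr k) 1) q) w
     + (\<Sum>l\<in>UNIV. \<Gamma> k i l (base_part w) * dd (axis (Inr l) 1) q w))"
  "cov2 (lifted_conn \<Gamma>) (Inr k) (Inl i) q = (\<lambda>w. dd (axis (Inr k) 1) (dd (axis (Inl i) 1) q) w
     + (\<Sum>l\<in>UNIV. \<Gamma> k l i (base_part w) * dd (axis (Inr l) 1) q w))"
  by (rule ext, simp add: cov2_def cov1_eq partial_dd sum_UNIV_Plus vhess_def sum_negf)+

text \<open>Only components with at most one base index are listed, since the symmetrised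
  coefficients vanish on the others. \<Gamma> is constant along the fibres, so fibre derivatives
  create no derivative of \<Gamma>, no first-order derivative of \<open>q\<close> remains, and the
  position of the base index does not matter.\<close>

lemma cov3_lifted:
  fixes w :: "real^('n + 'n::finite)" and q :: "real^('n + 'n) \<Rightarrow> real"
  defines "x \<equiv> base_part w"
  assumes d: "\<And>k i j. \<Gamma> k i j differentiable (at x)" and s: "\<And>k i j. \<Gamma> k i j x = \<Gamma> k j i x"
    and q: "open U" "w \<in> U" "smooth_on U q"
  defines "c3 \<equiv> \<lambda>i j k. dd (axis (Inl i) 1) (vhess q j k) w
    + (\<Sum>l\<in>UNIV. \<Gamma> j i l x * vhess q l k w) + (\<Sum>l\<in>UNIV. \<Gamma> k i l x * vhess q j l w)"
  shows "cov3 (lifted_conn \<Gamma>) (Inr i) (Inr j) (Inr k) q w = vthird q i j k w"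
    "cov3 (lifted_conn \<Gamma>) (Inl i) (Inr j) (Inr k) q w = c3 i j k"
    "cov3 (lifted_conn \<Gamma>) (Inr i) (Inl j) (Inr k) q w = c3 j i k"
    "cov3 (lifted_conn \<Gamma>) (Inr i) (Inr j) (Inl k) q w = c3 k i j"
proof -
  show "cov3 (lifted_conn \<Gamma>) (Inr i) (Inr j) (Inr k) q w = vthird q i j k w"
    by (simp add: cov3_def cov2_lifted partial_dd sum_UNIV_Plus vthird_def)
  show "cov3 (lifted_conn \<Gamma>) (Inl i) (Inr j) (Inr k) q w = c3 i j k"
    by (simp add: cov3_def cov2_lifted partial_dd sum_UNIV_Plus c3_def sum_negf x_def)
  have d1: "(\<lambda>w. dd a (dd b q) w) differentiable (at w)" "dd a q differentiable (at w)" for a b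
    using smooth_on_dd q smooth_on_differentiable by blast+
  have g: "(\<lambda>w. \<Gamma> k i j (base_part w)) differentiable (at w)" for k i j
    by (rule differentiable_compose[OF d[unfolded x_def] bounded_linear_imp_differentiable[OF bounded_linear_base_part]])
  have m: "(\<lambda>w. \<Gamma> k i j (base_part w) * dd a q w) differentiable (at w)" for k i j a
    by (rule differentiable_bilinear[OF bounded_bilinear_mult g d1(2)])
  have g0: "dd (axis (Inr a) 1) (\<lambda>w. \<Gamma> k i j (base_part w)) w = 0" for k i j a
    unfolding dd_cyl[OF d[unfolded x_def]] using linear_0[OF dd_linear[OF d]] by (simp add: x_def)
  have dm: "dd (axis (Inr a) 1) (\<lambda>w. \<Gamma> k i j (base_part w) * dd b q w) w
    = \<Gamma> k i j x * dd (axis (Inr a) 1) (dd b q) w" for k i j a b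
    by (subst dd_mult[OF g d1(2)]) (simp add: g0 x_def)
  have sd: "(\<lambda>w. \<Sum>l\<in>UNIV. F l w) differentiable (at w)" if "\<And>l. F l differentiable (at w)" for F :: "'n \<Rightarrow> real^('n + 'n) \<Rightarrow> real"
    using that by (intro differentiable_sum) simp_all
  have c: "dd (axis (Inr i) 1) (dd (axis (Inl j) 1) (dd (axis (Inr k) 1) q)) w = dd (axis (Inl j) 1) (vhess q i k) w" for i j k
    unfolding vhess_def by (rule dd_commute_real[OF q(1,2) smooth_on_dd[OF q(3)]])
  have c': "dd (axis (Inr i) 1) (dd (axis (Inr j) 1) (dd (axis (Inl k) 1) q)) w = dd (axis (Inl k) 1) (vhess q i j) w" for i j k
    unfolding c[symmetric]
    by (rule dd_cong[OF q(1,2)]) (rule dd_commute_real[OF q(1) _ q(3)])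
  show "cov3 (lifted_conn \<Gamma>) (Inr i) (Inl j) (Inr k) q w = c3 j i k"
    by (simp add: cov3_def cov2_lifted partial_dd sum_UNIV_Plus sum_negf dd_add[OF d1(1) sd[OF m]] dd_sum[OF m] dm c c3_def
        vhess_def[symmetric] x_def[symmetric] s[of i _ j])
  show "cov3 (lifted_conn \<Gamma>) (Inr i) (Inr j) (Inl k) q w = c3 k i j"
    by (simp add: cov3_def cov2_lifted partial_dd sum_UNIV_Plus sum_negf dd_add[OF d1(1) sd[OF m]] dd_sum[OF m] dm c'[folded vhess_def] c3_def
        vhess_def[symmetric] x_def[symmetric] s[of i _ k] s[of j _ k] vhess_commute[OF q])
qed

definition bvec :: "real^'n \<Rightarrow> real^('n + 'n::finite)" where
  "bvec v = (\<chi> b. case b of Inl i \<Rightarrow> v $ i | Inr i \<Rightarrow> 0)"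

lemma base_bvec [simp]: "base_part (bvec v) = v" "fibre_part (bvec v) = 0"
  by (simp_all add: bvec_def base_part_def fibre_part_def vec_eq_iff)

lemma dd_bvec:
  assumes "f differentiable (at w)"
  shows "dd (bvec v) f w = (\<Sum>i\<in>UNIV. v $ i *\<^sub>R dd (axis (Inl i) 1) f w)"
  by (subst dd_expand_axis[OF assms]) (simp add: sum_UNIV_Plus bvec_def)

text \<open>Contracted with third fibre derivatives, which are symmetric, the three terms
  \<partial>_k \<Gamma>_ij - \<partial>_i \<Gamma>_jk - \<partial>_j \<Gamma>_ik of the lifted
  symbols collapse to -\<partial>_k \<Gamma>_ij; hence the sign of the derivatives here.\<close>

definition Pvec :: "'n::finite christoffel \<Rightarrow> 'n christoffel \<Rightarrow> real^'n \<Rightarrow> real^'n \<Rightarrow> real^'n \<Rightarrow> real^'n \<Rightarrow> real^'n" where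
  "Pvec \<Gamma> \<Gamma>' x X Y Z = cvec (dconn \<Gamma> X) x Y Z - cvec (dconn \<Gamma>' X) x Y Z
     + 2 *\<^sub>R (cvec \<Gamma>' x X (cvec \<Gamma>' x Y Z) - cvec \<Gamma> x X (cvec \<Gamma> x Y Z))"

text \<open>The trace of V \<mapsto> \<Gamma> (\<Gamma> (V, Z), Y), a product of Christoffel symbols
  that also occurs, up to sign, in the Ricci tensor.\<close>

definition ric :: "'n::finite christoffel \<Rightarrow> real^'n \<Rightarrow> real^'n \<Rightarrow> real^'n \<Rightarrow> real" where
  "ric \<Gamma> x Y Z = (\<Sum>n\<in>UNIV. cvec \<Gamma> x (cvec \<Gamma> x (axis n 1) Z) Y $ n)"

text \<open>
  \<open>L_expl \<Gamma> \<Gamma>'\<close> is the difference of two operators, one depending on \<open>\<Gamma>'\<close> and one on \<open>\<Gamma>\<close>, and the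
  function \<open>q\<close> only enters through its vertical Hessian.
\<close>

definition L_expl ::
  "'n::finite christoffel \<Rightarrow> 'n christoffel \<Rightarrow> (real^('n + 'n) \<Rightarrow> real) \<Rightarrow> real^('n + 'n) \<Rightarrow> real" where
  "L_expl \<Gamma> \<Gamma>' q w = (let x = base_part w; \<xi> = fibre_part w in
     3 * (\<Sum>j\<in>UNIV. \<Sum>k\<in>UNIV. dd (bvec (cvec \<Gamma>' x (axis j 1) (axis k 1) - cvec \<Gamma> x (axis j 1) (axis k 1))) (vhess q j k) w)
     + (\<Sum>k\<in>UNIV. \<Sum>i\<in>UNIV. \<Sum>j\<in>UNIV. (\<xi> \<bullet> Pvec \<Gamma> \<Gamma>' x (axis k 1) (axis i 1) (axis j 1)) * vthird q k i j w)
     + 3 * (\<Sum>i\<in>UNIV. \<Sum>j\<in>UNIV. (ric \<Gamma>' x (axis i 1) (axis j 1) - ric \<Gamma> x (axis i 1) (axis j 1)) * vhess q i j w))"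

lemma ric_axis:
  assumes "\<And>k i j. \<Gamma> k i j x = \<Gamma> k j i x"
  shows "ric \<Gamma> x (axis i 1) (axis j 1) = (\<Sum>n\<in>UNIV. \<Sum>m\<in>UNIV. \<Gamma> n m i x * \<Gamma> m n j x)"
  unfolding ric_def cvec_commute[of \<Gamma> x _ "axis i 1", OF assms] cvec_axis_cvec cvec_axis
  using assms by simp

text \<open>Raising a lower index with the bivector exchanges base and fibre directions, and its
  signs absorb the minus signs of the mixed components of \<open>C\<close>. The block pattern of
  \<open>C\<close> then leaves at most one base index, and with exactly one all six orderings give
  the same \<delta>.\<close>

lemma L_loc_first:
  fixes \<Gamma> \<Gamma>' :: "'n::finite christoffel" and w :: "real^('n + 'n)"
  defines "C \<equiv> \<lambda>k i j. lifted_conn \<Gamma>' k i j w - lifted_conn \<Gamma> k i j w"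
  defines "T \<equiv> \<lambda>j i k. \<Sum>m\<in>UNIV. \<Sum>l\<in>UNIV. C j m l * bivector i m * bivector k l"
  defines "\<delta> \<equiv> \<lambda>k i j. \<Gamma>' k i j (base_part w) - \<Gamma> k i j (base_part w)"
  assumes s: "\<And>k i j. \<Gamma> k i j (base_part w) = \<Gamma> k j i (base_part w)"
    "\<And>k i j. \<Gamma>' k i j (base_part w) = \<Gamma>' k j i (base_part w)"
  shows "sym3 T (Inl a) (Inl b) K = 0" "sym3 T (Inl a) K (Inl b) = 0" "sym3 T K (Inl a) (Inl b) = 0"
    "sym3 T (Inl a) (Inr b) (Inr c) = \<delta> a b c"
    "sym3 T (Inr b) (Inl a) (Inr c) = \<delta> a b c"
    "sym3 T (Inr b) (Inr c) (Inl a) = \<delta> a b c"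
    "sym3 T (Inr a) (Inr b) (Inr c) = sym3 (\<lambda>a b c. C (Inr a) (Inl b) (Inl c)) a b c"
proof -
  have sd: "\<delta> k i j = \<delta> k j i" for k i j using s by (simp add: \<delta>_def)
  have e: "(if a = b then r else 0) = (if b = a then r else (0::real))" for a b :: 'n and r by auto
  have T1: "T K (Inl a) (Inl b) = 0" for K a b
    by (cases K) (simp_all add: T_def bivector_eq sum_UNIV_Plus C_def)
  have T2: "T (Inl c) (Inl a) (Inr b) = 0" "T (Inl c) (Inr a) (Inl b) = 0" for c a b
    by (simp_all add: T_def bivector_eq sum_UNIV_Plus C_def)
  have T3: "T (Inr c) (Inl a) (Inr b) = \<delta> a c b" for a b c
    by (simp add: T_def bivector_eq sum_UNIV_Plus C_def \<delta>_def if_distrib[of "\<lambda>x. _ * x"] if_distrib[of uminus] cong: if_cong)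
  have T4: "T (Inr c) (Inr a) (Inl b) = \<delta> b a c" for a b c
    by (simp add: T_def bivector_eq sum_UNIV_Plus C_def \<delta>_def if_distrib[of "\<lambda>x. _ * x"] if_distrib[of uminus] cong: if_cong)
  have T5: "T (Inl c) (Inr a) (Inr b) = \<delta> c a b" for a b c
    by (simp add: T_def bivector_eq sum_UNIV_Plus C_def \<delta>_def if_distrib[of "\<lambda>x. _ * x"] if_distrib[of uminus] cong: if_cong)
  have T6: "T (Inr c) (Inr a) (Inr b) = C (Inr c) (Inl a) (Inl b)" for a b c
    by (simp add: T_def bivector_eq sum_UNIV_Plus if_distrib[of "\<lambda>x. _ * x"] if_distrib[of uminus] cong: if_cong)
  show "sym3 T (Inl a) (Inl b) K = 0" "sym3 T (Inl a) K (Inl b) = 0" "sym3 T K (Inl a) (Inl b) = 0"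
    by (cases K; simp add: sym3_def T1 T2)+
  show "sym3 T (Inl a) (Inr b) (Inr c) = \<delta> a b c"
    "sym3 T (Inr b) (Inl a) (Inr c) = \<delta> a b c"
    "sym3 T (Inr b) (Inr c) (Inl a) = \<delta> a b c"
    using sd[of a b c] by (simp_all add: sym3_def T3 T4 T5)
  show "sym3 T (Inr a) (Inr b) (Inr c) = sym3 (\<lambda>a b c. C (Inr a) (Inl b) (Inl c)) a b c"
    by (simp add: sym3_def T6)
qed

lemma L_loc_eq:
  fixes \<Gamma> \<Gamma>' :: "'n::finite christoffel" and w :: "real^('n + 'n)"
  assumes S: "open S" "base_part w \<in> S"
    and sm: "\<And>k i j. smooth_on S (\<Gamma> k i j)" "\<And>k i j. smooth_on S (\<Gamma>' k i j)"
    and sy: "\<And>y k i j. y \<in> S \<Longrightarrow> \<Gamma> k i j y = \<Gamma> k j i y" "\<And>y k i j. y \<in> S \<Longrightarrow> \<Gamma>' k i j y = \<Gamma>' k j i y"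
    and q: "open U" "w \<in> U" "smooth_on U q"
  shows "L_loc \<Gamma> \<Gamma>' q w = L_expl \<Gamma> \<Gamma>' q w"
proof -
  let ?x = "base_part w" and ?\<xi> = "fibre_part w"
  define \<delta> where "\<delta> k i j = \<Gamma>' k i j ?x - \<Gamma> k i j ?x" for k i j
  define C where "C k i j = lifted_conn \<Gamma>' k i j w - lifted_conn \<Gamma> k i j w" for k i j
  define T where "T j i k = (\<Sum>m\<in>UNIV. \<Sum>l\<in>UNIV. C j m l * bivector i m * bivector k l)" for j i k
  define V where "V i j k = vthird q i j k w" for i j k
  define H where "H i j = vhess q i j w" for i j
  define B where "B i j k = dd (axis (Inl i) 1) (vhess q j k) w" for i j k
  define c3 where "c3 i j k = B i j k + (\<Sum>l\<in>UNIV. \<Gamma> j i l ?x * H l k) + (\<Sum>l\<in>UNIV. \<Gamma> k i l ?x * H j l)" for i j k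
  have T: "(\<lambda>j i k. \<Sum>m\<in>UNIV. \<Sum>l\<in>UNIV. C j m l * bivector i m * bivector k l) = T"
    by (intro ext) (simp add: T_def)
  have Hs: "H i j = H j i" for i j unfolding H_def by (rule vhess_commute[OF q])
  have Vs: "V i j k = V j i k" "V i j k = V i k j" for i j k unfolding V_def using vthird_commute[OF q] by auto
  have d: "\<Gamma> k i j differentiable (at ?x)" "\<Gamma>' k i j differentiable (at ?x)" for k i j
    using smooth_on_differentiable[OF sm(1) S(2)] smooth_on_differentiable[OF sm(2) S(2)] by auto
  have sd: "\<delta> k i j = \<delta> k j i" for k i j using sy S(2) by (simp add: \<delta>_def)
  note S3 = L_loc_first[where \<Gamma> = \<Gamma> and \<Gamma>' = \<Gamma>' and w = w, OF sy[OF S(2)], folded C_def, folded T[symmetric] \<delta>_def]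
  note cv = cov3_lifted[where \<Gamma> = \<Gamma> and w = w, OF d(1) sy(1)[OF S(2)] q, folded V_def H_def B_def, folded c3_def]
  \<comment> \<open>The factor 3 counts the positions of the single base index.\<close>
  have first: "(\<Sum>i\<in>UNIV. \<Sum>j\<in>UNIV. \<Sum>k\<in>UNIV. sym3 T j i k * cov3 (lifted_conn \<Gamma>) i j k q w)
    = 3 * (\<Sum>i\<in>UNIV. \<Sum>j\<in>UNIV. \<Sum>k\<in>UNIV. \<delta> i j k * c3 i j k)
      + (\<Sum>i\<in>UNIV. \<Sum>j\<in>UNIV. \<Sum>k\<in>UNIV. C (Inr i) (Inl j) (Inl k) * V i j k)"
  proof -
    have "(\<Sum>i\<in>UNIV. \<Sum>j\<in>UNIV. \<Sum>k\<in>UNIV. \<delta> j i k * c3 j i k) = (\<Sum>i\<in>UNIV. \<Sum>j\<in>UNIV. \<Sum>k\<in>UNIV. \<delta> i j k * c3 i j k)"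
      by (rule sum.swap)
    moreover have "(\<Sum>i\<in>UNIV. \<Sum>j\<in>UNIV. \<Sum>k\<in>UNIV. \<delta> k j i * c3 k i j) = (\<Sum>i\<in>UNIV. \<Sum>j\<in>UNIV. \<Sum>k\<in>UNIV. \<delta> i j k * c3 i j k)"
      by (subst sum3_rot[symmetric]) (simp add: sd[of _ _ j for j])
    ultimately show ?thesis
      using sum_sym3[where V = V, OF Vs, of "\<lambda>a b c. C (Inr a) (Inl b) (Inl c)"]
      by (simp add: sum_UNIV_Plus S3 cv sum.distrib)
  qed
  \<comment> \<open>Of the traced indices m, n exactly one is a base index, in either order;
    \<open>C\<close> contributes -\<delta> each time, whence -2.\<close>
  have second: "(\<Sum>i\<in>UNIV. \<Sum>j\<in>UNIV. \<Sum>m\<in>UNIV. \<Sum>n\<in>UNIV. sym3 T n m i * C j m n * cov2 (lifted_conn \<Gamma>) i j q w)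
    = - 2 * (\<Sum>i\<in>UNIV. \<Sum>j\<in>UNIV. \<Sum>n\<in>UNIV. \<Sum>m\<in>UNIV. \<delta> n m i * \<delta> m n j * H i j)"
  proof -
    have C0: "C (Inl j) (Inr m) K = 0" "C (Inl j) K (Inr m) = 0" "C K (Inr m) (Inr n) = 0" for j m n K
      by (cases K; simp add: C_def)+
    have C1: "C (Inr j) (Inr m) (Inl n) = - \<delta> m n j" "C (Inr j) (Inl m) (Inr n) = - \<delta> n m j" for j m n
      using sd[of m n j] by (simp_all add: C_def \<delta>_def)
    have "(\<Sum>m\<in>UNIV. \<Sum>n\<in>UNIV. \<delta> n m i * \<delta> m n j * H i j) = (\<Sum>n\<in>UNIV. \<Sum>m\<in>UNIV. \<delta> n m i * \<delta> m n j * H i j)" for i j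
      by (rule sum.swap)
    then show ?thesis
      by (simp add: sum_UNIV_Plus S3 C0 C1 cov2_lifted H_def[symmetric] sum.distrib sum_negf sum_distrib_left[symmetric])
  qed
  have third: "(\<Sum>i\<in>UNIV. \<Sum>j\<in>UNIV. \<Sum>k\<in>UNIV. C (Inr i) (Inl j) (Inl k) * V i j k)
    = (\<Sum>k\<in>UNIV. \<Sum>i\<in>UNIV. \<Sum>j\<in>UNIV. (?\<xi> \<bullet> Pvec \<Gamma> \<Gamma>' ?x (axis k 1) (axis i 1) (axis j 1)) * V k i j)"
  proof -
    define Q where "Q k i j = (\<Sum>a\<in>UNIV. ?\<xi> $ a * (dd (axis k 1) (\<Gamma>' a i j) ?x - dd (axis k 1) (\<Gamma> a i j) ?x))" for k i j
    define R where "R k i j = (\<Sum>a\<in>UNIV. ?\<xi> $ a * 2 * ((\<Sum>t\<in>UNIV. \<Gamma>' a k t ?x * \<Gamma>' t i j ?x) - (\<Sum>t\<in>UNIV. \<Gamma> a k t ?x * \<Gamma> t i j ?x)))" for k i j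
    have ds: "dd v (\<Gamma> k i j) ?x = dd v (\<Gamma> k j i) ?x" "dd v (\<Gamma>' k i j) ?x = dd v (\<Gamma>' k j i) ?x" for v k i j
      by (rule dd_cong[OF S], rule sy, assumption)+
    have Qs: "Q k i j = Q k j i" for k i j by (simp add: Q_def ds[of _ _ i j])
    have C: "C (Inr k) (Inl i) (Inl j) = Q k i j - Q i j k - Q j i k + R k i j" for k i j
      by (simp add: C_def Q_def R_def partial_dd algebra_simps sum.distrib sum_subtractf)
    have P: "?\<xi> \<bullet> Pvec \<Gamma> \<Gamma>' ?x (axis k 1) (axis i 1) (axis j 1) = - Q k i j + R k i j" for k i j
      by (simp add: Pvec_def inner_vec_def[of ?\<xi>] cvec_axis_cvec cvec_axis Q_def R_def algebra_simps sum.distrib sum_subtractf sum_negf, simp add: sum_distrib_left)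
    have 1: "(\<Sum>k\<in>UNIV. \<Sum>i\<in>UNIV. \<Sum>j\<in>UNIV. Q i j k * V k i j) = (\<Sum>k\<in>UNIV. \<Sum>i\<in>UNIV. \<Sum>j\<in>UNIV. Q k i j * V k i j)"
      by (subst (2) sum3_rot, intro sum.cong refl) (metis Vs)
    have 2: "(\<Sum>k\<in>UNIV. \<Sum>i\<in>UNIV. \<Sum>j\<in>UNIV. Q j i k * V k i j) = (\<Sum>k\<in>UNIV. \<Sum>i\<in>UNIV. \<Sum>j\<in>UNIV. Q k i j * V k i j)"
      by (subst sum3_rot, intro sum.cong refl) (metis Vs Qs)
    show ?thesis unfolding C P
      by (simp add: algebra_simps sum.distrib sum_subtractf 1 2)
  qed
  \<comment> \<open>The two connection terms of \<open>c3\<close> become equal after renaming, by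
    the symmetry of \<delta> and of the fibre Hessian; hence the factor 2.\<close>
  have main: "(\<Sum>i\<in>UNIV. \<Sum>j\<in>UNIV. \<Sum>k\<in>UNIV. \<delta> i j k * c3 i j k) =
      (\<Sum>j\<in>UNIV. \<Sum>k\<in>UNIV. dd (bvec (cvec \<Gamma>' ?x (axis j 1) (axis k 1) - cvec \<Gamma> ?x (axis j 1) (axis k 1))) (vhess q j k) w)
      + 2 * (\<Sum>i\<in>UNIV. \<Sum>j\<in>UNIV. \<Sum>n\<in>UNIV. \<Sum>m\<in>UNIV. \<delta> n m i * \<Gamma> m n j ?x * H i j)"
  proof -
    have vd: "vhess q j k differentiable (at w)" for j k
      unfolding vhess_def by (rule smooth_on_differentiable[OF smooth_on_dd[OF smooth_on_dd[OF q(3)]] q(2)])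
    have 1: "(\<Sum>j\<in>UNIV. \<Sum>k\<in>UNIV. dd (bvec (cvec \<Gamma>' ?x (axis j 1) (axis k 1) - cvec \<Gamma> ?x (axis j 1) (axis k 1))) (vhess q j k) w)
      = (\<Sum>i\<in>UNIV. \<Sum>j\<in>UNIV. \<Sum>k\<in>UNIV. \<delta> i j k * B i j k)"
      unfolding dd_bvec[OF vd]
      by (subst sum3_rot) (simp add: cvec_axis B_def \<delta>_def)
    have 2: "(\<Sum>i\<in>UNIV. \<Sum>j\<in>UNIV. \<Sum>k\<in>UNIV. \<delta> i j k * (\<Sum>l\<in>UNIV. \<Gamma> j i l ?x * H l k))
      = (\<Sum>i\<in>UNIV. \<Sum>j\<in>UNIV. \<Sum>n\<in>UNIV. \<Sum>m\<in>UNIV. \<delta> n m i * \<Gamma> m n j ?x * H i j)"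
    proof -
      have "(\<Sum>i\<in>UNIV. \<Sum>j\<in>UNIV. \<Sum>k\<in>UNIV. \<delta> i j k * (\<Sum>l\<in>UNIV. \<Gamma> j i l ?x * H l k))
        = (\<Sum>k\<in>UNIV. \<Sum>i\<in>UNIV. \<Sum>j\<in>UNIV. \<Sum>l\<in>UNIV. \<delta> i j k * \<Gamma> j i l ?x * H k l)"
        by (subst sum3_rot) (simp add: sum_distrib_left mult.assoc Hs)
      also have "\<dots> = (\<Sum>k\<in>UNIV. \<Sum>l\<in>UNIV. \<Sum>i\<in>UNIV. \<Sum>j\<in>UNIV. \<delta> i j k * \<Gamma> j i l ?x * H k l)"
        by (rule sum.cong[OF refl], subst (2) sum.swap, rule sum.cong[OF refl]) (rule sum.swap)
      finally show ?thesis .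
    qed
    have 3: "(\<Sum>i\<in>UNIV. \<Sum>j\<in>UNIV. \<Sum>k\<in>UNIV. \<delta> i j k * (\<Sum>l\<in>UNIV. \<Gamma> k i l ?x * H j l))
      = (\<Sum>i\<in>UNIV. \<Sum>j\<in>UNIV. \<Sum>k\<in>UNIV. \<delta> i j k * (\<Sum>l\<in>UNIV. \<Gamma> j i l ?x * H l k))"
      by (rule sum.cong[OF refl], subst sum.swap) (simp add: sd[of _ _ j for j] Hs)
    show ?thesis unfolding 1 c3_def
      using 2 3 by (simp add: distrib_left sum.distrib)
  qed
  \<comment> \<open>Substituting \<Gamma>' = \<Gamma> + \<delta>, the two mixed products agree.
    Three times the right-hand side is what \<open>main\<close> and \<open>second\<close> supply: 3
    times 2 mixed products, and -3/2 times -2 pure ones.\<close>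
  have r: "(\<Sum>i\<in>UNIV. \<Sum>j\<in>UNIV. (ric \<Gamma>' ?x (axis i 1) (axis j 1) - ric \<Gamma> ?x (axis i 1) (axis j 1)) * H i j)
    = 2 * (\<Sum>i\<in>UNIV. \<Sum>j\<in>UNIV. \<Sum>n\<in>UNIV. \<Sum>m\<in>UNIV. \<delta> n m i * \<Gamma> m n j ?x * H i j)
      + (\<Sum>i\<in>UNIV. \<Sum>j\<in>UNIV. \<Sum>n\<in>UNIV. \<Sum>m\<in>UNIV. \<delta> n m i * \<delta> m n j * H i j)"
  proof -
    have g: "\<Gamma>' k i j ?x = \<Gamma> k i j ?x + \<delta> k i j" for k i j by (simp add: \<delta>_def)
    have 1: "(\<Sum>i\<in>UNIV. \<Sum>j\<in>UNIV. \<Sum>n\<in>UNIV. \<Sum>m\<in>UNIV. \<Gamma> n m i ?x * \<delta> m n j * H i j)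
      = (\<Sum>i\<in>UNIV. \<Sum>j\<in>UNIV. \<Sum>n\<in>UNIV. \<Sum>m\<in>UNIV. \<delta> n m i * \<Gamma> m n j ?x * H i j)"
      by (subst sum.swap, rule sum.cong[OF refl], rule sum.cong[OF refl], subst sum.swap, intro sum.cong refl) (simp add: Hs)
    show ?thesis unfolding ric_axis[of \<Gamma>, OF sy(1)[OF S(2)]] ric_axis[of \<Gamma>', OF sy(2)[OF S(2)]] g
      using 1 by (simp add: algebra_simps sum.distrib sum_distrib_left)
  qed
  show ?thesis
    unfolding L_loc_def L_expl_def Let_def C_def[symmetric] T first second third[unfolded V_def] main r[unfolded H_def] H_def V_def
    by (simp add: third[unfolded V_def] algebra_simps)
qed


section \<open>Naturality of the operator\<close>

lemma base_part_nth: "base_part w $ i = w $ Inl i" and fibre_part_nth: "fibre_part w $ i = w $ Inr i"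
  by (simp_all add: base_part_def fibre_part_def)

lemma sum_pair:
  "(\<Sum>p\<in>UNIV. F (fst p) (snd p)) = (\<Sum>b\<in>UNIV. \<Sum>c\<in>UNIV. F b (c :: 'n::finite))"
  by (simp add: sum.cartesian_product case_prod_beta)

section \<open>Fibre derivatives along the cotangent lift\<close>

lemma smooth_on_ctl_compose:
  assumes "diffeo_on \<phi> \<psi> S T" "smooth_on (cyl T) f"
  shows "smooth_on (cyl S) (\<lambda>w. f (ctl \<phi> \<psi> w))"
proof -
  note C = diffeo_onD[OF diffeo_on_ctl[OF assms(1)]]
  show ?thesis by (rule smooth_on_compose[OF C(1,2,5) assms(2) C(3)])
qed

lemma smooth_on_vhess: "smooth_on U q \<Longrightarrow> smooth_on U (vhess q j k)"
  by (simp add: vhess_def smooth_on_dd)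

lemma smooth_inverse_entry:
  assumes "diffeo_on \<phi> \<psi> S T"
  shows "smooth_on S (\<lambda>x. dd (axis a 1) \<psi> (\<phi> x) $ j)"
proof -
  note D = diffeo_onD[OF assms]
  show ?thesis
    by (rule smooth_on_component[OF D(1) smooth_on_compose[OF D(1,2,5) smooth_on_dd[OF D(4)] D(3)]])
qed

text \<open>The lift is linear on each fibre, with the transposed inverse Jacobian as its matrix, so
  a vertical axis goes to a combination of vertical axes.\<close>

lemma dd_ctl_vertical:
  assumes "diffeo_on \<phi> \<psi> S T" "w \<in> cyl S"
  shows "dd (axis (Inr j) 1) (ctl \<phi> \<psi>) w =
    (\<Sum>a\<in>UNIV. (dd (axis a 1) \<psi> (\<phi> (base_part w)) $ j) *\<^sub>R axis (Inr a) 1)" (is "?l = ?r")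
proof (rule base_fibre_eqI)
  note D = diffeo_onD[OF assms(1)]
  have w: "base_part w \<in> S" using assms(2) by simp
  have r: "?r $ Inl i = 0" "?r $ Inr i = dd (axis i 1) \<psi> (\<phi> (base_part w)) $ j" for i
    by (simp_all add: axis_nth_if if_distrib[of "(*) _"] cong: if_cong)
  have 0: "dd 0 \<phi> (base_part w) = 0" by (rule linear_0[OF dd_linear[OF D(7)[OF w]]])
  show "base_part ?l = base_part ?r"
    unfolding dd_ctl_base[OF assms] using 0 r(1) by (simp add: base_part_nth vec_eq_iff)
  have 00: "dd 0 (dd V \<psi>) (\<phi> (base_part w)) = 0" for V
    by (rule linear_0[OF dd_linear[OF smooth_on_differentiable[OF smooth_on_dd[OF D(4)] D(5)[OF w]]]])
  have "fibre_part ?l \<bullet> axis i 1 = dd (axis i 1) \<psi> (\<phi> (base_part w)) $ j" for i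
    unfolding dd_ctl_fibre[OF assms] using 0 00 by simp
  then show "fibre_part ?l = fibre_part ?r"
    using r(2) by (simp only: inner_axis_vec vec_eq_iff fibre_part_nth simp_thms)
qed

lemma dd_vertical_compose:
  fixes f :: "real^('n + 'n::finite) \<Rightarrow> real"
  assumes "diffeo_on \<phi> \<psi> S T" "w \<in> cyl S" "smooth_on (cyl T) f"
  shows "dd (axis (Inr j) 1) (\<lambda>w. f (ctl \<phi> \<psi> w)) w =
    (\<Sum>a\<in>UNIV. dd (axis a 1) \<psi> (\<phi> (base_part w)) $ j * dd (axis (Inr a) 1) f (ctl \<phi> \<psi> w))"
proof -
  note C = diffeo_onD[OF diffeo_on_ctl[OF assms(1)]]
  have d: "f differentiable (at (ctl \<phi> \<psi> w))"
    by (rule smooth_on_differentiable[OF assms(3) C(5)[OF assms(2)]])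
  interpret linear "\<lambda>v. dd v f (ctl \<phi> \<psi> w)" by (rule dd_linear[OF d])
  show ?thesis unfolding dd_compose[OF C(7)[OF assms(2)] d] dd_ctl_vertical[OF assms(1,2)]
    by (simp only: sum scaleR real_scaleR_def)
qed

text \<open>Coefficients that depend on the base point alone are constants for a fibre derivative.
  Iterated fibre derivatives therefore transform as contravariant tensors, without derivatives of
  the Jacobian.\<close>

lemma dd_vertical_combination:
  fixes f :: "'i \<Rightarrow> real^('n + 'n::finite) \<Rightarrow> real"
  assumes "diffeo_on \<phi> \<psi> S T" "w \<in> cyl S" "\<And>b. smooth_on (cyl T) (f b)" "\<And>b. smooth_on S (c b)"
  shows "dd (axis (Inr j) 1) (\<lambda>w. \<Sum>b\<in>I. c b (base_part w) * f b (ctl \<phi> \<psi> w)) w =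
    (\<Sum>b\<in>I. c b (base_part w) * (\<Sum>a\<in>UNIV. dd (axis a 1) \<psi> (\<phi> (base_part w)) $ j * dd (axis (Inr a) 1) (f b) (ctl \<phi> \<psi> w)))"
proof -
  note D = diffeo_onD[OF assms(1)]
  have 1: "(\<lambda>w. c b (base_part w)) differentiable (at w)" for b
    by (rule smooth_on_differentiable[OF smooth_on_cyl[OF D(1) assms(4)] assms(2)])
  have 2: "(\<lambda>w. f b (ctl \<phi> \<psi> w)) differentiable (at w)" for b
    by (rule smooth_on_differentiable[OF smooth_on_ctl_compose[OF assms(1,3)] assms(2)])
  have cd: "c b differentiable (at (base_part w))" for b
    using smooth_on_differentiable[OF assms(4)] assms(2) by simp
  have 3: "dd (axis (Inr j) 1) (\<lambda>w. c b (base_part w)) w = 0" for b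
    unfolding dd_cyl[OF cd] using linear_0[OF dd_linear[OF cd]] by simp
  show ?thesis
    by (subst dd_sum) (simp_all add: differentiable_bilinear[OF bounded_bilinear_mult 1 2] dd_mult[OF 1 2] 3
        dd_vertical_compose[OF assms(1,2,3)])
qed

lemma vhess_ctl:
  assumes "diffeo_on \<phi> \<psi> S T" "w \<in> cyl S" "smooth_on (cyl T) q"
  shows "vhess (\<lambda>w. q (ctl \<phi> \<psi> w)) j k w =
    (\<Sum>a\<in>UNIV. \<Sum>b\<in>UNIV. dd (axis a 1) \<psi> (\<phi> (base_part w)) $ j * dd (axis b 1) \<psi> (\<phi> (base_part w)) $ k
       * vhess q a b (ctl \<phi> \<psi> w))"
proof -
  note D = diffeo_onD[OF assms(1)] and C = diffeo_onD[OF diffeo_on_ctl[OF assms(1)]]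
  have "vhess (\<lambda>w. q (ctl \<phi> \<psi> w)) j k w = dd (axis (Inr j) 1) (\<lambda>w.
    \<Sum>b\<in>UNIV. dd (axis b 1) \<psi> (\<phi> (base_part w)) $ k * dd (axis (Inr b) 1) q (ctl \<phi> \<psi> w)) w"
    unfolding vhess_def
    by (rule dd_cong[OF C(1) assms(2)]) (rule dd_vertical_compose[OF assms(1) _ assms(3)])
  also have "\<dots> = (\<Sum>b\<in>UNIV. dd (axis b 1) \<psi> (\<phi> (base_part w)) $ k *
     (\<Sum>a\<in>UNIV. dd (axis a 1) \<psi> (\<phi> (base_part w)) $ j * dd (axis (Inr a) 1) (dd (axis (Inr b) 1) q) (ctl \<phi> \<psi> w)))"
    by (rule dd_vertical_combination[OF assms(1,2) smooth_on_dd[OF assms(3)] smooth_inverse_entry[OF assms(1)]])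
  finally show ?thesis unfolding vhess_def
    by (subst sum.swap) (simp add: sum_distrib_left mult_ac)
qed

lemma vthird_ctl:
  assumes "diffeo_on \<phi> \<psi> S T" "w \<in> cyl S" "smooth_on (cyl T) q"
  shows "vthird (\<lambda>w. q (ctl \<phi> \<psi> w)) i j k w =
    (\<Sum>a\<in>UNIV. \<Sum>b\<in>UNIV. \<Sum>c\<in>UNIV. dd (axis a 1) \<psi> (\<phi> (base_part w)) $ i * dd (axis b 1) \<psi> (\<phi> (base_part w)) $ j
       * dd (axis c 1) \<psi> (\<phi> (base_part w)) $ k * vthird q a b c (ctl \<phi> \<psi> w))"
proof -
  note D = diffeo_onD[OF assms(1)] and C = diffeo_onD[OF diffeo_on_ctl[OF assms(1)]]
  let ?n = "\<lambda>a j x. dd (axis a 1) \<psi> (\<phi> x) $ j"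
  have "vthird (\<lambda>w. q (ctl \<phi> \<psi> w)) i j k w = dd (axis (Inr i) 1) (\<lambda>w.
    \<Sum>p\<in>UNIV. ?n (fst p) j (base_part w) * ?n (snd p) k (base_part w) * vhess q (fst p) (snd p) (ctl \<phi> \<psi> w)) w"
    unfolding vthird_def
    by (rule dd_cong[OF C(1) assms(2)])
      (simp add: vhess_ctl[OF assms(1) _ assms(3)] sum.cartesian_product case_prod_beta)
  also have "\<dots> = (\<Sum>p\<in>UNIV. ?n (fst p) j (base_part w) * ?n (snd p) k (base_part w) *
     (\<Sum>a\<in>UNIV. ?n a i (base_part w) * dd (axis (Inr a) 1) (vhess q (fst p) (snd p)) (ctl \<phi> \<psi> w)))"
    by (rule dd_vertical_combination[OF assms(1,2) smooth_on_vhess[OF assms(3)]])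
      (intro smooth_on_mult D(1) smooth_inverse_entry[OF assms(1)])
  also have "\<dots> = (\<Sum>b\<in>UNIV. \<Sum>c\<in>UNIV. \<Sum>a\<in>UNIV. ?n a i (base_part w) * ?n b j (base_part w)
       * ?n c k (base_part w) * vthird q a b c (ctl \<phi> \<psi> w))"
    using sum_pair[of "\<lambda>b c. ?n b j (base_part w) * ?n c k (base_part w) *
      (\<Sum>a\<in>UNIV. ?n a i (base_part w) * dd (axis (Inr a) 1) (vhess q b c) (ctl \<phi> \<psi> w))"]
    by (simp add: vthird_def sum_distrib_left mult_ac)
  also have "\<dots> = (\<Sum>a\<in>UNIV. \<Sum>b\<in>UNIV. \<Sum>c\<in>UNIV. ?n a i (base_part w) * ?n b j (base_part w)
       * ?n c k (base_part w) * vthird q a b c (ctl \<phi> \<psi> w))"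
    by (subst sum3_rot) simp
  finally show ?thesis .
qed

text \<open>The inhomogeneous term in the transformation law of Christoffel symbols.\<close>

definition hterm :: "(real^'m::finite \<Rightarrow> real^'m) \<Rightarrow> (real^'m \<Rightarrow> real^'m) \<Rightarrow> real^'m \<Rightarrow> real^'m \<Rightarrow> real^'m \<Rightarrow> real^'m" where
  "hterm \<phi> \<psi> x X Y = dd (dd X (dd Y \<phi>) x) \<psi> (\<phi> x)"

lemma hterm_commute: "diffeo_on \<phi> \<psi> S T \<Longrightarrow> x \<in> S \<Longrightarrow> hterm \<phi> \<psi> x X Y = hterm \<phi> \<psi> x Y X"
  unfolding hterm_def using dd_commute diffeo_onD(1,3) by metis

lemma hterm_linear:
  assumes "diffeo_on \<phi> \<psi> S T" "x \<in> S"
  shows "linear (\<lambda>X. hterm \<phi> \<psi> x X Y)" "linear (\<lambda>Y. hterm \<phi> \<psi> x X Y)"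
proof -
  note D = diffeo_onD[OF assms(1)]
  have dY: "dd Y \<phi> differentiable (at x)" for Y
    using smooth_on_differentiable[OF smooth_on_dd[OF D(3)] assms(2)] .
  show l: "linear (\<lambda>X. hterm \<phi> \<psi> x X Y)" for Y
    using linear_compose[OF dd_linear[OF dY, of Y] dd_linear[OF D(8)[OF assms(2)]]] by (simp add: hterm_def o_def)
  show "linear (\<lambda>Y. hterm \<phi> \<psi> x X Y)"
    unfolding hterm_commute[OF assms, of X] by (rule l)
qed

text \<open>The formula for the second derivative of the inverse, with \<open>V\<close> written as
  d\<phi> of d\<psi> V.\<close>

lemma dd_inverse_entry:
  assumes "diffeo_on \<phi> \<psi> S T" "x \<in> S"
  shows "dd (dd X \<phi> x) (dd V \<psi>) (\<phi> x) = - hterm \<phi> \<psi> x X (dd V \<psi> (\<phi> x))"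
  using dd_dd_inverse[OF assms, of X "dd V \<psi> (\<phi> x)"] by (simp add: hterm_def dd_inverse'[OF assms])

lemma linear_expand:
  fixes f :: "real^'m::finite \<Rightarrow> 'b::real_vector"
  assumes "linear f"
  shows "f V = (\<Sum>l\<in>UNIV. V $ l *\<^sub>R f (axis l 1))"
proof -
  interpret linear f by fact
  have "V = (\<Sum>l\<in>UNIV. V $ l *\<^sub>R axis l 1)"
    using basis_expansion[of V] by (simp add: scalar_mult_eq_scaleR)
  then have "f V = f (\<Sum>l\<in>UNIV. V $ l *\<^sub>R axis l 1)" by simp
  then show ?thesis by (simp only: sum scaleR)
qed

text \<open>A base derivative of the fibre Hessian is not tensorial. Two corrections come from
  differentiating the entries of the inverse Jacobian that transform the Hessian, the third from the
  vertical motion of the image when the base point moves with fixed fibre coordinates.\<close>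

lemma dd_base_vhess_ctl:
  fixes q :: "real^('n + 'n::finite) \<Rightarrow> real" and \<phi> \<psi> :: "real^'n \<Rightarrow> real^'n" and w :: "real^('n + 'n)"
  assumes "diffeo_on \<phi> \<psi> S T" "w \<in> cyl S" "smooth_on (cyl T) q"
  defines "x \<equiv> base_part w" and "q' \<equiv> (\<lambda>w. q (ctl \<phi> \<psi> w))"
  defines "B \<equiv> hterm \<phi> \<psi> x"
  shows "dd (bvec X) (vhess q' j k) w =
    (\<Sum>a\<in>UNIV. \<Sum>b\<in>UNIV. dd (axis a 1) \<psi> (\<phi> x) $ j * dd (axis b 1) \<psi> (\<phi> x) $ k
       * dd (bvec (dd X \<phi> x)) (vhess q a b) (ctl \<phi> \<psi> w))
    - (\<Sum>l\<in>UNIV. B X (axis l 1) $ j * vhess q' l k w)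
    - (\<Sum>l\<in>UNIV. B X (axis l 1) $ k * vhess q' j l w)
    - (\<Sum>l\<in>UNIV. (fibre_part w \<bullet> B X (axis l 1)) * vthird q' l j k w)"
proof -
  note D = diffeo_onD[OF assms(1)] and C = diffeo_onD[OF diffeo_on_ctl[OF assms(1)]]
  have x: "x \<in> S" using assms(2) by (simp add: x_def)
  let ?n = "\<lambda>a j x. dd (axis a 1) \<psi> (\<phi> x) $ j" and ?w = "ctl \<phi> \<psi> w"
  have nd: "?n a j differentiable (at (base_part w))" for a j
    by (rule smooth_on_differentiable[OF smooth_inverse_entry[OF assms(1)]]) (use x in \<open>simp add: x_def\<close>)
  have nd': "(\<lambda>w. ?n a j (base_part w)) differentiable (at w)" for a j
    by (rule differentiable_compose[OF nd bounded_linear_imp_differentiable[OF bounded_linear_base_part]])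
  have hd: "(\<lambda>w. vhess q a b (ctl \<phi> \<psi> w)) differentiable (at w)" for a b
    by (rule smooth_on_differentiable[OF smooth_on_ctl_compose[OF assms(1) smooth_on_vhess[OF assms(3)]] assms(2)])
  have hd': "vhess q a b differentiable (at ?w)" for a b
    by (rule smooth_on_differentiable[OF smooth_on_vhess[OF assms(3)] C(5)[OF assms(2)]])
  have n': "dd (bvec X) (\<lambda>w. ?n a j (base_part w)) w = - (\<Sum>l\<in>UNIV. ?n a l x * B X (axis l 1) $ j)" for a j
  proof -
    have s: "dd (axis a 1) \<psi> differentiable (at (\<phi> x))"
      using smooth_on_differentiable[OF smooth_on_dd[OF D(4)] D(5)[OF x]] .
    have "dd (bvec X) (\<lambda>w. ?n a j (base_part w)) w = dd X (?n a j) x"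
      unfolding dd_cyl[OF nd] by (simp add: x_def)
    also have "\<dots> = dd X (\<lambda>x. dd (axis a 1) \<psi> (\<phi> x)) x $ j"
      by (rule dd_component[OF differentiable_compose[OF s D(7)[OF x]]])
    also have "\<dots> = - B X (dd (axis a 1) \<psi> (\<phi> x)) $ j"
      unfolding dd_compose[OF D(7)[OF x] s] dd_inverse_entry[OF assms(1) x] B_def by simp
    also have "B X (dd (axis a 1) \<psi> (\<phi> x)) = (\<Sum>l\<in>UNIV. ?n a l x *\<^sub>R B X (axis l 1))"
      unfolding B_def by (rule linear_expand[OF hterm_linear(2)[OF assms(1) x]])
    finally show ?thesis by simp
  qed
  have h': "dd (bvec X) (\<lambda>w. vhess q a b (ctl \<phi> \<psi> w)) w = dd (bvec (dd X \<phi> x)) (vhess q a b) ?w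
     - (\<Sum>l\<in>UNIV. (fibre_part w \<bullet> B X (axis l 1)) * (\<Sum>c\<in>UNIV. ?n c l x * vthird q c a b ?w))" for a b
  proof -
    \<comment> \<open>The lift carries the horizontal vector \<open>bvec X\<close> to a horizontal
      vector plus this vertical one, which is linear in the covector.\<close>
    let ?u = "\<Sum>c\<in>UNIV. (- (\<Sum>l\<in>UNIV. ?n c l x * (fibre_part w \<bullet> B X (axis l 1)))) *\<^sub>R (axis (Inr c) 1 :: real^('n + 'n))"
    have u: "?u $ Inl i = 0" "?u $ Inr i = - (\<Sum>l\<in>UNIV. ?n i l x * (fibre_part w \<bullet> B X (axis l 1)))" for i
      by (simp_all add: axis_nth_if if_distrib[of "(*) _"] if_distrib[of uminus] cong: if_cong)
    have e: "dd (bvec X) (ctl \<phi> \<psi>) w = bvec (dd X \<phi> x) + ?u"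
    proof (rule base_fibre_eqI)
      show "base_part (dd (bvec X) (ctl \<phi> \<psi>) w) = base_part (bvec (dd X \<phi> x) + ?u)"
        unfolding dd_ctl_base[OF assms(1,2)] using u(1) by (simp add: x_def vec_eq_iff base_part_nth)
      have "fibre_part (dd (bvec X) (ctl \<phi> \<psi>) w) \<bullet> axis c 1 = fibre_part ?u \<bullet> axis c 1" for c
      proof -
        have "fibre_part (dd (bvec X) (ctl \<phi> \<psi>) w) \<bullet> axis c 1 = - (fibre_part w \<bullet> B X (dd (axis c 1) \<psi> (\<phi> x)))"
          unfolding dd_ctl_fibre[OF assms(1,2)] x_def[symmetric] by (simp add: dd_inverse_entry[OF assms(1) x] B_def)
        also have "B X (dd (axis c 1) \<psi> (\<phi> x)) = (\<Sum>l\<in>UNIV. ?n c l x *\<^sub>R B X (axis l 1))"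
          unfolding B_def by (rule linear_expand[OF hterm_linear(2)[OF assms(1) x]])
        also have "- (fibre_part w \<bullet> (\<Sum>l\<in>UNIV. ?n c l x *\<^sub>R B X (axis l 1))) = ?u $ Inr c"
          unfolding u(2) by (simp add: inner_sum_right)
        finally show ?thesis by (simp only: inner_axis_vec fibre_part_nth)
      qed
      then have "fibre_part (dd (bvec X) (ctl \<phi> \<psi>) w) = fibre_part ?u"
        by (simp only: inner_axis_vec vec_eq_iff simp_thms)
      then show "fibre_part (dd (bvec X) (ctl \<phi> \<psi>) w) = fibre_part (bvec (dd X \<phi> x) + ?u)" by simp
    qed
    interpret linear "\<lambda>v. dd v (vhess q a b) ?w" by (rule dd_linear[OF hd'])
    have "dd (bvec X) (\<lambda>w. vhess q a b (ctl \<phi> \<psi> w)) w = dd (bvec (dd X \<phi> x)) (vhess q a b) ?w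
      + (\<Sum>c\<in>UNIV. (- (\<Sum>l\<in>UNIV. ?n c l x * (fibre_part w \<bullet> B X (axis l 1)))) * vthird q c a b ?w)"
      unfolding dd_compose[OF C(7)[OF assms(2)] hd'] e vthird_def by (simp only: add sum scaleR real_scaleR_def)
    also have "(\<Sum>c\<in>UNIV. (- (\<Sum>l\<in>UNIV. ?n c l x * (fibre_part w \<bullet> B X (axis l 1)))) * vthird q c a b ?w)
      = - (\<Sum>c\<in>UNIV. \<Sum>l\<in>UNIV. (fibre_part w \<bullet> B X (axis l 1)) * (?n c l x * vthird q c a b ?w))"
      by (simp add: sum_negf sum_distrib_left mult_ac)
    also have "\<dots> = - (\<Sum>l\<in>UNIV. (fibre_part w \<bullet> B X (axis l 1)) * (\<Sum>c\<in>UNIV. ?n c l x * vthird q c a b ?w))"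
      by (subst sum.swap) (simp add: sum_distrib_left)
    finally show ?thesis by simp
  qed
  have nn: "(\<lambda>w. ?n a j (base_part w) * ?n b k (base_part w)) differentiable (at w)" for a b j k
    by (rule differentiable_bilinear[OF bounded_bilinear_mult nd' nd'])
  have d3: "(\<lambda>w. ?n a j (base_part w) * ?n b k (base_part w) * vhess q a b (ctl \<phi> \<psi> w)) differentiable (at w)" for a b
    by (rule differentiable_bilinear[OF bounded_bilinear_mult nn hd])
  have ds: "(\<lambda>w. \<Sum>b\<in>UNIV. ?n a j (base_part w) * ?n b k (base_part w) * vhess q a b (ctl \<phi> \<psi> w)) differentiable (at w)" for a
    by (intro differentiable_sum) (simp_all add: d3)
  have "dd (bvec X) (vhess q' j k) w = dd (bvec X) (\<lambda>w. \<Sum>a\<in>UNIV. \<Sum>b\<in>UNIV.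
      ?n a j (base_part w) * ?n b k (base_part w) * vhess q a b (ctl \<phi> \<psi> w)) w"
    unfolding q'_def by (rule dd_cong[OF C(1) assms(2)]) (rule vhess_ctl[OF assms(1) _ assms(3)])
  also have "\<dots> = (\<Sum>a\<in>UNIV. \<Sum>b\<in>UNIV. dd (bvec X) (\<lambda>w. ?n a j (base_part w) * ?n b k (base_part w) * vhess q a b (ctl \<phi> \<psi> w)) w)"
    by (simp only: dd_sum[OF ds] dd_sum[OF d3])
  also have "\<dots> = (\<Sum>a\<in>UNIV. \<Sum>b\<in>UNIV.
      ?n a j x * ?n b k x * dd (bvec (dd X \<phi> x)) (vhess q a b) ?w
      - (\<Sum>l\<in>UNIV. ?n a l x * B X (axis l 1) $ j) * ?n b k x * vhess q a b ?w
      - ?n a j x * (\<Sum>l\<in>UNIV. ?n b l x * B X (axis l 1) $ k) * vhess q a b ?w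
      - ?n a j x * ?n b k x * (\<Sum>l\<in>UNIV. (fibre_part w \<bullet> B X (axis l 1)) * (\<Sum>c\<in>UNIV. ?n c l x * vthird q c a b ?w)))"
    by (intro sum.cong refl, unfold dd_mult[OF nn hd] dd_mult[OF nd' nd'] n' h' x_def[symmetric]) (simp add: algebra_simps)
  also have "\<dots> = (\<Sum>a\<in>UNIV. \<Sum>b\<in>UNIV. ?n a j x * ?n b k x * dd (bvec (dd X \<phi> x)) (vhess q a b) ?w)
      - (\<Sum>a\<in>UNIV. \<Sum>b\<in>UNIV. (\<Sum>l\<in>UNIV. ?n a l x * B X (axis l 1) $ j) * ?n b k x * vhess q a b ?w)
      - (\<Sum>a\<in>UNIV. \<Sum>b\<in>UNIV. ?n a j x * (\<Sum>l\<in>UNIV. ?n b l x * B X (axis l 1) $ k) * vhess q a b ?w)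
      - (\<Sum>a\<in>UNIV. \<Sum>b\<in>UNIV. ?n a j x * ?n b k x * (\<Sum>l\<in>UNIV. (fibre_part w \<bullet> B X (axis l 1)) * (\<Sum>c\<in>UNIV. ?n c l x * vthird q c a b ?w)))"
    by (simp only: sum_subtractf)
  also have "(\<Sum>a\<in>UNIV. \<Sum>b\<in>UNIV. (\<Sum>l\<in>UNIV. ?n a l x * B X (axis l 1) $ j) * ?n b k x * vhess q a b ?w)
      = (\<Sum>l\<in>UNIV. B X (axis l 1) $ j * vhess q' l k w)"
    unfolding q'_def vhess_ctl[OF assms(1-3)] x_def[symmetric] sum_distrib_left sum_distrib_right
    by (subst sum3_rot) (simp add: mult_ac)
  also have "(\<Sum>a\<in>UNIV. \<Sum>b\<in>UNIV. ?n a j x * (\<Sum>l\<in>UNIV. ?n b l x * B X (axis l 1) $ k) * vhess q a b ?w)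
      = (\<Sum>l\<in>UNIV. B X (axis l 1) $ k * vhess q' j l w)"
    unfolding q'_def vhess_ctl[OF assms(1-3)] x_def[symmetric] sum_distrib_left sum_distrib_right
    by (subst sum3_rot) (simp add: mult_ac)
  also have "(\<Sum>a\<in>UNIV. \<Sum>b\<in>UNIV. ?n a j x * ?n b k x * (\<Sum>l\<in>UNIV. (fibre_part w \<bullet> B X (axis l 1)) * (\<Sum>c\<in>UNIV. ?n c l x * vthird q c a b ?w)))
      = (\<Sum>l\<in>UNIV. (fibre_part w \<bullet> B X (axis l 1)) * vthird q' l j k w)"
  proof -
    have "(\<Sum>a\<in>UNIV. \<Sum>b\<in>UNIV. ?n a j x * ?n b k x * (\<Sum>l\<in>UNIV. (fibre_part w \<bullet> B X (axis l 1)) * (\<Sum>c\<in>UNIV. ?n c l x * vthird q c a b ?w)))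
      = (\<Sum>a\<in>UNIV. \<Sum>b\<in>UNIV. \<Sum>l\<in>UNIV. (fibre_part w \<bullet> B X (axis l 1)) * (\<Sum>c\<in>UNIV. ?n c l x * ?n a j x * ?n b k x * vthird q c a b ?w))"
      by (simp add: sum_distrib_left mult_ac)
    also have "\<dots> = (\<Sum>l\<in>UNIV. \<Sum>a\<in>UNIV. \<Sum>b\<in>UNIV. (fibre_part w \<bullet> B X (axis l 1)) * (\<Sum>c\<in>UNIV. ?n c l x * ?n a j x * ?n b k x * vthird q c a b ?w))"
      by (rule sum3_rot)
    also have "\<dots> = (\<Sum>l\<in>UNIV. (fibre_part w \<bullet> B X (axis l 1)) * (\<Sum>a\<in>UNIV. \<Sum>b\<in>UNIV. \<Sum>c\<in>UNIV. ?n c l x * ?n a j x * ?n b k x * vthird q c a b ?w))"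
      by (simp only: sum_distrib_left)
    also have "\<dots> = (\<Sum>l\<in>UNIV. (fibre_part w \<bullet> B X (axis l 1)) * vthird q' l j k w)"
      unfolding q'_def vthird_ctl[OF assms(1-3)] x_def[symmetric]
      by (rule sum.cong[OF refl], rule arg_cong[where f = "(*) _"], rule sum3_rot)
    finally show ?thesis .
  qed
  finally show ?thesis by simp
qed


section \<open>Derivatives of the connection and contractions with the Jacobian\<close>

lemma smooth_on_cvec:
  assumes "open S" "open T" "\<And>k i j. smooth_on T (\<Gamma> k i j)" "\<And>x. x \<in> S \<Longrightarrow> g x \<in> T"
    "smooth_on S g" "smooth_on S A" "smooth_on S B"
  shows "smooth_on S (\<lambda>x. cvec \<Gamma> (g x) (A x) (B x))"
proof (rule smooth_on_vec[OF assms(1)])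
  fix k
  have "smooth_on S (\<lambda>x. \<Gamma> k i j (g x))" for i j
    by (rule smooth_on_compose[OF assms(1,2,4,3,5)])
  then show "smooth_on S (\<lambda>x. cvec \<Gamma> (g x) (A x) (B x) $ k)"
    by (simp add: cvec_def bil_def)
      (intro smooth_on_sum smooth_on_mult assms(1) smooth_on_component[OF assms(1,6)] smooth_on_component[OF assms(1,7)])
qed

lemma dd_cvec:
  fixes g :: "real^'m::finite \<Rightarrow> real^'m"
  assumes "open S" "open T" "\<And>k i j. smooth_on T (\<Gamma> k i j)" "\<And>x. x \<in> S \<Longrightarrow> g x \<in> T"
    "smooth_on S g" "smooth_on S A" "smooth_on S B" "x \<in> S"
  shows "dd Z (\<lambda>x. cvec \<Gamma> (g x) (A x) (B x)) x =
    cvec (dconn \<Gamma> (dd Z g x)) (g x) (A x) (B x) + cvec \<Gamma> (g x) (dd Z A x) (B x) + cvec \<Gamma> (g x) (A x) (dd Z B x)"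
proof -
  have d: "(\<lambda>x. cvec \<Gamma> (g x) (A x) (B x)) differentiable (at x)"
    by (rule smooth_on_differentiable[OF smooth_on_cvec[OF assms(1-7)] assms(8)])
  have "dd Z (\<lambda>x. cvec \<Gamma> (g x) (A x) (B x)) x $ k = dd Z (\<lambda>x. bil (\<Gamma> k) (g x) (A x) (B x)) x" for k
    using dd_component[OF d, of Z k] by (simp add: cvec_def)
  moreover have "dd Z (\<lambda>x. bil (\<Gamma> k) (g x) (A x) (B x)) x =
     bil (\<lambda>i j. dd (dd Z g x) (\<Gamma> k i j)) (g x) (A x) (B x)
    + bil (\<Gamma> k) (g x) (dd Z A x) (B x) + bil (\<Gamma> k) (g x) (A x) (dd Z B x)" for k
    by (rule dd_bil[OF smooth_on_differentiable[OF assms(3) assms(4)[OF assms(8)]]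
          smooth_on_differentiable[OF assms(5,8)] smooth_on_differentiable[OF assms(6,8)] smooth_on_differentiable[OF assms(7,8)]])
  ultimately show ?thesis by (simp add: vec_eq_iff cvec_def)
qed

lemma cvec_dconn:
  assumes "open S" "\<And>k i j. smooth_on S (\<Gamma> k i j)" "x \<in> S"
  shows "cvec (dconn \<Gamma> Z) x X Y = dd Z (\<lambda>x. cvec \<Gamma> x X Y) x"
  using dd_cvec[OF assms(1,1,2) _ smooth_on_ident smooth_on_const smooth_on_const assms(3), where Z = Z]
  by (simp add: dd_bounded_linear[OF bounded_linear_ident] linear_rules)

text \<open>The identity d\<phi> d\<psi> = 1 in index form. It turns sums at the source point,
  weighted by entries of the inverse Jacobian, into sums at the image point.\<close>

lemma contract1:
  fixes f :: "real^'n::finite \<Rightarrow> real"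
  assumes "diffeo_on \<phi> \<psi> S T" "x \<in> S" "linear f"
  shows "(\<Sum>j\<in>UNIV. dd (axis a 1) \<psi> (\<phi> x) $ j * f (dd (axis j 1) \<phi> x)) = f (axis a 1)"
  using linear_expand[OF linear_compose[OF dd_linear[OF diffeo_onD(7)[OF assms(1,2)]] assms(3)], of "dd (axis a 1) \<psi> (\<phi> x)"]
  by (simp add: o_def dd_inverse'[OF assms(1,2)])

lemma sum4_rot:
  fixes G :: "'n::finite \<Rightarrow> 'n \<Rightarrow> 'n \<Rightarrow> 'n \<Rightarrow> 'b::comm_monoid_add"
  shows "(\<Sum>k\<in>UNIV. \<Sum>i\<in>UNIV. \<Sum>j\<in>UNIV. \<Sum>a\<in>UNIV. G k i j a) = (\<Sum>a\<in>UNIV. \<Sum>k\<in>UNIV. \<Sum>i\<in>UNIV. \<Sum>j\<in>UNIV. G k i j a)"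
proof -
  have "(\<Sum>k\<in>UNIV. \<Sum>i\<in>UNIV. \<Sum>j\<in>UNIV. \<Sum>a\<in>UNIV. G k i j a) = (\<Sum>k\<in>UNIV. \<Sum>a\<in>UNIV. \<Sum>i\<in>UNIV. \<Sum>j\<in>UNIV. G k i j a)"
    by (rule sum.cong[OF refl], rule sum3_rot)
  then show ?thesis by (simp only: sum.swap[of "\<lambda>k a. \<Sum>i\<in>UNIV. \<Sum>j\<in>UNIV. G k i j a"])
qed

lemma contract2:
  fixes F :: "'n::finite \<Rightarrow> 'n \<Rightarrow> real^'n \<Rightarrow> real^'n \<Rightarrow> real"
  assumes "diffeo_on \<phi> \<psi> S T" "x \<in> S" "\<And>a b Y. linear (\<lambda>X. F a b X Y)" "\<And>a b X. linear (F a b X)"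
  shows "(\<Sum>j\<in>UNIV. \<Sum>k\<in>UNIV. \<Sum>a\<in>UNIV. \<Sum>b\<in>UNIV. dd (axis a 1) \<psi> (\<phi> x) $ j * dd (axis b 1) \<psi> (\<phi> x) $ k
      * F a b (dd (axis j 1) \<phi> x) (dd (axis k 1) \<phi> x)) = (\<Sum>a\<in>UNIV. \<Sum>b\<in>UNIV. F a b (axis a 1) (axis b 1))"
    (is "(\<Sum>j\<in>UNIV. \<Sum>k\<in>UNIV. \<Sum>a\<in>UNIV. \<Sum>b\<in>UNIV. ?G j k a b) = _")
proof -
  have "(\<Sum>j\<in>UNIV. \<Sum>k\<in>UNIV. \<Sum>a\<in>UNIV. \<Sum>b\<in>UNIV. ?G j k a b) = (\<Sum>a\<in>UNIV. \<Sum>j\<in>UNIV. \<Sum>k\<in>UNIV. \<Sum>b\<in>UNIV. ?G j k a b)"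
    by (rule sum3_rot)
  also have "\<dots> = (\<Sum>a\<in>UNIV. \<Sum>b\<in>UNIV. \<Sum>j\<in>UNIV. \<Sum>k\<in>UNIV. ?G j k a b)"
    by (rule sum.cong[OF refl], rule sum3_rot)
  also have "\<dots> = (\<Sum>a\<in>UNIV. \<Sum>b\<in>UNIV. F a b (axis a 1) (axis b 1))"
    by (intro sum.cong refl)
      (simp only: mult.assoc sum_distrib_left[symmetric] contract1[OF assms(1,2,3)] contract1[OF assms(1,2,4)])
  finally show ?thesis .
qed

lemma contract3:
  fixes F :: "'n::finite \<Rightarrow> 'n \<Rightarrow> 'n \<Rightarrow> real^'n \<Rightarrow> real^'n \<Rightarrow> real^'n \<Rightarrow> real"
  assumes "diffeo_on \<phi> \<psi> S T" "x \<in> S" "\<And>a b c Y Z. linear (\<lambda>X. F a b c X Y Z)"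
    "\<And>a b c X Z. linear (\<lambda>Y. F a b c X Y Z)" "\<And>a b c X Y. linear (F a b c X Y)"
  shows "(\<Sum>i\<in>UNIV. \<Sum>j\<in>UNIV. \<Sum>k\<in>UNIV. \<Sum>a\<in>UNIV. \<Sum>b\<in>UNIV. \<Sum>c\<in>UNIV.
      dd (axis a 1) \<psi> (\<phi> x) $ i * dd (axis b 1) \<psi> (\<phi> x) $ j * dd (axis c 1) \<psi> (\<phi> x) $ k
      * F a b c (dd (axis i 1) \<phi> x) (dd (axis j 1) \<phi> x) (dd (axis k 1) \<phi> x))
    = (\<Sum>a\<in>UNIV. \<Sum>b\<in>UNIV. \<Sum>c\<in>UNIV. F a b c (axis a 1) (axis b 1) (axis c 1))"
    (is "(\<Sum>i\<in>UNIV. \<Sum>j\<in>UNIV. \<Sum>k\<in>UNIV. \<Sum>a\<in>UNIV. \<Sum>b\<in>UNIV. \<Sum>c\<in>UNIV. ?G i j k a b c) = _")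
proof -
  have "(\<Sum>i\<in>UNIV. \<Sum>j\<in>UNIV. \<Sum>k\<in>UNIV. \<Sum>a\<in>UNIV. \<Sum>b\<in>UNIV. \<Sum>c\<in>UNIV. ?G i j k a b c)
    = (\<Sum>a\<in>UNIV. \<Sum>i\<in>UNIV. \<Sum>j\<in>UNIV. \<Sum>k\<in>UNIV. \<Sum>b\<in>UNIV. \<Sum>c\<in>UNIV. ?G i j k a b c)"
    by (rule sum4_rot)
  also have "\<dots> = (\<Sum>a\<in>UNIV. \<Sum>b\<in>UNIV. \<Sum>i\<in>UNIV. \<Sum>j\<in>UNIV. \<Sum>k\<in>UNIV. \<Sum>c\<in>UNIV. ?G i j k a b c)"
    by (rule sum.cong[OF refl], rule sum4_rot)
  also have "\<dots> = (\<Sum>a\<in>UNIV. \<Sum>b\<in>UNIV. \<Sum>c\<in>UNIV. \<Sum>i\<in>UNIV. \<Sum>j\<in>UNIV. \<Sum>k\<in>UNIV. ?G i j k a b c)"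
    by (rule sum.cong[OF refl], rule sum.cong[OF refl], rule sum4_rot)
  also have "\<dots> = (\<Sum>a\<in>UNIV. \<Sum>b\<in>UNIV. \<Sum>c\<in>UNIV. F a b c (axis a 1) (axis b 1) (axis c 1))"
    by (intro sum.cong refl)
      (simp only: mult.assoc sum_distrib_left[symmetric] contract1[OF assms(1,2,3)] contract1[OF assms(1,2,4)]
        contract1[OF assms(1,2,5)])
  finally show ?thesis .
qed

lemma trace_commute:
  fixes F G :: "real^'n::finite \<Rightarrow> real^'n"
  assumes "linear F" "linear G"
  shows "(\<Sum>n\<in>UNIV. F (G (axis n 1)) $ n) = (\<Sum>n\<in>UNIV. G (F (axis n 1)) $ n)"
proof -
  have "(\<Sum>n\<in>UNIV. F (G (axis n 1)) $ n) = (\<Sum>n\<in>UNIV. \<Sum>l\<in>UNIV. G (axis n 1) $ l * F (axis l 1) $ n)"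
    by (subst linear_expand[OF assms(1)]) simp
  also have "\<dots> = (\<Sum>n\<in>UNIV. \<Sum>l\<in>UNIV. F (axis n 1) $ l * G (axis l 1) $ n)"
    by (subst sum.swap) (simp add: mult.commute)
  also have "\<dots> = (\<Sum>n\<in>UNIV. G (F (axis n 1)) $ n)"
    by (subst linear_expand[OF assms(2)]) simp
  finally show ?thesis .
qed

text \<open>Both connections acquire the same term B = d\<psi> D^2 \<phi>, so \<delta> is a tensor
  and only corrections bilinear in B and \<delta> remain. On third fibre derivatives they carry the
  factor -3 from the first sum and 3 - 1 - 1 + 2 from the second, where the last three terms agree
  after symmetrisation; on the fibre Hessian they carry -3 - 3 from the first sum and 3 + 3 from the
  third. Everything cancels.\<close>

theorem L_expl_natural:
  fixes q :: "real^('n + 'n::finite) \<Rightarrow> real" and \<phi> \<psi> :: "real^'n \<Rightarrow> real^'n" and w :: "real^('n + 'n)"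
  assumes diff: "diffeo_on \<phi> \<psi> S T" and w: "w \<in> cyl S"
    and sm: "\<And>k i j. smooth_on T (\<Gamma>1 k i j)" "\<And>k i j. smooth_on T (\<Gamma>2 k i j)"
    and sy: "\<And>y k i j. y \<in> T \<Longrightarrow> \<Gamma>1 k i j y = \<Gamma>1 k j i y" "\<And>y k i j. y \<in> T \<Longrightarrow> \<Gamma>2 k i j y = \<Gamma>2 k j i y"
    and q: "smooth_on (cyl T) q"
  shows "L_expl (pullback_conn \<phi> \<Gamma>1) (pullback_conn \<phi> \<Gamma>2) (\<lambda>w. q (ctl \<phi> \<psi> w)) w = L_expl \<Gamma>1 \<Gamma>2 q (ctl \<phi> \<psi> w)"
proof -
  note D = diffeo_onD[OF diff] and C = diffeo_onD[OF diffeo_on_ctl[OF diff]]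
  define x where "x = base_part w"
  define y where "y = \<phi> x"
  define \<xi> where "\<xi> = fibre_part w"
  define \<eta> where "\<eta> = fibre_part (ctl \<phi> \<psi> w)"
  define q' where "q' = (\<lambda>w. q (ctl \<phi> \<psi> w))"
  have x: "x \<in> S" using w by (simp add: x_def)
  have yT: "y \<in> T" using D(5)[OF x] by (simp add: y_def)
  define N where "N V = dd V \<psi> y" for V
  define J where "J X = dd X \<phi> x" for X
  define B where "B X Y = hterm \<phi> \<psi> x X Y" for X Y
  define G1 where "G1 X Y = N (cvec \<Gamma>1 y (J X) (J Y))" for X Y
  define G2 where "G2 X Y = N (cvec \<Gamma>2 y (J X) (J Y))" for X Y
  define \<delta> where "\<delta> X Y = G2 X Y - G1 X Y" for X Y
  define e :: "'n \<Rightarrow> real^'n" where "e i = axis i 1" for i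
  define H where "H i j = vhess q' i j w" for i j
  define V where "V i j k = vthird q' i j k w" for i j k
  have JN: "J (N X) = X" and NJ: "N (J X) = X" for X
    unfolding J_def N_def y_def by (rule dd_inverse'[OF diff x], rule dd_inverse[OF diff x])
  have lN: "linear N" unfolding N_def y_def by (rule dd_linear[OF D(8)[OF x]])
  have lJ: "linear J" unfolding J_def by (rule dd_linear[OF D(7)[OF x]])
  have lB: "linear (\<lambda>X. B X Y)" "linear (B X)" for X Y
    using hterm_linear[OF diff x] by (simp_all add: B_def[abs_def])
  note l = linear_add[OF lN] linear_cmul[OF lN] linear_diff[OF lN] linear_add[OF lJ] linear_cmul[OF lJ] linear_diff[OF lJ]
    linear_add[OF lB(1)] linear_cmul[OF lB(1)] linear_diff[OF lB(1)] linear_add[OF lB(2)] linear_cmul[OF lB(2)] linear_diff[OF lB(2)]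
    linear_rules linear_diff[OF cvec_linear(1)] linear_diff[OF cvec_linear(2)]
  have lG: "linear (\<lambda>X. G1 X Y)" "linear (G1 X)" "linear (\<lambda>X. G2 X Y)" "linear (G2 X)" for X Y
    by (auto simp: linear_iff G1_def G2_def l)
  have l\<delta>: "linear (\<lambda>X. \<delta> X Y)" "linear (\<delta> X)" for X Y
    using linear_compose_sub[OF lG(3) lG(1)] linear_compose_sub[OF lG(4) lG(2)] by (simp_all add: \<delta>_def[abs_def])
  note l' = l linear_add[OF lG(1)] linear_add[OF lG(2)] linear_add[OF lG(3)] linear_add[OF lG(4)]
    linear_add[OF l\<delta>(1)] linear_add[OF l\<delta>(2)] linear_diff[OF l\<delta>(1)] linear_diff[OF l\<delta>(2)]
  have Bs: "B X Y = B Y X" for X Y unfolding B_def by (rule hterm_commute[OF diff x])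
  have G1s: "G1 X Y = G1 Y X" for X Y unfolding G1_def by (subst cvec_commute[of \<Gamma>1]) (auto intro: sy yT)
  have G2s: "G2 X Y = G2 Y X" for X Y unfolding G2_def by (subst cvec_commute[of \<Gamma>2]) (auto intro: sy yT)
  have \<delta>s: "\<delta> X Y = \<delta> Y X" for X Y by (simp add: \<delta>_def G1s[of X] G2s[of X])
  have c1: "cvec (pullback_conn \<phi> \<Gamma>1) x X Y = G1 X Y + B X Y" for X Y
    unfolding cvec_pullback[OF diff x] G1_def B_def hterm_def N_def J_def y_def
    by (rule dd_add_left[OF D(8)[OF x]])
  have c2: "cvec (pullback_conn \<phi> \<Gamma>2) x X Y = G2 X Y + B X Y" for X Y
    unfolding cvec_pullback[OF diff x] G2_def B_def hterm_def N_def J_def y_def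
    by (rule dd_add_left[OF D(8)[OF x]])
  have J\<delta>: "J (\<delta> X Y) = cvec \<Gamma>2 y (J X) (J Y) - cvec \<Gamma>1 y (J X) (J Y)" for X Y
    by (simp add: \<delta>_def l G1_def G2_def JN)
  have q's: "smooth_on (cyl S) q'" unfolding q'_def by (rule smooth_on_ctl_compose[OF diff q])
  have Hs: "H i j = H j i" for i j unfolding H_def by (rule vhess_commute[OF C(1) w q's])
  have Vs: "V i j k = V j i k" "V i j k = V i k j" for i j k
    unfolding V_def using vthird_commute[OF C(1) w q's] by auto
  have \<eta>: "\<eta> \<bullet> V = \<xi> \<bullet> N V" for V
    using fibre_ctl[of \<psi> \<phi> w V] D(8)[OF x] by (simp add: \<eta>_def \<xi>_def N_def y_def x_def)

  \<comment> \<open>Only the difference of the connections is differentiated. Its inhomogeneous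
    terms have already dropped out, so no third derivative of \<phi> appears.\<close>
  have dc: "cvec (dconn (pullback_conn \<phi> \<Gamma>2) Z) x X Y - cvec (dconn (pullback_conn \<phi> \<Gamma>1) Z) x X Y =
     N (cvec (dconn \<Gamma>2 (J Z)) y (J X) (J Y) - cvec (dconn \<Gamma>1 (J Z)) y (J X) (J Y))
     - B Z (\<delta> X Y) + \<delta> (B Z X) Y + \<delta> X (B Z Y)" for X Y Z
  proof -
    define A1 where "A1 x = cvec \<Gamma>1 (\<phi> x) (dd X \<phi> x) (dd Y \<phi> x)" for x
    define A2 where "A2 x = cvec \<Gamma>2 (\<phi> x) (dd X \<phi> x) (dd Y \<phi> x)" for x
    have sA: "smooth_on S A1" "smooth_on S A2" unfolding A1_def A2_def
      by (rule smooth_on_cvec[OF D(1,2) sm(1) D(5) D(3) smooth_on_dd[OF D(3)] smooth_on_dd[OF D(3)]], assumption,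
          rule smooth_on_cvec[OF D(1,2) sm(2) D(5) D(3) smooth_on_dd[OF D(3)] smooth_on_dd[OF D(3)]])
    have dA: "A1 differentiable (at x)" "A2 differentiable (at x)"
      using sA smooth_on_differentiable x by blast+
    have JB: "dd Z (dd X \<phi>) x = J (B Z X)" for X Z
      by (simp add: J_def B_def hterm_def dd_inverse'[OF diff x])
    have A1': "dd Z A1 x = cvec (dconn \<Gamma>1 (J Z)) y (J X) (J Y) + cvec \<Gamma>1 y (J (B Z X)) (J Y) + cvec \<Gamma>1 y (J X) (J (B Z Y))"
      unfolding A1_def using dd_cvec[OF D(1,2) sm(1) D(5) D(3) smooth_on_dd[OF D(3)] smooth_on_dd[OF D(3)] x, where Z = Z]
      by (simp add: JB) (simp add: J_def y_def)
    have A2': "dd Z A2 x = cvec (dconn \<Gamma>2 (J Z)) y (J X) (J Y) + cvec \<Gamma>2 y (J (B Z X)) (J Y) + cvec \<Gamma>2 y (J X) (J (B Z Y))"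
      unfolding A2_def using dd_cvec[OF D(1,2) sm(2) D(5) D(3) smooth_on_dd[OF D(3)] smooth_on_dd[OF D(3)] x, where Z = Z]
      by (simp add: JB) (simp add: J_def y_def)
    have "cvec (dconn (pullback_conn \<phi> \<Gamma>2) Z) x X Y - cvec (dconn (pullback_conn \<phi> \<Gamma>1) Z) x X Y =
      dd Z (\<lambda>x. cvec (pullback_conn \<phi> \<Gamma>2) x X Y) x - dd Z (\<lambda>x. cvec (pullback_conn \<phi> \<Gamma>1) x X Y) x"
      by (simp only: cvec_dconn[OF D(1) smooth_on_pullback_conn[OF diff sm(1)] x] cvec_dconn[OF D(1) smooth_on_pullback_conn[OF diff sm(2)] x])
    also have "\<dots> = dd Z (\<lambda>x. cvec (pullback_conn \<phi> \<Gamma>2) x X Y - cvec (pullback_conn \<phi> \<Gamma>1) x X Y) x"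
      by (rule dd_diff[symmetric]; rule smooth_on_differentiable[OF _ x];
          rule smooth_on_cvec[OF D(1,1) smooth_on_pullback_conn[OF diff] _ smooth_on_ident smooth_on_const smooth_on_const];
          (assumption | rule sm))
    also have "\<dots> = dd Z (\<lambda>x. dd (A2 x - A1 x) \<psi> (\<phi> x)) x"
    proof (rule dd_cong[OF D(1) x])
      fix z assume z: "z \<in> S"
      show "cvec (pullback_conn \<phi> \<Gamma>2) z X Y - cvec (pullback_conn \<phi> \<Gamma>1) z X Y = dd (A2 z - A1 z) \<psi> (\<phi> z)"
        unfolding cvec_pullback[OF diff z] A1_def A2_def
        by (simp add: linear_add[OF dd_linear[OF D(8)[OF z]]] linear_diff[OF dd_linear[OF D(8)[OF z]]])
    qed
    also have "\<dots> = dd (dd Z (\<lambda>x. A2 x - A1 x) x) \<psi> (\<phi> x) + dd (dd Z \<phi> x) (dd (A2 x - A1 x) \<psi>) (\<phi> x)"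
      by (rule dd_dd_compose[OF D(1) x D(2,4,5) D(7)[OF x] differentiable_diff[OF dA(2,1)]])
    also have "dd Z (\<lambda>x. A2 x - A1 x) x = dd Z A2 x - dd Z A1 x"
      by (rule dd_diff[OF dA(2,1)])
    also have "dd (dd Z \<phi> x) (dd (A2 x - A1 x) \<psi>) (\<phi> x) = - B Z (\<delta> X Y)"
      unfolding dd_inverse_entry[OF diff x] B_def[symmetric]
      by (simp add: N_def[symmetric] y_def[symmetric] A1_def A2_def J_def[symmetric] \<delta>_def G1_def G2_def l)
    finally show ?thesis
      unfolding A1' A2' N_def[symmetric] y_def[symmetric]
      by (simp add: l \<delta>_def G1_def G2_def algebra_simps)
  qed

  \<comment> \<open>The term B X (\<delta> Y Z) occurs once in the derivative part and twice in the
    doubled quadratic part; hence the 3.\<close>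
  have P: "\<xi> \<bullet> Pvec (pullback_conn \<phi> \<Gamma>1) (pullback_conn \<phi> \<Gamma>2) x X Y Z = \<eta> \<bullet> Pvec \<Gamma>1 \<Gamma>2 y (J X) (J Y) (J Z)
     + 3 * (\<xi> \<bullet> B X (\<delta> Y Z)) - \<xi> \<bullet> \<delta> (B X Y) Z - \<xi> \<bullet> \<delta> Y (B X Z) + 2 * (\<xi> \<bullet> \<delta> X (B Y Z))" for X Y Z
  proof -
    have GG: "G1 X (G1 Y Z) = N (cvec \<Gamma>1 y (J X) (cvec \<Gamma>1 y (J Y) (J Z)))"
      "G2 X (G2 Y Z) = N (cvec \<Gamma>2 y (J X) (cvec \<Gamma>2 y (J Y) (J Z)))"
      by (simp_all add: G1_def G2_def JN)
    have "cvec (pullback_conn \<phi> \<Gamma>2) x X (cvec (pullback_conn \<phi> \<Gamma>2) x Y Z)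
        - cvec (pullback_conn \<phi> \<Gamma>1) x X (cvec (pullback_conn \<phi> \<Gamma>1) x Y Z)
      = N (cvec \<Gamma>2 y (J X) (cvec \<Gamma>2 y (J Y) (J Z)) - cvec \<Gamma>1 y (J X) (cvec \<Gamma>1 y (J Y) (J Z)))
        + \<delta> X (B Y Z) + B X (\<delta> Y Z)"
      unfolding c1 c2 by (simp add: l' GG[symmetric] \<delta>_def)
    moreover have "cvec (dconn (pullback_conn \<phi> \<Gamma>1) X) x Y Z - cvec (dconn (pullback_conn \<phi> \<Gamma>2) X) x Y Z =
      N (cvec (dconn \<Gamma>1 (J X)) y (J Y) (J Z) - cvec (dconn \<Gamma>2 (J X)) y (J Y) (J Z))
      + B X (\<delta> Y Z) - \<delta> (B X Y) Z - \<delta> Y (B X Z)"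
      using dc[of X Y Z] by (simp add: l algebra_simps)
    ultimately show ?thesis
      unfolding Pvec_def \<eta> by (simp add: l inner_add_right inner_diff_right)
  qed

  have R: "ric (pullback_conn \<phi> \<Gamma>2) x Y Z - ric (pullback_conn \<phi> \<Gamma>1) x Y Z =
     ric \<Gamma>2 y (J Y) (J Z) - ric \<Gamma>1 y (J Y) (J Z)
     + (\<Sum>n\<in>UNIV. B (\<delta> (e n) Y) Z $ n) + (\<Sum>n\<in>UNIV. B (\<delta> (e n) Z) Y $ n)" for Y Z
  proof -
    \<comment> \<open>Conjugation invariance of the trace, N and J being inverse to each
      other.\<close>
    have tr: "(\<Sum>n\<in>UNIV. N (L (J (e n))) $ n) = (\<Sum>n\<in>UNIV. L (e n) $ n)" if "linear L" for L
      using trace_commute[OF lN linear_compose[OF lJ that]] by (simp add: o_def e_def JN)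
    have "linear (\<lambda>X. cvec \<Gamma> y (cvec \<Gamma> y X (J Z)) (J Y))" for \<Gamma> by (simp add: linear_iff linear_rules)
    from tr[OF this] have r: "(\<Sum>n\<in>UNIV. G1 (G1 (e n) Z) Y $ n) = ric \<Gamma>1 y (J Y) (J Z)"
      "(\<Sum>n\<in>UNIV. G2 (G2 (e n) Z) Y $ n) = ric \<Gamma>2 y (J Y) (J Z)"
      by (simp_all add: G1_def G2_def JN ric_def e_def)
    \<comment> \<open>Cyclicity of the trace moves B to the outside; the traces quadratic in B are
      common to both connections and cancel below.\<close>
    have s: "(\<Sum>n\<in>UNIV. \<delta> (B (e n) Z) Y $ n) = (\<Sum>n\<in>UNIV. B (\<delta> (e n) Y) Z $ n)"
      using trace_commute[OF l\<delta>(1)[of Y] lB(1)[of Z]] by (simp add: e_def)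
    have 2: "ric (pullback_conn \<phi> \<Gamma>2) x Y Z = (\<Sum>n\<in>UNIV. G2 (G2 (e n) Z) Y $ n) + (\<Sum>n\<in>UNIV. G2 (B (e n) Z) Y $ n)
       + (\<Sum>n\<in>UNIV. B (G2 (e n) Z) Y $ n) + (\<Sum>n\<in>UNIV. B (B (e n) Z) Y $ n)"
      by (simp add: ric_def c2 l' sum.distrib e_def)
    have 1: "ric (pullback_conn \<phi> \<Gamma>1) x Y Z = (\<Sum>n\<in>UNIV. G1 (G1 (e n) Z) Y $ n) + (\<Sum>n\<in>UNIV. G1 (B (e n) Z) Y $ n)
       + (\<Sum>n\<in>UNIV. B (G1 (e n) Z) Y $ n) + (\<Sum>n\<in>UNIV. B (B (e n) Z) Y $ n)"
      by (simp add: ric_def c1 l' sum.distrib e_def)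
    show ?thesis unfolding 1 2 r s[symmetric]
      by (simp add: \<delta>_def l' sum_subtractf)
  qed

  \<comment> \<open>The first sum of the operator at the image point as a bilinear function of two
    vectors, the form in which the Jacobians can be contracted away.\<close>
  define F where "F a b X Y = dd (bvec (cvec \<Gamma>2 y X Y - cvec \<Gamma>1 y X Y)) (vhess q a b) (ctl \<phi> \<psi> w)" for a b X Y
  have bl: "bvec (u + v) = bvec u + bvec v" "bvec (c *\<^sub>R u) = c *\<^sub>R bvec u" for u v :: "real^'n" and c
    by (simp_all add: vec_eq_iff all_Plus bvec_def)
  have hd: "vhess q a b differentiable (at (ctl \<phi> \<psi> w))" for a b
    by (rule smooth_on_differentiable[OF smooth_on_vhess[OF q] C(5)[OF w]])
  have lF: "linear (\<lambda>X. F a b X Y)" "linear (F a b X)" for a b X Y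
  proof -
    have bd: "bvec (u - v) = bvec u - bvec v" for u v :: "real^'n"
      by (simp add: vec_eq_iff all_Plus bvec_def)
    show "linear (\<lambda>X. F a b X Y)" "linear (F a b X)"
      by (simp_all add: linear_iff F_def linear_rules bl bd linear_diff[OF dd_linear[OF hd]] dd_add_left[OF hd] dd_scaleR_left[OF hd] algebra_simps)
  qed
  have first: "(\<Sum>j\<in>UNIV. \<Sum>k\<in>UNIV. dd (bvec (\<delta> (e j) (e k))) (vhess q' j k) w) =
     (\<Sum>a\<in>UNIV. \<Sum>b\<in>UNIV. F a b (e a) (e b))
     - (\<Sum>j\<in>UNIV. \<Sum>k\<in>UNIV. \<Sum>l\<in>UNIV. B (\<delta> (e j) (e k)) (e l) $ j * H l k)
     - (\<Sum>j\<in>UNIV. \<Sum>k\<in>UNIV. \<Sum>l\<in>UNIV. B (\<delta> (e j) (e k)) (e l) $ k * H j l)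
     - (\<Sum>j\<in>UNIV. \<Sum>k\<in>UNIV. \<Sum>l\<in>UNIV. (\<xi> \<bullet> B (\<delta> (e j) (e k)) (e l)) * V l j k)"
    using contract2[where F = F, OF diff x lF]
    unfolding q'_def dd_base_vhess_ctl[OF diff w q]
    unfolding x_def[symmetric] B_def[symmetric] q'_def[symmetric] e_def[symmetric] H_def[symmetric] V_def[symmetric] \<xi>_def[symmetric]
      J_def[symmetric] J\<delta> y_def[symmetric]
    by (simp add: sum_subtractf F_def)
  have second: "(\<Sum>k\<in>UNIV. \<Sum>i\<in>UNIV. \<Sum>j\<in>UNIV. (\<eta> \<bullet> Pvec \<Gamma>1 \<Gamma>2 y (J (e k)) (J (e i)) (J (e j))) * V k i j)
    = (\<Sum>k\<in>UNIV. \<Sum>i\<in>UNIV. \<Sum>j\<in>UNIV. (\<eta> \<bullet> Pvec \<Gamma>1 \<Gamma>2 y (e k) (e i) (e j)) * vthird q k i j (ctl \<phi> \<psi> w))"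
  proof -
    define F3 where "F3 a b c X Y Z = (\<eta> \<bullet> Pvec \<Gamma>1 \<Gamma>2 y X Y Z) * vthird q a b c (ctl \<phi> \<psi> w)" for a b c X Y Z
    have d: "\<Gamma>1 k i j differentiable (at y)" "\<Gamma>2 k i j differentiable (at y)" for k i j
      using smooth_on_differentiable[OF sm(1) yT] smooth_on_differentiable[OF sm(2) yT] by auto
    note ld = linear_add[OF cvec_dconn_linear] linear_cmul[OF cvec_dconn_linear] d
    have l3: "linear (\<lambda>X. F3 a b c X Y Z)" "linear (\<lambda>Y. F3 a b c X Y Z)" "linear (F3 a b c X Y)" for a b c X Y Z
      by (simp_all add: linear_iff F3_def Pvec_def linear_rules ld inner_add_right inner_diff_right algebra_simps)
    show ?thesis
      using contract3[where F = F3, OF diff x l3] unfolding V_def q'_def vthird_ctl[OF diff w q]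
      unfolding x_def[symmetric] J_def[symmetric] e_def[symmetric]
      by (simp add: F3_def sum_distrib_left mult_ac)
  qed
  have third: "(\<Sum>i\<in>UNIV. \<Sum>j\<in>UNIV. (ric \<Gamma>2 y (J (e i)) (J (e j)) - ric \<Gamma>1 y (J (e i)) (J (e j))) * H i j)
    = (\<Sum>i\<in>UNIV. \<Sum>j\<in>UNIV. (ric \<Gamma>2 y (e i) (e j) - ric \<Gamma>1 y (e i) (e j)) * vhess q i j (ctl \<phi> \<psi> w))"
  proof -
    define F2 where "F2 a b X Y = (ric \<Gamma>2 y X Y - ric \<Gamma>1 y X Y) * vhess q a b (ctl \<phi> \<psi> w)" for a b X Y
    have l2: "linear (\<lambda>X. F2 a b X Y)" "linear (F2 a b X)" for a b X Y
      by (simp_all add: linear_iff F2_def ric_def linear_rules sum.distrib sum_distrib_left algebra_simps)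
    show ?thesis
      using contract2[where F = F2, OF diff x l2] unfolding H_def q'_def vhess_ctl[OF diff w q]
      unfolding x_def[symmetric] J_def[symmetric] e_def[symmetric]
      by (simp add: F2_def sum_distrib_left mult_ac)
  qed

  have h1: "(\<Sum>j\<in>UNIV. \<Sum>k\<in>UNIV. \<Sum>l\<in>UNIV. B (\<delta> (e j) (e k)) (e l) $ k * H j l)
    = (\<Sum>j\<in>UNIV. \<Sum>k\<in>UNIV. \<Sum>l\<in>UNIV. B (\<delta> (e j) (e k)) (e l) $ j * H l k)"
    by (subst sum.swap, intro sum.cong refl) (simp add: \<delta>s Hs)
  have h2: "(\<Sum>i\<in>UNIV. \<Sum>j\<in>UNIV. (\<Sum>n\<in>UNIV. B (\<delta> (e n) (e i)) (e j) $ n) * H i j)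
    = (\<Sum>j\<in>UNIV. \<Sum>k\<in>UNIV. \<Sum>l\<in>UNIV. B (\<delta> (e j) (e k)) (e l) $ j * H l k)"
    unfolding sum_distrib_right by (subst sum3_rot, intro sum.cong refl) (simp add: Hs)
  have h3: "(\<Sum>i\<in>UNIV. \<Sum>j\<in>UNIV. (\<Sum>n\<in>UNIV. B (\<delta> (e n) (e j)) (e i) $ n) * H i j)
    = (\<Sum>j\<in>UNIV. \<Sum>k\<in>UNIV. \<Sum>l\<in>UNIV. B (\<delta> (e j) (e k)) (e l) $ j * H l k)"
    unfolding h2[symmetric] by (subst sum.swap, intro sum.cong refl) (simp add: Hs)
  have v1: "(\<Sum>j\<in>UNIV. \<Sum>k\<in>UNIV. \<Sum>l\<in>UNIV. (\<xi> \<bullet> B (\<delta> (e j) (e k)) (e l)) * V l j k)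
    = (\<Sum>k\<in>UNIV. \<Sum>i\<in>UNIV. \<Sum>j\<in>UNIV. (\<xi> \<bullet> B (e k) (\<delta> (e i) (e j))) * V k i j)"
    by (subst sum3_rot, intro sum.cong refl) (simp add: Bs)
  have v2: "(\<Sum>k\<in>UNIV. \<Sum>i\<in>UNIV. \<Sum>j\<in>UNIV. (\<xi> \<bullet> \<delta> (B (e k) (e i)) (e j)) * V k i j)
    = (\<Sum>k\<in>UNIV. \<Sum>i\<in>UNIV. \<Sum>j\<in>UNIV. (\<xi> \<bullet> \<delta> (e k) (B (e i) (e j))) * V k i j)"
    by (subst sum3_rot, intro sum.cong refl) (simp add: \<delta>s Vs)
  have v3: "(\<Sum>k\<in>UNIV. \<Sum>i\<in>UNIV. \<Sum>j\<in>UNIV. (\<xi> \<bullet> \<delta> (e i) (B (e k) (e j))) * V k i j)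
    = (\<Sum>k\<in>UNIV. \<Sum>i\<in>UNIV. \<Sum>j\<in>UNIV. (\<xi> \<bullet> \<delta> (e k) (B (e i) (e j))) * V k i j)"
    by (subst sum.swap, intro sum.cong refl) (simp add: Vs)

  have L1: "L_expl (pullback_conn \<phi> \<Gamma>1) (pullback_conn \<phi> \<Gamma>2) q' w =
     3 * (\<Sum>j\<in>UNIV. \<Sum>k\<in>UNIV. dd (bvec (\<delta> (e j) (e k))) (vhess q' j k) w)
     + (\<Sum>k\<in>UNIV. \<Sum>i\<in>UNIV. \<Sum>j\<in>UNIV. (\<xi> \<bullet> Pvec (pullback_conn \<phi> \<Gamma>1) (pullback_conn \<phi> \<Gamma>2) x (e k) (e i) (e j)) * V k i j)
     + 3 * (\<Sum>i\<in>UNIV. \<Sum>j\<in>UNIV. (ric (pullback_conn \<phi> \<Gamma>2) x (e i) (e j) - ric (pullback_conn \<phi> \<Gamma>1) x (e i) (e j)) * H i j)"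
    unfolding L_expl_def Let_def x_def[symmetric] \<xi>_def[symmetric] H_def[symmetric] V_def[symmetric] c1 c2 e_def[symmetric]
    by (simp add: \<delta>_def)
  have L2: "L_expl \<Gamma>1 \<Gamma>2 q (ctl \<phi> \<psi> w) =
     3 * (\<Sum>a\<in>UNIV. \<Sum>b\<in>UNIV. F a b (e a) (e b))
     + (\<Sum>k\<in>UNIV. \<Sum>i\<in>UNIV. \<Sum>j\<in>UNIV. (\<eta> \<bullet> Pvec \<Gamma>1 \<Gamma>2 y (e k) (e i) (e j)) * vthird q k i j (ctl \<phi> \<psi> w))
     + 3 * (\<Sum>i\<in>UNIV. \<Sum>j\<in>UNIV. (ric \<Gamma>2 y (e i) (e j) - ric \<Gamma>1 y (e i) (e j)) * vhess q i j (ctl \<phi> \<psi> w))"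
    unfolding L_expl_def Let_def base_ctl x_def[symmetric] y_def[symmetric] \<eta>_def[symmetric] F_def e_def[symmetric] ..
  have P': "(\<Sum>k\<in>UNIV. \<Sum>i\<in>UNIV. \<Sum>j\<in>UNIV. (\<xi> \<bullet> Pvec (pullback_conn \<phi> \<Gamma>1) (pullback_conn \<phi> \<Gamma>2) x (e k) (e i) (e j)) * V k i j)
    = (\<Sum>k\<in>UNIV. \<Sum>i\<in>UNIV. \<Sum>j\<in>UNIV. (\<eta> \<bullet> Pvec \<Gamma>1 \<Gamma>2 y (J (e k)) (J (e i)) (J (e j))) * V k i j)
      + 3 * (\<Sum>k\<in>UNIV. \<Sum>i\<in>UNIV. \<Sum>j\<in>UNIV. (\<xi> \<bullet> B (e k) (\<delta> (e i) (e j))) * V k i j)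
      - (\<Sum>k\<in>UNIV. \<Sum>i\<in>UNIV. \<Sum>j\<in>UNIV. (\<xi> \<bullet> \<delta> (B (e k) (e i)) (e j)) * V k i j)
      - (\<Sum>k\<in>UNIV. \<Sum>i\<in>UNIV. \<Sum>j\<in>UNIV. (\<xi> \<bullet> \<delta> (e i) (B (e k) (e j))) * V k i j)
      + 2 * (\<Sum>k\<in>UNIV. \<Sum>i\<in>UNIV. \<Sum>j\<in>UNIV. (\<xi> \<bullet> \<delta> (e k) (B (e i) (e j))) * V k i j)"
    unfolding P by (simp only: distrib_right left_diff_distrib sum.distrib sum_subtractf mult.assoc sum_distrib_left[symmetric])
  have R': "(\<Sum>i\<in>UNIV. \<Sum>j\<in>UNIV. (ric (pullback_conn \<phi> \<Gamma>2) x (e i) (e j) - ric (pullback_conn \<phi> \<Gamma>1) x (e i) (e j)) * H i j)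
    = (\<Sum>i\<in>UNIV. \<Sum>j\<in>UNIV. (ric \<Gamma>2 y (J (e i)) (J (e j)) - ric \<Gamma>1 y (J (e i)) (J (e j))) * H i j)
      + (\<Sum>i\<in>UNIV. \<Sum>j\<in>UNIV. (\<Sum>n\<in>UNIV. B (\<delta> (e n) (e i)) (e j) $ n) * H i j)
      + (\<Sum>i\<in>UNIV. \<Sum>j\<in>UNIV. (\<Sum>n\<in>UNIV. B (\<delta> (e n) (e j)) (e i) $ n) * H i j)"
    unfolding R by (simp only: distrib_right sum.distrib)
  show ?thesis
    unfolding q'_def[symmetric] L1 L2 first P' R' second third h1 h2 h3 v1 v2 v3
    by (simp add: algebra_simps)
qed


section \<open>Local representatives\<close>

text \<open>Composable local maps need matching domains. Shrinking the source shrinks the target to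
  its image, written as a preimage under \<psi> to make openness evident.\<close>

lemma diffeo_on_restrict:
  assumes "diffeo_on \<phi> \<psi> S T" "open S'" "S' \<subseteq> S"
  shows "diffeo_on \<phi> \<psi> S' (T \<inter> \<psi> -` S')"
proof -
  note D = diffeo_onD[OF assms(1)]
  have "open (T \<inter> \<psi> -` S')"
    using continuous_open_preimage[OF smooth_on_continuous_on[OF D(4)] D(2) assms(2)] .
  moreover have "smooth_on S' \<phi>" "smooth_on (T \<inter> \<psi> -` S') \<psi>"
    by (rule smooth_on_subset[OF D(3) assms(3)], rule smooth_on_subset[OF D(4)]) simp
  ultimately show ?thesis using assms unfolding diffeo_on_def by auto
qed

lemma ctl_compose:
  assumes "diffeo_on \<phi> \<psi> S T" "diffeo_on \<phi>' \<psi>' T R" "w \<in> cyl S"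
  shows "ctl \<phi>' \<psi>' (ctl \<phi> \<psi> w) = ctl (\<lambda>x. \<phi>' (\<phi> x)) (\<lambda>x. \<psi> (\<psi>' x)) w"
proof (rule base_fibre_eqI)
  note D = diffeo_onD[OF assms(1)] and D' = diffeo_onD[OF assms(2)]
  note E = diffeo_onD[OF diffeo_on_compose[OF assms(1,2)]]
  have w: "base_part w \<in> S" using assms by simp
  show "base_part (ctl \<phi>' \<psi>' (ctl \<phi> \<psi> w)) = base_part (ctl (\<lambda>x. \<phi>' (\<phi> x)) (\<lambda>x. \<psi> (\<psi>' x)) w)" by simp
  have "fibre_part (ctl \<phi>' \<psi>' (ctl \<phi> \<psi> w)) \<bullet> V = fibre_part (ctl (\<lambda>x. \<phi>' (\<phi> x)) (\<lambda>x. \<psi> (\<psi>' x)) w) \<bullet> V" for V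
  proof -
    have p: "\<psi>' (\<phi>' (\<phi> (base_part w))) = \<phi> (base_part w)" by (rule D'(6)[OF D(5)[OF w]])
    have "dd V (\<lambda>x. \<psi> (\<psi>' x)) (\<phi>' (\<phi> (base_part w))) = dd (dd V \<psi>' (\<phi>' (\<phi> (base_part w)))) \<psi> (\<phi> (base_part w))"
      using dd_compose[OF D'(8)[OF D(5)[OF w]], of \<psi> V] D(8)[OF w] by (simp add: p)
    then show ?thesis using D(8)[OF w] D'(8)[OF D(5)[OF w]] E(8)[OF w] by (simp add: fibre_ctl)
  qed
  then show "fibre_part (ctl \<phi>' \<psi>' (ctl \<phi> \<psi> w)) = fibre_part (ctl (\<lambda>x. \<phi>' (\<phi> x)) (\<lambda>x. \<psi> (\<psi>' x)) w)"
    by (rule vec_eq_inner)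
qed

text \<open>The lift at a point uses \<phi> through its value alone and \<psi> through a derivative,
  hence the two different forms of agreement.\<close>

lemma ctl_cong:
  assumes "\<phi> (base_part w) = \<phi>' (base_part w)" "open T" "\<phi> (base_part w) \<in> T" "\<And>y. y \<in> T \<Longrightarrow> \<psi> y = \<psi>' y"
  shows "ctl \<phi> \<psi> w = ctl \<phi>' \<psi>' w"
  unfolding ctl_def using assms(1) dd_cong[OF assms(2-4)] by (intro vec_eq_iff[THEN iffD2]) (auto split: sum.split)

lemma ctl_ident:
  assumes "open T" "base_part w \<in> T" "\<And>y. y \<in> T \<Longrightarrow> \<phi> y = y" "\<And>y. y \<in> T \<Longrightarrow> \<psi> y = y"
  shows "ctl \<phi> \<psi> w = w"
proof -
  have "ctl \<phi> \<psi> w = ctl (\<lambda>x. x) (\<lambda>x. x) w" by (rule ctl_cong[OF _ assms(1)]) (use assms in simp_all)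
  also have "\<dots> = w"
    by (rule base_fibre_eqI) (simp_all add: vec_eq_iff fibre_ctl_component dd_bounded_linear[OF bounded_linear_ident])
  finally show ?thesis .
qed

section \<open>Coordinate expressions of global diffeomorphisms\<close>

definition dmn :: "('a \<Rightarrow> 'a) \<Rightarrow> ('a, 'n::finite) chart \<Rightarrow> ('a, 'n) chart \<Rightarrow> (real^'n) set" where
  "dmn f c d = snd c ` (fst c \<inter> f -` fst d)"

locale manifold =
  fixes A :: "('a::{t2_space,second_countable_topology}, 'n::finite) chart set"
  assumes atlas: "smooth_atlas A"
begin

lemma chart_homeo: "c \<in> A \<Longrightarrow> homeomorphism (fst c) (snd c ` fst c) (snd c) (chart_inv c)"
  and chart_open: "c \<in> A \<Longrightarrow> open (fst c)" "c \<in> A \<Longrightarrow> open (snd c ` fst c)"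
  and chart_cover: "\<exists>c\<in>A. x \<in> fst c"
  and chart_smooth: "c \<in> A \<Longrightarrow> d \<in> A \<Longrightarrow> smooth_on (snd c ` (fst c \<inter> fst d)) (local_map id c d)"
  using atlas unfolding smooth_atlas_def by (blast, blast, blast, blast, blast)

lemma chart_inv_left [simp]: "c \<in> A \<Longrightarrow> x \<in> fst c \<Longrightarrow> chart_inv c (snd c x) = x"
  by (rule homeomorphism_apply1[OF chart_homeo])

lemma chart_inv_right [simp]: "c \<in> A \<Longrightarrow> u \<in> snd c ` fst c \<Longrightarrow> snd c (chart_inv c u) = u"
  by (rule homeomorphism_apply2[OF chart_homeo])

lemma chart_inv_in: "c \<in> A \<Longrightarrow> u \<in> snd c ` fst c \<Longrightarrow> chart_inv c u \<in> fst c"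
  by auto

lemma chart_at: "chart_at A x \<in> A" "x \<in> fst (chart_at A x)"
  using someI_ex[of "\<lambda>c. c \<in> A \<and> x \<in> fst c"] chart_cover[of x] unfolding chart_at_def by blast+

lemma open_chart_image:
  assumes "c \<in> A" "open W" "W \<subseteq> fst c"
  shows "open (snd c ` W)"
proof -
  have "openin (top_of_set (fst c)) W" using assms by (simp add: openin_open_eq chart_open)
  then have "openin (top_of_set (snd c ` fst c)) (snd c ` W)"
    by (rule homeomorphism_imp_open_map[OF chart_homeo[OF assms(1)]])
  then show ?thesis using chart_open(2)[OF assms(1)] openin_open_trans by blast
qed

lemma dmn_iff: "c \<in> A \<Longrightarrow> u \<in> dmn f c d \<longleftrightarrow> u \<in> snd c ` fst c \<and> f (chart_inv c u) \<in> fst d"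
  by (auto simp: dmn_def)

lemma dmn_in: "x \<in> fst c \<Longrightarrow> f x \<in> fst d \<Longrightarrow> snd c x \<in> dmn f c d"
  by (auto simp: dmn_def)

lemma dmn_id: "dmn id c c = snd c ` fst c"
  by (simp add: dmn_def)

lemma open_dmn: "continuous_on UNIV f \<Longrightarrow> c \<in> A \<Longrightarrow> d \<in> A \<Longrightarrow> open (dmn f c d)"
  unfolding dmn_def
  by (rule open_chart_image) (simp_all add: open_Int chart_open(1) open_vimage)

lemma local_map_apply: "c \<in> A \<Longrightarrow> x \<in> fst c \<Longrightarrow> local_map f c d (snd c x) = snd d (f x)"
  by (simp add: local_map_def)

lemma id_Diff: "id \<in> Diff A"
  using chart_smooth by (simp add: Diff_def smooth_map_def continuous_on_id inv_id)

lemma inv_Diff: "f \<in> Diff A \<Longrightarrow> inv f \<in> Diff A"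
  by (simp add: Diff_def bij_imp_bij_inv inv_inv_eq)

lemma DiffD:
  assumes "f \<in> Diff A"
  shows "bij f" "continuous_on UNIV f" "inv f (f x) = x" "f (inv f x) = x" "inv (inv f) = f"
    "c \<in> A \<Longrightarrow> d \<in> A \<Longrightarrow> smooth_on (dmn f c d) (local_map f c d)"
proof -
  show b: "bij f" and "continuous_on UNIV f" using assms by (simp_all add: Diff_def smooth_map_def)
  show "inv f (f x) = x" by (rule inv_f_f[OF bij_is_inj[OF b]])
  show "f (inv f x) = x" by (rule surj_f_inv_f[OF bij_is_surj[OF b]])
  show "inv (inv f) = f" by (rule inv_inv_eq[OF b])
  show "c \<in> A \<Longrightarrow> d \<in> A \<Longrightarrow> smooth_on (dmn f c d) (local_map f c d)"
    using assms by (simp add: Diff_def smooth_map_def dmn_def)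
qed

text \<open>Near a given point the composite factors through a chart around the intermediate image;
  the inverse of a composite is again a composite.\<close>

lemma compose_Diff:
  assumes f: "f \<in> Diff A" and h: "h \<in> Diff A"
  shows "f \<circ> h \<in> Diff A"
proof -
  have sm: "smooth_map A (f \<circ> h)" if f: "f \<in> Diff A" and h: "h \<in> Diff A" for f h
    unfolding smooth_map_def
  proof (intro conjI ballI)
    note F = DiffD[OF f] and H = DiffD[OF h]
    show cont: "continuous_on UNIV (f \<circ> h)"
      by (rule continuous_on_compose[OF H(2)]) (rule continuous_on_subset[OF F(2)], simp)
    fix c d assume cd: "c \<in> A" "d \<in> A"
    show "smooth_on (snd c ` (fst c \<inter> (f \<circ> h) -` fst d)) (local_map (f \<circ> h) c d)"
    proof (rule smooth_on_local)
      fix u assume "u \<in> snd c ` (fst c \<inter> (f \<circ> h) -` fst d)"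
      then obtain x where x: "u = snd c x" "x \<in> fst c" "f (h x) \<in> fst d" by auto
      obtain e where e: "e \<in> A" "h x \<in> fst e" using chart_cover by blast
      define W where "W = dmn h c e \<inter> dmn (f \<circ> h) c d"
      have W: "open W" unfolding W_def by (intro open_Int open_dmn[OF H(2)] open_dmn[OF cont] cd e(1))
      have maps: "local_map h c e v \<in> dmn f e d" "local_map (f \<circ> h) c d v = local_map f e d (local_map h c e v)"
        if "v \<in> W" for v
        using that cd e by (auto simp: W_def dmn_iff local_map_def)
      have "smooth_on W (\<lambda>v. local_map f e d (local_map h c e v))"
        by (rule smooth_on_compose[OF W open_dmn[OF F(2) e(1) cd(2)] maps(1) F(6)[OF e(1) cd(2)]
              smooth_on_subset[OF H(6)[OF cd(1) e(1)]]]) (auto simp: W_def)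
      then have "smooth_on W (local_map (f \<circ> h) c d)"
        by (rule smooth_on_cong[OF W]) (simp add: maps(2))
      moreover have "u \<in> W" using x e by (auto simp: W_def dmn_def)
      ultimately show "\<exists>T. open T \<and> u \<in> T \<and> smooth_on T (local_map (f \<circ> h) c d)" using W by blast
    qed
  qed
  have "inv (f \<circ> h) = inv h \<circ> inv f" using f h by (simp add: o_inv_distrib DiffD(1))
  then show ?thesis
    using sm[OF f h] sm[OF inv_Diff[OF h] inv_Diff[OF f]] DiffD(1)[OF f] DiffD(1)[OF h]
    by (simp add: Diff_def bij_comp)
qed

lemma inv_compose: "f \<in> Diff A \<Longrightarrow> h \<in> Diff A \<Longrightarrow> inv (f \<circ> h) = inv h \<circ> inv f"
  by (simp add: o_inv_distrib DiffD(1))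

lemma local_diffeo:
  assumes "f \<in> Diff A" "c \<in> A" "d \<in> A"
  shows "diffeo_on (local_map f c d) (local_map (inv f) d c) (dmn f c d) (dmn (inv f) d c)"
  unfolding diffeo_on_def
proof (intro conjI ballI)
  note F = DiffD[OF assms(1)] and F' = DiffD[OF inv_Diff[OF assms(1)]]
  show "open (dmn f c d)" "open (dmn (inv f) d c)" using open_dmn F F' assms by auto
  show "smooth_on (dmn f c d) (local_map f c d)" "smooth_on (dmn (inv f) d c) (local_map (inv f) d c)"
    using F(6) F'(6) assms by auto
  show "local_map f c d u \<in> dmn (inv f) d c" "local_map (inv f) d c (local_map f c d u) = u" if "u \<in> dmn f c d" for u
    using that assms F by (auto simp: dmn_def local_map_def intro!: image_eqI)
  show "local_map (inv f) d c u \<in> dmn f c d" "local_map f c d (local_map (inv f) d c u) = u" if "u \<in> dmn (inv f) d c" for u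
    using that assms F by (auto simp: dmn_def local_map_def intro!: image_eqI)
qed

lemma local_map_compose:
  assumes "c \<in> A" "d \<in> A" "u \<in> dmn h c d"
  shows "local_map (f \<circ> h) c e u = local_map f d e (local_map h c d u)"
  using assms by (auto simp: dmn_def local_map_def)

abbreviation lct :: "('a \<Rightarrow> 'a) \<Rightarrow> ('a, 'n) chart \<Rightarrow> ('a, 'n) chart \<Rightarrow> real^('n + 'n) \<Rightarrow> real^('n + 'n)" where
  "lct f c d \<equiv> ctl (local_map f c d) (local_map (inv f) d c)"

text \<open>The three charts need not fit together, so the local maps are first restricted to the
  points that \<open>h\<close> sends into \<open>d\<close> and \<open>f \<circ> h\<close> sends into
  \<open>e\<close>. With one map the identity, this says that lifts are compatible with coordinate
  changes.\<close>

lemma lct_compose: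
  assumes "f \<in> Diff A" "h \<in> Diff A" "c \<in> A" "d \<in> A" "e \<in> A"
    and w: "base_part w = snd c x" "x \<in> fst c" "h x \<in> fst d" "f (h x) \<in> fst e"
  shows "lct f d e (lct h c d w) = lct (f \<circ> h) c e w"
proof -
  note F = DiffD[OF assms(1)] and H = DiffD[OF assms(2)]
  note Df = local_diffeo[OF assms(1,4,5)] and Dh = local_diffeo[OF assms(2,3,4)]
  let ?S = "dmn h c d \<inter> dmn (f \<circ> h) c e"
  have o: "open ?S" by (intro open_Int open_dmn[OF H(2)] open_dmn[OF DiffD(2)[OF compose_Diff[OF assms(1,2)]]] assms(3-5))
  define T where "T = dmn (inv h) d c \<inter> local_map (inv h) d c -` ?S"
  note R = diffeo_on_restrict[OF Dh o, folded T_def, simplified]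
  have "T \<subseteq> dmn f d e"
    using assms(3,4) by (auto simp: T_def dmn_iff local_map_def H(4))
  note R' = diffeo_on_restrict[OF Df diffeo_onD(2)[OF R] this]
  have w': "w \<in> cyl ?S" using w by (simp add: dmn_in)
  have y: "snd e (f (h x)) \<in> dmn (inv f) e d" using w assms F by (auto simp: dmn_def intro!: image_eqI)
  have "lct f d e (lct h c d w) = ctl (\<lambda>x. local_map f d e (local_map h c d x))
      (\<lambda>x. local_map (inv h) d c (local_map (inv f) e d x)) w"
    by (rule ctl_compose[OF R R' w'])
  also have "\<dots> = lct (f \<circ> h) c e w"
  proof (rule ctl_cong)
    show "local_map f d e (local_map h c d (base_part w)) = local_map (f \<circ> h) c e (base_part w)"
      using w' assms by (simp add: local_map_compose)
    show "open (dmn (inv f) e d)" using open_dmn DiffD(2)[OF inv_Diff[OF assms(1)]] assms by auto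
    show "local_map f d e (local_map h c d (base_part w)) \<in> dmn (inv f) e d"
      using w assms y by (simp add: local_map_apply)
    show "local_map (inv h) d c (local_map (inv f) e d y) = local_map (inv (f \<circ> h)) e c y" if "y \<in> dmn (inv f) e d" for y
      using that assms by (simp add: inv_compose local_map_compose)
  qed
  finally show ?thesis .
qed

lemma lct_id:
  assumes "c \<in> A" "base_part w \<in> snd c ` fst c"
  shows "lct id c c w = w"
  by (rule ctl_ident[OF chart_open(2)[OF assms(1)] assms(2)])
    (use assms in \<open>auto simp: local_map_def inv_id\<close>)

section \<open>The cotangent bundle\<close>

lemma base_cot_coord [simp]: "base_part (cot_coord c z) = snd c (fst z)"
  and fibre_cot_coord [simp]: "fibre_part (cot_coord c z) = snd z c"
  by (simp_all add: cot_coord_def base_part_def fibre_part_def vec_eq_iff)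

lemma transpose_inner: "(transpose M *v a) \<bullet> X = a \<bullet> (M *v X)" for M :: "real^'k::finite^'m::finite"
  by (simp add: dot_lmul_matrix[symmetric] vector_transpose_matrix)

text \<open>The transformation law of covectors is the lift of the identity between two charts. Read
  this way, facts about lifts of diffeomorphisms apply to coordinate changes of the bundle.\<close>

lemma covectors_iff:
  "\<alpha> \<in> covectors A x \<longleftrightarrow> (\<forall>c. \<not> (c \<in> A \<and> x \<in> fst c) \<longrightarrow> \<alpha> c = 0) \<and>
     (\<forall>c\<in>A. \<forall>d\<in>A. x \<in> fst c \<and> x \<in> fst d \<longrightarrow> cot_coord d (x, \<alpha>) = lct id c d (cot_coord c (x, \<alpha>)))"
proof -
  have "\<alpha> d = transpose (jacobian (local_map id d c) (at (snd d x))) *v \<alpha> c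
    \<longleftrightarrow> cot_coord d (x, \<alpha>) = lct id c d (cot_coord c (x, \<alpha>))"
    if cd: "c \<in> A" "d \<in> A" "x \<in> fst c" "x \<in> fst d" for c d
  proof -
    note D = diffeo_onD[OF local_diffeo[OF id_Diff cd(1,2)]]
    have u: "snd c x \<in> dmn id c d" using cd by (simp add: dmn_in)
    have df: "local_map id d c differentiable (at (snd d x))"
      using D(8)[OF u] cd by (simp add: local_map_apply inv_id)
    have "fibre_part (lct id c d (cot_coord c (x, \<alpha>))) \<bullet> V =
      (transpose (jacobian (local_map id d c) (at (snd d x))) *v \<alpha> c) \<bullet> V" for V
      unfolding transpose_inner jacobian_dd[OF df] using cd df by (simp add: fibre_ctl local_map_apply inv_id)
    then have *: "fibre_part (lct id c d (cot_coord c (x, \<alpha>))) =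
      transpose (jacobian (local_map id d c) (at (snd d x))) *v \<alpha> c" by (rule vec_eq_inner)
    have b: "base_part (cot_coord d (x, \<alpha>)) = base_part (lct id c d (cot_coord c (x, \<alpha>)))"
      using cd by (simp add: local_map_apply)
    show ?thesis
      using base_fibre_eqI[OF b] * by (metis fibre_cot_coord snd_conv)
  qed
  then show ?thesis unfolding covectors_def mem_Collect_eq by meson
qed

lemma cotangent_iff: "z \<in> cotangent A \<longleftrightarrow> snd z \<in> covectors A (fst z)"
  by (cases z) (simp add: cotangent_def)

lemma covector_zero: "\<alpha> \<in> covectors A x \<Longrightarrow> \<not> (c \<in> A \<and> x \<in> fst c) \<Longrightarrow> \<alpha> c = 0"
  unfolding covectors_def by blast

lemma cot_coord_change:
  assumes "z \<in> cotangent A" "c \<in> A" "d \<in> A" "fst z \<in> fst c" "fst z \<in> fst d"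
  shows "cot_coord d z = lct id c d (cot_coord c z)"
  using assms unfolding cotangent_iff covectors_iff by (metis prod.collapse)

text \<open>Components in one chart determine a covector: in other charts around the point they
  follow from the transformation law, and elsewhere they are zero by convention.\<close>

lemma cotangent_eqI:
  assumes "z \<in> cotangent A" "z' \<in> cotangent A" "c \<in> A" "fst z \<in> fst c" "fst z = fst z'" "cot_coord c z = cot_coord c z'"
  shows "z = z'"
proof (rule prod_eqI)
  show "fst z = fst z'" by fact
  show "snd z = snd z'"
  proof
    fix d
    show "snd z d = snd z' d"
    proof (cases "d \<in> A \<and> fst z \<in> fst d")
      case True
      then have "cot_coord d z = cot_coord d z'"
        using cot_coord_change[OF assms(1,3), of d] cot_coord_change[OF assms(2,3), of d] assms by simp
      then show ?thesis by (metis fibre_cot_coord)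
    next
      case False
      then have "snd z d = 0" "snd z' d = 0"
        using assms(1,2,5) covector_zero unfolding cotangent_iff by metis+
      then show ?thesis by simp
    qed
  qed
qed

lemma cot_domD: "z \<in> cot_dom A c \<Longrightarrow> z \<in> cotangent A" "z \<in> cot_dom A c \<Longrightarrow> fst z \<in> fst c"
  by (simp_all add: cot_dom_def)

lemma inj_cot_coord: "c \<in> A \<Longrightarrow> inj_on (cot_coord c) (cot_dom A c)"
proof (rule inj_onI)
  fix z z' assume *: "c \<in> A" "z \<in> cot_dom A c" "z' \<in> cot_dom A c" "cot_coord c z = cot_coord c z'"
  have "snd c (fst z) = snd c (fst z')" using *(4) by (metis base_cot_coord)
  then have "fst z = fst z'" using * by (metis chart_inv_left cot_domD(2))
  then show "z = z'" using * cot_domD by (metis cotangent_eqI)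
qed

text \<open>The components in all other charts are forced by those in \<open>c\<close>; that they
  satisfy the transformation law among each other is functoriality of the lift for the
  identity.\<close>

lemma cot_coord_surj:
  assumes "c \<in> A" "x \<in> fst c" "base_part w = snd c x"
  obtains z where "z \<in> cotangent A" "fst z = x" "cot_coord c z = w"
proof
  define \<alpha> where "\<alpha> d = (if d \<in> A \<and> x \<in> fst d then fibre_part (lct id c d w) else 0)" for d
  have co: "cot_coord d (x, \<alpha>) = lct id c d w" if "d \<in> A" "x \<in> fst d" for d
    by (rule base_fibre_eqI) (use that assms in \<open>simp_all add: local_map_apply \<alpha>_def\<close>)
  show "(x, \<alpha>) \<in> cotangent A" unfolding cotangent_iff covectors_iff
  proof (intro conjI allI impI ballI)
    show "snd (x, \<alpha>) d = 0" if "\<not> (d \<in> A \<and> fst (x, \<alpha>) \<in> fst d)" for d using that by (auto simp: \<alpha>_def)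
    show "cot_coord e (fst (x, \<alpha>), snd (x, \<alpha>)) = lct id d e (cot_coord d (fst (x, \<alpha>), snd (x, \<alpha>)))"
      if de: "d \<in> A" "e \<in> A" "fst (x, \<alpha>) \<in> fst d \<and> fst (x, \<alpha>) \<in> fst e" for d e
      using lct_compose[OF id_Diff id_Diff assms(1) de(1,2) assms(3,2)] de by (simp add: co)
  qed
  show "fst (x, \<alpha>) = x" by simp
  show "cot_coord c (x, \<alpha>) = w" using co[OF assms(1,2)] lct_id[OF assms(1)] assms by simp
qed

lemma cot_coord_image: "c \<in> A \<Longrightarrow> cot_coord c ` cot_dom A c = cyl (snd c ` fst c)"
proof (intro equalityI subsetI)
  fix w assume "c \<in> A" "w \<in> cyl (snd c ` fst c)"
  then obtain x where x: "x \<in> fst c" "base_part w = snd c x" by auto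
  from cot_coord_surj[OF \<open>c \<in> A\<close> this] obtain z where "z \<in> cotangent A" "fst z = x" "cot_coord c z = w" .
  then show "w \<in> cot_coord c ` cot_dom A c" using x by (auto simp: cot_dom_def)
qed (auto simp: cot_dom_def)

lemma cot_inv_left [simp]: "c \<in> A \<Longrightarrow> z \<in> cotangent A \<Longrightarrow> fst z \<in> fst c \<Longrightarrow> cot_inv A c (cot_coord c z) = z"
  unfolding cot_inv_def by (rule inv_into_f_f[OF inj_cot_coord]) (auto simp: cot_dom_def)

lemma cot_inv_right:
  assumes "c \<in> A" "base_part w \<in> snd c ` fst c"
  shows "cot_coord c (cot_inv A c w) = w" "cot_inv A c w \<in> cotangent A" "fst (cot_inv A c w) = chart_inv c (base_part w)"
    "fst (cot_inv A c w) \<in> fst c"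
proof -
  obtain x where x: "x \<in> fst c" "base_part w = snd c x" using assms by auto
  from cot_coord_surj[OF assms(1) this] obtain z where z: "z \<in> cotangent A" "fst z = x" "cot_coord c z = w" .
  then have "cot_inv A c w = z" using cot_inv_left[OF assms(1) z(1)] x by simp
  then show "cot_coord c (cot_inv A c w) = w" "cot_inv A c w \<in> cotangent A"
    "fst (cot_inv A c w) = chart_inv c (base_part w)" "fst (cot_inv A c w) \<in> fst c"
    using z x assms by simp_all
qed

text \<open>\<open>cot_lift\<close> computes with one chosen chart around the base point; composing
  with the change of coordinates to that chart gives the formula in any \<open>c\<close>.\<close>

lemma cot_lift_coord:
  assumes "f \<in> Diff A" "z \<in> cotangent A" "c \<in> A" "d \<in> A" "fst z \<in> fst c" "f (fst z) \<in> fst d"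
  shows "cot_coord d (cot_lift A f z) = lct f c d (cot_coord c z)"
proof -
  let ?c = "chart_at A (fst z)"
  note c0 = chart_at[of "fst z"]
  note D = diffeo_onD[OF local_diffeo[OF assms(1) c0(1) assms(4)]]
  have u: "snd ?c (fst z) \<in> dmn f ?c d" using c0 assms by (simp add: dmn_in)
  have "cot_coord d (cot_lift A f z) = lct f ?c d (cot_coord ?c z)"
  proof (rule base_fibre_eqI)
    show "base_part (cot_coord d (cot_lift A f z)) = base_part (lct f ?c d (cot_coord ?c z))"
      using c0 by (simp add: cot_lift_def local_map_apply)
    have df: "local_map (inv f) d ?c differentiable (at (snd d (f (fst z))))"
      using D(8)[OF u] c0 by (simp add: local_map_apply)
    have "fibre_part (cot_coord d (cot_lift A f z)) \<bullet> V = fibre_part (lct f ?c d (cot_coord ?c z)) \<bullet> V" for V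
      using transpose_inner[of "jacobian (local_map (inv f) d ?c) (at (snd d (f (fst z))))" "snd z ?c" V]
        assms c0 df unfolding jacobian_dd[OF df] by (simp add: cot_lift_def Let_def fibre_ctl local_map_apply)
    then show "fibre_part (cot_coord d (cot_lift A f z)) = fibre_part (lct f ?c d (cot_coord ?c z))"
      by (rule vec_eq_inner)
  qed
  also have "\<dots> = lct f ?c d (lct id c ?c (cot_coord c z))"
    by (simp only: cot_coord_change[OF assms(2,3) c0(1) assms(5) c0(2)])
  also have "\<dots> = lct (f \<circ> id) c d (cot_coord c z)"
    by (rule lct_compose[OF assms(1) id_Diff assms(3) c0(1) assms(4)]) (use assms c0 in auto)
  finally show ?thesis by simp
qed

lemma fst_cot_lift [simp]: "fst (cot_lift A f z) = f (fst z)"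
  by (simp add: cot_lift_def)

lemma cot_lift_cotangent:
  assumes "f \<in> Diff A" "z \<in> cotangent A"
  shows "cot_lift A f z \<in> cotangent A"
  unfolding cotangent_iff covectors_iff
proof (intro conjI allI impI ballI)
  show "snd (cot_lift A f z) d = 0" if "\<not> (d \<in> A \<and> fst (cot_lift A f z) \<in> fst d)" for d
    using that by (auto simp: cot_lift_def)
  fix d e assume de: "d \<in> A" "e \<in> A" "fst (cot_lift A f z) \<in> fst d \<and> fst (cot_lift A f z) \<in> fst e"
  note c = chart_at[of "fst z"]
  let ?c = "chart_at A (fst z)"
  have "lct id d e (lct f ?c d (cot_coord ?c z)) = lct (id \<circ> f) ?c e (cot_coord ?c z)"
    by (rule lct_compose[OF id_Diff assms(1) c(1) de(1,2)]) (use c de in auto)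
  then show "cot_coord e (fst (cot_lift A f z), snd (cot_lift A f z)) = lct id d e (cot_coord d (fst (cot_lift A f z), snd (cot_lift A f z)))"
    unfolding prod.collapse using cot_lift_coord[OF assms c(1) _ c(2)] de by simp
qed

lemma cot_lift_compose:
  assumes "f \<in> Diff A" "h \<in> Diff A" "z \<in> cotangent A"
  shows "cot_lift A (f \<circ> h) z = cot_lift A f (cot_lift A h z)"
proof -
  let ?c = "chart_at A (fst z)" and ?d = "chart_at A (h (fst z))" and ?e = "chart_at A (f (h (fst z)))"
  have hz: "cot_lift A h z \<in> cotangent A" by (rule cot_lift_cotangent[OF assms(2,3)])
  have "cot_coord ?e (cot_lift A (f \<circ> h) z) = lct (f \<circ> h) ?c ?e (cot_coord ?c z)"
    by (rule cot_lift_coord[OF compose_Diff[OF assms(1,2)] assms(3)]) (use chart_at in auto)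
  also have "\<dots> = lct f ?d ?e (lct h ?c ?d (cot_coord ?c z))"
    by (rule lct_compose[symmetric, OF assms(1,2)]) (use chart_at in auto)
  also have "\<dots> = lct f ?d ?e (cot_coord ?d (cot_lift A h z))"
    by (subst cot_lift_coord[OF assms(2,3)]) (use chart_at in auto)
  also have "\<dots> = cot_coord ?e (cot_lift A f (cot_lift A h z))"
    by (rule cot_lift_coord[OF assms(1) hz, symmetric]) (use chart_at in auto)
  finally show ?thesis
    by (intro cotangent_eqI[where c = ?e] cot_lift_cotangent compose_Diff assms) (use chart_at in auto)
qed

lemma cot_lift_id:
  assumes "z \<in> cotangent A"
  shows "cot_lift A id z = z"
proof -
  let ?c = "chart_at A (fst z)"
  have "cot_coord ?c (cot_lift A id z) = lct id ?c ?c (cot_coord ?c z)"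
    by (rule cot_lift_coord[OF id_Diff assms]) (use chart_at in auto)
  also have "\<dots> = cot_coord ?c z" by (rule lct_id) (use chart_at in auto)
  finally show ?thesis
    by (intro cotangent_eqI[where c = ?c] cot_lift_cotangent id_Diff assms) (use chart_at in auto)
qed

lemma cot_lift_inv:
  assumes "f \<in> Diff A" "z \<in> cotangent A"
  shows "cot_lift A (inv f) (cot_lift A f z) = z" "cot_lift A f (cot_lift A (inv f) z) = z"
proof -
  have "inv f \<circ> f = id" "f \<circ> inv f = id" using DiffD(3,4)[OF assms(1)] by (auto simp: fun_eq_iff)
  then show "cot_lift A (inv f) (cot_lift A f z) = z" "cot_lift A f (cot_lift A (inv f) z) = z"
    using cot_lift_compose[OF inv_Diff[OF assms(1)] assms] cot_lift_compose[OF assms(1) inv_Diff[OF assms(1)] assms(2)]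
      cot_lift_id[OF assms(2)] by simp_all
qed

text \<open>\<open>act_fun\<close> inverts the lift on the bundle by choice; the lift of the inverse
  diffeomorphism is that inverse.\<close>

lemma act_fun_eq:
  assumes "f \<in> Diff A" "z \<in> cotangent A"
  shows "act_fun A f Q z = Q (cot_lift A (inv f) z)"
proof -
  have "inj_on (cot_lift A f) (cotangent A)"
    by (rule inj_on_inverseI[of _ "cot_lift A (inv f)"]) (rule cot_lift_inv(1)[OF assms(1)])
  from inv_into_f_f[OF this cot_lift_cotangent[OF inv_Diff[OF assms(1)] assms(2)]]
  have "inv_into (cotangent A) (cot_lift A f) z = cot_lift A (inv f) z"
    by (simp add: cot_lift_inv(2)[OF assms])
  then show ?thesis using assms(2) by (simp add: act_fun_def)
qed

text \<open>The link between the global lift seen through charts and the coordinate lift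
  \<open>ctl\<close>, on which the calculus is done.\<close>

lemma lift_local_eq:
  assumes "f \<in> Diff A" "c \<in> A" "d \<in> A" "w \<in> cyl (dmn f c d)"
  shows "lift_local A f c d w = lct f c d w"
proof -
  have w: "base_part w \<in> snd c ` fst c" "f (chart_inv c (base_part w)) \<in> fst d"
    using assms by (auto simp: dmn_iff)
  note I = cot_inv_right[OF assms(2) w(1)]
  have "cot_coord d (cot_lift A f (cot_inv A c w)) = lct f c d (cot_coord c (cot_inv A c w))"
    by (rule cot_lift_coord[OF assms(1) I(2) assms(2,3)]) (use I w in auto)
  then show ?thesis by (simp add: lift_local_def I)
qed

lemma C_inf_smooth:
  "Q \<in> C_inf A \<Longrightarrow> c \<in> A \<Longrightarrow> smooth_on (cyl (snd c ` fst c)) (Q \<circ> cot_inv A c)"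
  by (simp add: C_inf_def cot_coord_image)

lemma cot_inv_lct:
  assumes "f \<in> Diff A" "c \<in> A" "d \<in> A" "w \<in> cyl (dmn f c d)"
  shows "cot_inv A d (lct f c d w) = cot_lift A f (cot_inv A c w)"
proof -
  have w: "base_part w \<in> snd c ` fst c" "f (chart_inv c (base_part w)) \<in> fst d"
    using assms by (auto simp: dmn_iff)
  note I = cot_inv_right[OF assms(2) w(1)]
  have "lct f c d w = cot_coord d (cot_lift A f (cot_inv A c w))"
    using cot_lift_coord[OF assms(1) I(2) assms(2,3)] I w by simp
  then show ?thesis
    using I w assms by (simp add: cot_lift_cotangent)
qed

lemma act_fun_C_inf:
  assumes "f \<in> Diff A" "Q \<in> C_inf A"
  shows "act_fun A f Q \<in> C_inf A"
  unfolding C_inf_def mem_Collect_eq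
proof (intro conjI ballI allI impI)
  show "act_fun A f Q z = 0" if "z \<notin> cotangent A" for z using that by (simp add: act_fun_def)
  fix c assume c: "c \<in> A"
  note f' = inv_Diff[OF assms(1)]
  show "smooth_on (cot_coord c ` cot_dom A c) (act_fun A f Q \<circ> cot_inv A c)"
    unfolding cot_coord_image[OF c]
  proof (rule smooth_on_local)
    fix w assume "w \<in> cyl (snd c ` fst c)"
    then have w: "base_part w \<in> snd c ` fst c" by simp
    let ?d = "chart_at A (inv f (chart_inv c (base_part w)))"
    have d: "?d \<in> A" "inv f (chart_inv c (base_part w)) \<in> fst ?d" by (rule chart_at)+
    note D = local_diffeo[OF f' c d(1)]
    have sub: "dmn (inv (inv f)) ?d c \<subseteq> snd ?d ` fst ?d" by (auto simp: dmn_def)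
    have "smooth_on (cyl (dmn (inv (inv f)) ?d c)) (Q \<circ> cot_inv A ?d)"
      by (rule smooth_on_subset[OF C_inf_smooth[OF assms(2) d(1)]]) (use sub in auto)
    then have "smooth_on (cyl (dmn (inv f) c ?d)) (\<lambda>w. (Q \<circ> cot_inv A ?d) (lct (inv f) c ?d w))"
      by (rule smooth_on_ctl_compose[OF D])
    then have "smooth_on (cyl (dmn (inv f) c ?d)) (act_fun A f Q \<circ> cot_inv A c)"
    proof (rule smooth_on_cong[rotated])
      show "open (cyl (dmn (inv f) c ?d))" by (rule open_cyl[OF diffeo_onD(1)[OF D]])
      show "(Q \<circ> cot_inv A ?d) (lct (inv f) c ?d w) = (act_fun A f Q \<circ> cot_inv A c) w" if "w \<in> cyl (dmn (inv f) c ?d)" for w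
        using that cot_inv_right(2)[OF c] by (simp add: cot_inv_lct[OF f' c d(1)] act_fun_eq[OF assms(1)] dmn_iff[OF c])
    qed
    moreover have "w \<in> cyl (dmn (inv f) c ?d)" using w d c by (simp add: dmn_iff)
    ultimately show "\<exists>T. open T \<and> w \<in> T \<and> smooth_on T (act_fun A f Q \<circ> cot_inv A c)"
      using open_cyl[OF diffeo_onD(1)[OF D]] by blast
  qed
qed

end


section \<open>The cocycle property\<close>

lemma lifted_conn_cong:
  assumes "open S" "base_part w \<in> S" "\<And>y k i j. y \<in> S \<Longrightarrow> \<Gamma> k i j y = \<Gamma>' k i j y"
  shows "lifted_conn \<Gamma> K I J w = lifted_conn \<Gamma>' K I J w"
proof -
  have "partial l (\<Gamma> k i j) (base_part w) = partial l (\<Gamma>' k i j) (base_part w)" for l k i j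
    unfolding partial_dd by (rule dd_cong[OF assms])
  then show ?thesis
    using assms(3)[OF assms(2)] by (cases K; cases I; cases J) simp_all
qed

lemma vhess_cong:
  assumes "open U" "w \<in> U" "\<And>w. w \<in> U \<Longrightarrow> q w = q' w"
  shows "vhess q j k w = vhess q' j k w"
  unfolding vhess_def by (intro dd_cong[OF assms(1)] assms)

text \<open>The symbols are differentiated in \<open>Pvec\<close>, and \<open>q\<close> enters
  through derivatives, so agreement is asked on open sets.\<close>

lemma L_expl_cong:
  assumes "open S" "base_part w \<in> S" "\<And>y k i j. y \<in> S \<Longrightarrow> \<Gamma>1 k i j y = \<Gamma>1' k i j y"
    "\<And>y k i j. y \<in> S \<Longrightarrow> \<Gamma>2 k i j y = \<Gamma>2' k i j y"
    and "open U" "w \<in> U" "\<And>w. w \<in> U \<Longrightarrow> q w = q' w"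
  shows "L_expl \<Gamma>1 \<Gamma>2 q w = L_expl \<Gamma>1' \<Gamma>2' q' w"
proof -
  let ?x = "base_part w"
  have c: "cvec \<Gamma>1 ?x X Y = cvec \<Gamma>1' ?x X Y" "cvec \<Gamma>2 ?x X Y = cvec \<Gamma>2' ?x X Y" for X Y
    by (rule cvec_cong, rule assms(3)[OF assms(2)], rule cvec_cong, rule assms(4)[OF assms(2)])
  have d: "cvec (dconn \<Gamma>1 V) ?x X Y = cvec (dconn \<Gamma>1' V) ?x X Y" "cvec (dconn \<Gamma>2 V) ?x X Y = cvec (dconn \<Gamma>2' V) ?x X Y" for V X Y
    by (rule cvec_cong, rule dd_cong[OF assms(1,2,3)], assumption, rule cvec_cong, rule dd_cong[OF assms(1,2,4)], assumption)
  have v: "dd V (vhess q j k) w = dd V (vhess q' j k) w" for V j k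
    by (rule dd_cong[OF assms(5,6)]) (rule vhess_cong[OF assms(5) _ assms(7)])
  have v': "vhess q j k w = vhess q' j k w" for j k by (rule vhess_cong[OF assms(5-7)])
  show ?thesis unfolding L_expl_def Let_def Pvec_def ric_def c d v v' vthird_def ..
qed

lemma bvec_add: "bvec (u + v) = bvec u + bvec v"
  by (simp add: vec_eq_iff all_Plus bvec_def)

text \<open>Each coefficient is an expression in the second connection minus the same expression in
  the first, so sums telescope; this is the algebra behind the cocycle identity.\<close>

lemma L_expl_add:
  assumes "open U" "w \<in> U" "smooth_on U q"
  shows "L_expl \<Gamma>1 \<Gamma>3 q w = L_expl \<Gamma>1 \<Gamma>2 q w + L_expl \<Gamma>2 \<Gamma>3 q w"
proof -
  let ?x = "base_part w" and ?\<xi> = "fibre_part w"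
  have hd: "vhess q j k differentiable (at w)" for j k
    by (rule smooth_on_differentiable[OF smooth_on_vhess[OF assms(3)] assms(2)])
  have 1: "dd (bvec (cvec \<Gamma>3 ?x X Y - cvec \<Gamma>1 ?x X Y)) (vhess q j k) w =
    dd (bvec (cvec \<Gamma>2 ?x X Y - cvec \<Gamma>1 ?x X Y)) (vhess q j k) w + dd (bvec (cvec \<Gamma>3 ?x X Y - cvec \<Gamma>2 ?x X Y)) (vhess q j k) w" for X Y j k
    by (simp add: dd_add_left[OF hd, symmetric] bvec_add[symmetric])
  have 2: "?\<xi> \<bullet> Pvec \<Gamma>1 \<Gamma>3 ?x X Y Z = ?\<xi> \<bullet> Pvec \<Gamma>1 \<Gamma>2 ?x X Y Z + ?\<xi> \<bullet> Pvec \<Gamma>2 \<Gamma>3 ?x X Y Z" for X Y Z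
    by (simp add: Pvec_def inner_add_right inner_diff_right)
  show ?thesis unfolding L_expl_def Let_def 1 2
    by (simp add: sum.distrib algebra_simps sum_subtractf)
qed

text \<open>A mixed derivative occurs under several orderings among the index lists; the whole
  coefficient is put on the list with the base index in front, and the other orderings get
  zero.\<close>

definition L_coef :: "'n::finite christoffel \<Rightarrow> 'n christoffel \<Rightarrow> ('n + 'n) list \<Rightarrow> real^('n + 'n) \<Rightarrow> real" where
  "L_coef \<Gamma> \<Gamma>' is w = (case is of
     [Inl i, Inr j, Inr k] \<Rightarrow> 3 * (\<Gamma>' i j k (base_part w) - \<Gamma> i j k (base_part w))
   | [Inr k, Inr i, Inr j] \<Rightarrow> fibre_part w \<bullet> Pvec \<Gamma> \<Gamma>' (base_part w) (axis k 1) (axis i 1) (axis j 1)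
   | [Inr i, Inr j] \<Rightarrow> 3 * (ric \<Gamma>' (base_part w) (axis i 1) (axis j 1) - ric \<Gamma> (base_part w) (axis i 1) (axis j 1))
   | _ \<Rightarrow> 0)"

lemma L_coef_simps:
  "L_coef \<Gamma> \<Gamma>' [Inl i, Inr j, Inr k] = (\<lambda>w. 3 * (\<Gamma>' i j k (base_part w) - \<Gamma> i j k (base_part w)))"
  "L_coef \<Gamma> \<Gamma>' [Inr k, Inr i, Inr j] = (\<lambda>w. fibre_part w \<bullet> Pvec \<Gamma> \<Gamma>' (base_part w) (axis k 1) (axis i 1) (axis j 1))"
  "L_coef \<Gamma> \<Gamma>' [Inr i, Inr j] = (\<lambda>w. 3 * (ric \<Gamma>' (base_part w) (axis i 1) (axis j 1) - ric \<Gamma> (base_part w) (axis i 1) (axis j 1)))"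
  by (simp_all add: L_coef_def fun_eq_iff)

lemma L_coef_zero:
  assumes "\<And>i j k. is \<noteq> [Inl i, Inr j, Inr k]" "\<And>i j k. is \<noteq> [Inr i, Inr j, Inr k]" "\<And>i j. is \<noteq> [Inr i, Inr j]"
  shows "L_coef \<Gamma> \<Gamma>' is = (\<lambda>w. 0)"
  using assms unfolding L_coef_def fun_eq_iff by (auto split: list.split sum.split)

lemma smooth_on_Pvec:
  assumes "open S" "\<And>k i j. smooth_on S (\<Gamma>1 k i j)" "\<And>k i j. smooth_on S (\<Gamma>2 k i j)"
  shows "smooth_on S (\<lambda>x. Pvec \<Gamma>1 \<Gamma>2 x X Y Z)"
  unfolding Pvec_def
  by (intro smooth_on_add smooth_on_diff smooth_on_scaleR smooth_on_const assms smooth_on_cvec[OF assms(1,1)]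
      smooth_on_ident smooth_on_dd)

lemma smooth_on_ric:
  assumes "open S" "\<And>k i j. smooth_on S (\<Gamma> k i j)"
  shows "smooth_on S (\<lambda>x. ric \<Gamma> x Y Z)"
  unfolding ric_def
  by (intro smooth_on_sum smooth_on_component smooth_on_const assms smooth_on_cvec[OF assms(1,1)] smooth_on_ident)

lemma smooth_on_Lcoef:
  assumes "open S" "\<And>k i j. smooth_on S (\<Gamma>1 k i j)" "\<And>k i j. smooth_on S (\<Gamma>2 k i j)"
  shows "smooth_on (cyl S) (L_coef \<Gamma>1 \<Gamma>2 is)"
proof -
  note o = open_cyl[OF assms(1)]
  have 1: "smooth_on (cyl S) (\<lambda>w. 3 * (\<Gamma>2 i j k (base_part w) - \<Gamma>1 i j k (base_part w)))" for i j k
    by (intro smooth_on_mult smooth_on_diff smooth_on_const o smooth_on_cyl[OF assms(1)] assms(2,3))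
  have 2: "smooth_on (cyl S) (\<lambda>w. fibre_part w \<bullet> Pvec \<Gamma>1 \<Gamma>2 (base_part w) (axis k 1) (axis i 1) (axis j 1))" for i j k
    by (rule smooth_on_inner[OF o smooth_on_fibre smooth_on_cyl[OF assms(1) smooth_on_Pvec[OF assms]]])
  have 3: "smooth_on (cyl S) (\<lambda>w. 3 * (ric \<Gamma>2 (base_part w) (axis i 1) (axis j 1) - ric \<Gamma>1 (base_part w) (axis i 1) (axis j 1)))" for i j
    by (intro smooth_on_mult smooth_on_diff smooth_on_const o
        smooth_on_cyl[OF assms(1) smooth_on_ric[OF assms(1)]] assms(2,3))
  show ?thesis
  proof (cases "(\<exists>i j k. is = [Inl i, Inr j, Inr k]) \<or> (\<exists>i j k. is = [Inr i, Inr j, Inr k]) \<or> (\<exists>i j. is = [Inr i, Inr j])")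
    case True
    then show ?thesis by (elim disjE exE) (simp_all only: L_coef_simps 1 2 3)
  next
    case False
    then have "L_coef \<Gamma>1 \<Gamma>2 is = (\<lambda>w. 0)" by (intro L_coef_zero) auto
    then show ?thesis by (simp add: smooth_on_const)
  qed
qed

lemma smooth_on_foldr_partial: "smooth_on S q \<Longrightarrow> smooth_on S (foldr partial is q)"
  by (induction "is") (simp_all add: smooth_on_Suc_partial)

lemma finite_lists_le: "finite {is :: 'i::finite list. length is \<le> k}"
  using finite_lists_length_le[of "UNIV :: 'i set" k] by simp

text \<open>Lists with a coefficient that can be non-zero form three disjoint, injectively
  parametrised families, one for each sum in \<open>L_expl\<close>.\<close>

lemma L_expl_eq_sum:
  assumes "open U" "w \<in> U" "smooth_on U q"
  shows "L_expl \<Gamma>1 \<Gamma>2 q w = (\<Sum>is\<in>{is. length is \<le> 3}. L_coef \<Gamma>1 \<Gamma>2 is w * foldr partial is q w)"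
proof -
  let ?L = "{is :: ('a + 'a) list. length is \<le> 3}"
  let ?f = "\<lambda>is. L_coef \<Gamma>1 \<Gamma>2 is w * foldr partial is q w"
  define a where "a = (\<lambda>(i, j, k). [Inl i, Inr j, Inr k :: 'a + 'a])"
  define b where "b = (\<lambda>(i, j, k). [Inr i, Inr j, Inr k :: 'a + 'a])"
  define c where "c = (\<lambda>(i, j). [Inr i, Inr j :: 'a + 'a])"
  have inj: "inj a" "inj b" "inj c" by (auto simp: a_def b_def c_def inj_on_def)
  have "(\<Sum>is\<in>?L. ?f is) = (\<Sum>is\<in>range a \<union> range b \<union> range c. ?f is)"
  proof (rule sum.mono_neutral_right[OF finite_lists_le])
    show "range a \<union> range b \<union> range c \<subseteq> ?L" by (auto simp: a_def b_def c_def)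
    show "\<forall>is\<in>?L - (range a \<union> range b \<union> range c). ?f is = 0"
    proof
      fix "is" :: "('a + 'a) list" assume "is \<in> ?L - (range a \<union> range b \<union> range c)"
      then have n: "\<And>i j k. is \<noteq> a (i, j, k)" "\<And>i j k. is \<noteq> b (i, j, k)" "\<And>i j. is \<noteq> c (i, j)"
        by blast+
      have "L_coef \<Gamma>1 \<Gamma>2 is w = 0"
        using L_coef_zero[of "is" \<Gamma>1 \<Gamma>2] n by (simp add: a_def b_def c_def)
      then show "?f is = 0" by simp
    qed
  qed
  also have "\<dots> = (\<Sum>is\<in>range a. ?f is) + (\<Sum>is\<in>range b. ?f is) + (\<Sum>is\<in>range c. ?f is)"
    by (subst sum.union_disjoint; (subst sum.union_disjoint)?) (auto simp: a_def b_def c_def)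
  also have "(\<Sum>is\<in>range a. ?f is) = 3 * (\<Sum>j\<in>UNIV. \<Sum>k\<in>UNIV. dd (bvec (cvec \<Gamma>2 (base_part w) (axis j 1) (axis k 1)
      - cvec \<Gamma>1 (base_part w) (axis j 1) (axis k 1))) (vhess q j k) w)"
  proof -
    have vd: "vhess q j k differentiable (at w)" for j k
      by (rule smooth_on_differentiable[OF smooth_on_vhess[OF assms(3)] assms(2)])
    have "(\<Sum>is\<in>range a. ?f is) = (\<Sum>i\<in>UNIV. \<Sum>j\<in>UNIV. \<Sum>k\<in>UNIV. ?f [Inl i, Inr j, Inr k])"
      by (subst sum.reindex[OF inj(1)]) (simp add: a_def sum.cartesian_product case_prod_beta)
    also have "\<dots> = (\<Sum>j\<in>UNIV. \<Sum>k\<in>UNIV. \<Sum>i\<in>UNIV. ?f [Inl i, Inr j, Inr k])"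
      by (rule sum3_rot[symmetric])
    also have "\<dots> = 3 * (\<Sum>j\<in>UNIV. \<Sum>k\<in>UNIV. dd (bvec (cvec \<Gamma>2 (base_part w) (axis j 1) (axis k 1)
      - cvec \<Gamma>1 (base_part w) (axis j 1) (axis k 1))) (vhess q j k) w)"
      unfolding dd_bvec[OF vd] sum_distrib_left
      by (intro sum.cong refl) (simp add: L_coef_simps partial_dd vhess_def cvec_axis)
    finally show ?thesis .
  qed
  also have "(\<Sum>is\<in>range b. ?f is) = (\<Sum>k\<in>UNIV. \<Sum>i\<in>UNIV. \<Sum>j\<in>UNIV.
     (fibre_part w \<bullet> Pvec \<Gamma>1 \<Gamma>2 (base_part w) (axis k 1) (axis i 1) (axis j 1)) * vthird q k i j w)"
    by (subst sum.reindex[OF inj(2)])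
      (simp add: b_def sum.cartesian_product case_prod_beta L_coef_simps partial_dd vthird_def vhess_def)
  also have "(\<Sum>is\<in>range c. ?f is) = 3 * (\<Sum>i\<in>UNIV. \<Sum>j\<in>UNIV.
     (ric \<Gamma>2 (base_part w) (axis i 1) (axis j 1) - ric \<Gamma>1 (base_part w) (axis i 1) (axis j 1)) * vhess q i j w)"
    by (subst sum.reindex[OF inj(3)])
      (simp add: c_def sum.cartesian_product case_prod_beta L_coef_simps partial_dd vhess_def sum_distrib_left algebra_simps)
  finally show ?thesis unfolding L_expl_def Let_def by simp
qed

section \<open>The connection pulled back by a diffeomorphism of the manifold\<close>

locale manifold_with_connection = manifold A
  for A :: "('a::{t2_space,second_countable_topology}, 'n::finite) chart set" +
  fixes G :: "('a, 'n) chart \<Rightarrow> 'n christoffel"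
  assumes conn: "symmetric_connection A G"
begin

lemma G_smooth: "c \<in> A \<Longrightarrow> smooth_on (snd c ` fst c) (G c k i j)"
  using conn[unfolded symmetric_connection_def, THEN conjunct1] by blast

lemma G_sym: "c \<in> A \<Longrightarrow> u \<in> snd c ` fst c \<Longrightarrow> G c k i j u = G c k j i u"
  using conn[unfolded symmetric_connection_def, THEN conjunct2, THEN conjunct1] by blast

lemma G_change: "c \<in> A \<Longrightarrow> d \<in> A \<Longrightarrow> u \<in> dmn id c d \<Longrightarrow> G c k i j u = pullback_conn (local_map id c d) (G d) k i j u"
  using conn[unfolded symmetric_connection_def, THEN conjunct2, THEN conjunct2] unfolding dmn_def vimage_id id_apply by blast

lemma dmn_subset: "dmn f c d \<subseteq> snd c ` fst c"
  by (auto simp: dmn_def)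

text \<open>As for lifts, functoriality needs a common domain: the points that \<open>h\<close>
  sends into \<open>d\<close> and whose final image lies in \<open>e\<close>.\<close>

lemma pullback_conn_chain:
  assumes "f \<in> Diff A" "h \<in> Diff A" "c \<in> A" "d \<in> A" "e \<in> A" "u \<in> dmn h c d" "u \<in> dmn (f \<circ> h) c e"
  shows "pullback_conn (local_map (f \<circ> h) c e) \<Gamma> k i j u =
    pullback_conn (local_map h c d) (pullback_conn (local_map f d e) \<Gamma>) k i j u"
proof -
  note F = DiffD[OF assms(1)] and H = DiffD[OF assms(2)]
  note Df = local_diffeo[OF assms(1,4,5)] and Dh = local_diffeo[OF assms(2,3,4)]
  let ?S = "dmn h c d \<inter> dmn (f \<circ> h) c e"
  have o: "open ?S" by (intro open_Int open_dmn[OF H(2)] open_dmn[OF DiffD(2)[OF compose_Diff[OF assms(1,2)]]] assms(3-5))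
  define T where "T = dmn (inv h) d c \<inter> local_map (inv h) d c -` ?S"
  note R = diffeo_on_restrict[OF Dh o, folded T_def, simplified]
  have "T \<subseteq> dmn f d e"
    using assms(3,4) by (auto simp: T_def dmn_iff local_map_def H(4))
  note R' = diffeo_on_restrict[OF Df diffeo_onD(2)[OF R] this]
  have u: "u \<in> ?S" using assms by simp
  have "pullback_conn (local_map (f \<circ> h) c e) \<Gamma> k i j u = pullback_conn (\<lambda>x. local_map f d e (local_map h c d x)) \<Gamma> k i j u"
    by (rule pullback_conn_cong[OF o u]) (use assms in \<open>simp_all add: local_map_compose\<close>)
  also have "\<dots> = pullback_conn (local_map h c d) (pullback_conn (local_map f d e) \<Gamma>) k i j u"
    by (rule pullback_conn_compose[OF R R' u])
  finally show ?thesis .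
qed

text \<open>The chart around the image varies with the point \<open>u\<close>, which makes this a
  global object in the chart \<open>c\<close>; it is a single pull-back near a point only once
  independence of that choice is known.\<close>

definition conn_pull :: "('a \<Rightarrow> 'a) \<Rightarrow> ('a, 'n) chart \<Rightarrow> 'n christoffel" where
  "conn_pull f c k i j u = (let d = chart_at A (f (chart_inv c u)) in pullback_conn (local_map f c d) (G d) k i j u)"

text \<open>Passing from the chosen chart to \<open>d\<close> inserts a coordinate change, and the
  transformation law says that pulling \<open>G\<close> back by it gives \<open>G\<close>
  again.\<close>

lemma conn_pull_eq:
  assumes "f \<in> Diff A" "c \<in> A" "d \<in> A" "u \<in> dmn f c d"
  shows "conn_pull f c k i j u = pullback_conn (local_map f c d) (G d) k i j u"
proof -
  let ?d = "chart_at A (f (chart_inv c u))"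
  note d = chart_at[of "f (chart_inv c u)"]
  have u: "u \<in> dmn f c ?d" "u \<in> dmn (id \<circ> f) c d" using assms d by (auto simp: dmn_iff)
  have v: "local_map f c ?d u \<in> dmn id ?d d" using assms d by (auto simp: dmn_iff local_map_def)
  have "pullback_conn (local_map f c d) (G d) k i j u = pullback_conn (local_map f c ?d) (pullback_conn (local_map id ?d d) (G d)) k i j u"
    using pullback_conn_chain[OF id_Diff assms(1,2) d(1) assms(3) u] by simp
  also have "\<dots> = pullback_conn (local_map f c ?d) (G ?d) k i j u"
    by (rule pullback_conn_cong[OF diffeo_onD(1)[OF local_diffeo[OF assms(1,2) d(1)]] u(1) refl])
      (rule G_change[OF d(1) assms(3) v, symmetric])
  finally show ?thesis by (simp add: conn_pull_def Let_def)
qed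

lemma conn_pull_id: "c \<in> A \<Longrightarrow> u \<in> snd c ` fst c \<Longrightarrow> conn_pull id c k i j u = G c k i j u"
  using conn_pull_eq[OF id_Diff, of c c u] G_change[of c c u] by (simp add: dmn_id)

lemma conn_pull_compose:
  assumes "f \<in> Diff A" "h \<in> Diff A" "c \<in> A" "d \<in> A" "u \<in> dmn h c d"
  shows "conn_pull (f \<circ> h) c k i j u = pullback_conn (local_map h c d) (conn_pull f d) k i j u"
proof -
  let ?e = "chart_at A (f (h (chart_inv c u)))"
  note e = chart_at[of "f (h (chart_inv c u))"]
  have u: "u \<in> dmn (f \<circ> h) c ?e" using assms e by (simp add: dmn_iff)
  have v: "local_map h c d u \<in> dmn f d ?e" using assms e by (auto simp: dmn_iff local_map_def)
  have "conn_pull (f \<circ> h) c k i j u = pullback_conn (local_map (f \<circ> h) c ?e) (G ?e) k i j u"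
    by (rule conn_pull_eq[OF compose_Diff[OF assms(1,2)] assms(3) e(1) u])
  also have "\<dots> = pullback_conn (local_map h c d) (pullback_conn (local_map f d ?e) (G ?e)) k i j u"
    by (rule pullback_conn_chain[OF assms(1-4) e(1) assms(5) u])
  also have "\<dots> = pullback_conn (local_map h c d) (conn_pull f d) k i j u"
    by (rule pullback_conn_cong[OF diffeo_onD(1)[OF local_diffeo[OF assms(2-4)]] assms(5) refl])
      (rule conn_pull_eq[OF assms(1,4) e(1) v, symmetric])
  finally show ?thesis .
qed

text \<open>Around each point the varying chart can be frozen, and the formula becomes a single
  pull-back.\<close>

lemma conn_pull_smooth:
  assumes "f \<in> Diff A" "c \<in> A"
  shows "smooth_on (snd c ` fst c) (conn_pull f c k i j)"
proof (rule smooth_on_local)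
  fix u assume u: "u \<in> snd c ` fst c"
  let ?d = "chart_at A (f (chart_inv c u))"
  note d = chart_at[of "f (chart_inv c u)"]
  have "smooth_on (dmn f c ?d) (pullback_conn (local_map f c ?d) (G ?d) k i j)"
    by (rule smooth_on_pullback_conn[OF local_diffeo[OF assms d(1)] smooth_on_subset[OF G_smooth[OF d(1)] dmn_subset]])
  then have "smooth_on (dmn f c ?d) (conn_pull f c k i j)"
    by (rule smooth_on_cong[OF diffeo_onD(1)[OF local_diffeo[OF assms d(1)]]]) (simp add: conn_pull_eq[OF assms d(1)])
  moreover have "u \<in> dmn f c ?d" using u d assms by (simp add: dmn_iff)
  ultimately show "\<exists>T. open T \<and> u \<in> T \<and> smooth_on T (conn_pull f c k i j)"
    using diffeo_onD(1)[OF local_diffeo[OF assms d(1)]] by blast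
qed

lemma conn_pull_sym:
  assumes "f \<in> Diff A" "c \<in> A" "u \<in> snd c ` fst c"
  shows "conn_pull f c k i j u = conn_pull f c k j i u"
proof -
  let ?d = "chart_at A (f (chart_inv c u))"
  note d = chart_at[of "f (chart_inv c u)"]
  have u: "u \<in> dmn f c ?d" using assms d by (simp add: dmn_iff)
  have v: "local_map f c ?d u \<in> snd ?d ` fst ?d" using d by (simp add: local_map_def)
  show ?thesis unfolding conn_pull_eq[OF assms(1,2) d(1) u]
    by (rule pullback_conn_commute[where \<Gamma> = "G ?d", OF local_diffeo[OF assms(1,2) d(1)] u G_sym[OF d(1) v]])
qed

text \<open>Local naturality transported to the bundle. For \<open>h\<close> the identity it
  expresses independence of the chart, for general \<open>h\<close> compatibility with the
  action.\<close>

lemma L_expl_covariant: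
  assumes "h \<in> Diff A" "f1 \<in> Diff A" "f2 \<in> Diff A" "c \<in> A" "d \<in> A" "Q \<in> C_inf A" "z \<in> cotangent A"
    "fst z \<in> fst c" "h (fst z) \<in> fst d"
  shows "L_expl (conn_pull (f1 \<circ> h) c) (conn_pull (f2 \<circ> h) c) (\<lambda>w. Q (cot_lift A h (cot_inv A c w))) (cot_coord c z) =
    L_expl (conn_pull f1 d) (conn_pull f2 d) (Q \<circ> cot_inv A d) (cot_coord d (cot_lift A h z))"
proof -
  note D = local_diffeo[OF assms(1,4,5)]
  have u: "snd c (fst z) \<in> dmn h c d" using assms by (simp add: dmn_in)
  have sub: "dmn (inv h) d c \<subseteq> snd d ` fst d" by (rule dmn_subset)
  have "L_expl (conn_pull (f1 \<circ> h) c) (conn_pull (f2 \<circ> h) c) (\<lambda>w. Q (cot_lift A h (cot_inv A c w))) (cot_coord c z) =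
    L_expl (pullback_conn (local_map h c d) (conn_pull f1 d)) (pullback_conn (local_map h c d) (conn_pull f2 d))
      (\<lambda>w. (Q \<circ> cot_inv A d) (lct h c d w)) (cot_coord c z)"
  proof (rule L_expl_cong)
    show "open (dmn h c d)" "open (cyl (dmn h c d))" using diffeo_onD(1)[OF D] by (simp_all add: open_cyl)
    show "base_part (cot_coord c z) \<in> dmn h c d" "cot_coord c z \<in> cyl (dmn h c d)" using u by simp_all
    show "conn_pull (f1 \<circ> h) c k i j y = pullback_conn (local_map h c d) (conn_pull f1 d) k i j y" if "y \<in> dmn h c d" for y k i j
      by (rule conn_pull_compose[OF assms(2,1,4,5) that])
    show "conn_pull (f2 \<circ> h) c k i j y = pullback_conn (local_map h c d) (conn_pull f2 d) k i j y" if "y \<in> dmn h c d" for y k i j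
      by (rule conn_pull_compose[OF assms(3,1,4,5) that])
    show "Q (cot_lift A h (cot_inv A c w)) = (Q \<circ> cot_inv A d) (lct h c d w)" if "w \<in> cyl (dmn h c d)" for w
      by (simp add: cot_inv_lct[OF assms(1,4,5) that])
  qed
  also have "\<dots> = L_expl (conn_pull f1 d) (conn_pull f2 d) (Q \<circ> cot_inv A d) (lct h c d (cot_coord c z))"
  proof (rule L_expl_natural[OF D])
    show "cot_coord c z \<in> cyl (dmn h c d)" using u by simp
    show "smooth_on (dmn (inv h) d c) (conn_pull f1 d k i j)" "smooth_on (dmn (inv h) d c) (conn_pull f2 d k i j)" for k i j
      by (rule smooth_on_subset[OF conn_pull_smooth sub]; fact)+
    show "conn_pull f1 d k i j y = conn_pull f1 d k j i y" "conn_pull f2 d k i j y = conn_pull f2 d k j i y" if "y \<in> dmn (inv h) d c" for k i j y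
      by (rule conn_pull_sym[OF _ assms(5)]; use assms that sub in blast)+
    show "smooth_on (cyl (dmn (inv h) d c)) (Q \<circ> cot_inv A d)"
      by (rule smooth_on_subset[OF C_inf_smooth[OF assms(6,5)]]) (use sub in auto)
  qed
  finally show ?thesis using cot_lift_coord[OF assms(1,7,4,5,8,9)] by simp
qed

text \<open>\<open>L_op\<close> works in chosen charts around the base point and its image.
  Naturality of the lifted connection removes the second, and covariance under the identity replaces
  the first by an arbitrary \<open>c\<close>.\<close>

lemma L_op_eq:
  assumes "f \<in> Diff A" "Q \<in> C_inf A" "z \<in> cotangent A" "c \<in> A" "fst z \<in> fst c"
  shows "L_op A G f Q z = L_expl (conn_pull id c) (conn_pull f c) (Q \<circ> cot_inv A c) (cot_coord c z)"
proof -
  let ?c = "chart_at A (fst z)" and ?d = "chart_at A (f (fst z))"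
  note c0 = chart_at[of "fst z"] and d0 = chart_at[of "f (fst z)"]
  let ?w = "cot_coord ?c z" and ?q = "Q \<circ> cot_inv A ?c"
  note D = local_diffeo[OF assms(1) c0(1) d0(1)]
  have u: "snd ?c (fst z) \<in> dmn f ?c ?d" using c0 d0 by (simp add: dmn_in)
  have w: "?w \<in> cyl (dmn f ?c ?d)" using u by simp
  have o: "open (snd ?c ` fst ?c)" by (rule chart_open(2)[OF c0(1)])
  have b: "base_part ?w \<in> snd ?c ` fst ?c" using c0 by simp
  \<comment> \<open>The tensor C is the difference of two lifted connections, since lifting a
    connection commutes with pulling back.\<close>
  have C: "C_comp A G f ?c ?d k i j ?w = lifted_conn (conn_pull f ?c) k i j ?w - lifted_conn (conn_pull id ?c) k i j ?w" for k i j
  proof -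
    have "pullback_conn (lift_local A f ?c ?d) (lifted_conn (G ?d)) k i j ?w = pullback_conn (lct f ?c ?d) (lifted_conn (G ?d)) k i j ?w"
      by (rule pullback_conn_cong[OF open_cyl[OF diffeo_onD(1)[OF D]] w]) (simp_all add: lift_local_eq[OF assms(1) c0(1) d0(1)])
    also have "\<dots> = lifted_conn (pullback_conn (local_map f ?c ?d) (G ?d)) k i j ?w"
      by (rule pullback_lifted_conn[OF D w smooth_on_subset[OF G_smooth[OF d0(1)] dmn_subset]])
        (rule G_sym[OF d0(1)], use dmn_subset in blast)
    also have "\<dots> = lifted_conn (conn_pull f ?c) k i j ?w"
      by (rule lifted_conn_cong[OF diffeo_onD(1)[OF D]]) (use u in \<open>simp_all add: conn_pull_eq[OF assms(1) c0(1) d0(1)]\<close>)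
    finally have 1: "pullback_conn (lift_local A f ?c ?d) (lifted_conn (G ?d)) k i j ?w = lifted_conn (conn_pull f ?c) k i j ?w" .
    have "lifted_conn (G ?c) k i j ?w = lifted_conn (conn_pull id ?c) k i j ?w"
      by (rule lifted_conn_cong[OF o b]) (rule conn_pull_id[OF c0(1), symmetric])
    then show ?thesis unfolding C_comp_def 1 by simp
  qed
  have C': "C_comp A G f ?c ?d k i j ?w = lifted_conn (conn_pull f ?c) k i j ?w - lifted_conn (G ?c) k i j ?w" for k i j
    unfolding C using lifted_conn_cong[OF o b conn_pull_id[OF c0(1)]] by simp
  have "L_op A G f Q z = L_loc (G ?c) (conn_pull f ?c) ?q ?w"
    unfolding L_op_def L_loc_def Let_def C' using assms(3) by simp
  also have "\<dots> = L_expl (G ?c) (conn_pull f ?c) ?q ?w"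
    by (rule L_loc_eq[OF o b G_smooth[OF c0(1)] conn_pull_smooth[OF assms(1) c0(1)] G_sym[OF c0(1)] conn_pull_sym[OF assms(1) c0(1)]
        open_cyl[OF o] _ C_inf_smooth[OF assms(2) c0(1)]]) (use b in simp_all)
  also have "\<dots> = L_expl (conn_pull id ?c) (conn_pull f ?c) ?q ?w"
    by (rule L_expl_cong[OF o b _ _ open_UNIV UNIV_I]) (simp_all only: conn_pull_id[OF c0(1)])
  also have "\<dots> = L_expl (conn_pull (id \<circ> id) c) (conn_pull (f \<circ> id) c) (\<lambda>w. Q (cot_lift A id (cot_inv A c w))) (cot_coord c z)"
    using L_expl_covariant[OF id_Diff id_Diff assms(1) assms(4) c0(1) assms(2,3,5)] c0(2) cot_lift_id[OF assms(3)] by simp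
  also have "\<dots> = L_expl (conn_pull id c) (conn_pull f c) (Q \<circ> cot_inv A c) (cot_coord c z)"
  proof (rule L_expl_cong[OF open_UNIV UNIV_I])
    show "open (cyl (snd c ` fst c))" by (rule open_cyl[OF chart_open(2)[OF assms(4)]])
    show "cot_coord c z \<in> cyl (snd c ` fst c)" using assms by simp
    show "Q (cot_lift A id (cot_inv A c w)) = (Q \<circ> cot_inv A c) w" if "w \<in> cyl (snd c ` fst c)" for w
      using that cot_inv_right(2)[OF assms(4)] by (simp add: cot_lift_id)
  qed simp_all
  finally show ?thesis .
qed

lemma act_inv_eq: "f \<in> Diff A \<Longrightarrow> z \<in> cotangent A \<Longrightarrow> act_fun A (inv f) Q z = Q (cot_lift A f z)"
  using act_fun_eq[OF inv_Diff] DiffD(5) by metis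

text \<open>The pair formed by the connection and its pull-back under the inverse of
  \<open>f \<circ> h\<close> is split at the pull-back under \<open>inv f\<close>. In the second
  half both connections are pull-backs by \<open>inv f\<close>, so by covariance it is the operator
  of \<open>inv h\<close> conjugated by the action of \<open>f\<close>.\<close>

lemma L_op_cocycle:
  assumes "f \<in> Diff A" "h \<in> Diff A" "Q \<in> C_inf A" "z \<in> cotangent A"
  shows "L_op A G (inv (f \<circ> h)) Q z = L_op A G (inv f) Q z + act_op A f (L_op A G (inv h)) Q z"
proof -
  let ?c = "chart_at A (fst z)" and ?z = "cot_lift A (inv f) z" and ?Q = "act_fun A (inv f) Q"
  let ?d = "chart_at A (fst ?z)"
  note c = chart_at[of "fst z"] and d = chart_at[of "fst ?z"]
  note f' = inv_Diff[OF assms(1)] and h' = inv_Diff[OF assms(2)]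
  have hf: "inv h \<circ> inv f \<in> Diff A" by (rule compose_Diff[OF h' f'])
  have Q': "?Q \<in> C_inf A" by (rule act_fun_C_inf[OF f' assms(3)])
  have z': "?z \<in> cotangent A" by (rule cot_lift_cotangent[OF f' assms(4)])
  have o: "open (cyl (snd ?c ` fst ?c))" by (rule open_cyl[OF chart_open(2)[OF c(1)]])
  have w: "cot_coord ?c z \<in> cyl (snd ?c ` fst ?c)" using c by simp
  have "L_op A G (inv (f \<circ> h)) Q z = L_expl (conn_pull id ?c) (conn_pull (inv h \<circ> inv f) ?c) (Q \<circ> cot_inv A ?c) (cot_coord ?c z)"
    unfolding inv_compose[OF assms(1,2)] by (rule L_op_eq[OF hf assms(3,4) c])
  also have "\<dots> = L_expl (conn_pull id ?c) (conn_pull (inv f) ?c) (Q \<circ> cot_inv A ?c) (cot_coord ?c z)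
      + L_expl (conn_pull (id \<circ> inv f) ?c) (conn_pull (inv h \<circ> inv f) ?c) (Q \<circ> cot_inv A ?c) (cot_coord ?c z)"
    using L_expl_add[OF o w C_inf_smooth[OF assms(3) c(1)]] by simp
  also have "L_expl (conn_pull id ?c) (conn_pull (inv f) ?c) (Q \<circ> cot_inv A ?c) (cot_coord ?c z) = L_op A G (inv f) Q z"
    by (rule L_op_eq[OF f' assms(3,4) c, symmetric])
  \<comment> \<open>The function is rewritten as one composed with the lift of \<open>inv f\<close>,
    the form that covariance requires.\<close>
  also have "L_expl (conn_pull (id \<circ> inv f) ?c) (conn_pull (inv h \<circ> inv f) ?c) (Q \<circ> cot_inv A ?c) (cot_coord ?c z)
     = L_expl (conn_pull (id \<circ> inv f) ?c) (conn_pull (inv h \<circ> inv f) ?c) (\<lambda>w. ?Q (cot_lift A (inv f) (cot_inv A ?c w))) (cot_coord ?c z)"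
  proof (rule L_expl_cong[OF open_UNIV _ refl refl o w])
    show "(Q \<circ> cot_inv A ?c) w = ?Q (cot_lift A (inv f) (cot_inv A ?c w))" if "w \<in> cyl (snd ?c ` fst ?c)" for w
      using that cot_inv_right(2)[OF c(1)] by (simp add: act_inv_eq[OF assms(1)] cot_lift_cotangent[OF f'] cot_lift_inv[OF assms(1)])
  qed simp
  also have "\<dots> = L_expl (conn_pull id ?d) (conn_pull (inv h) ?d) (?Q \<circ> cot_inv A ?d) (cot_coord ?d ?z)"
    by (rule L_expl_covariant[OF f' id_Diff h' c(1) d(1) Q' assms(4) c(2)]) (use d in simp)
  also have "\<dots> = L_op A G (inv h) ?Q ?z" by (rule L_op_eq[OF h' Q' z' d, symmetric])
  also have "\<dots> = act_op A f (L_op A G (inv h)) Q z"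
    by (simp add: act_op_def act_fun_eq[OF assms(1,4)])
  finally show ?thesis .
qed

text \<open>The sum form serves twice: for membership in \<open>diff_ops\<close>, and for comparing
  the operator on functions with equal jets.\<close>

lemma L_op_sum:
  assumes "f \<in> Diff A" "Q \<in> C_inf A" "z \<in> cotangent A" "c \<in> A" "fst z \<in> fst c"
  shows "L_op A G f Q z = (\<Sum>is\<in>{is. length is \<le> 3}. L_coef (conn_pull id c) (conn_pull f c) is (cot_coord c z)
      * foldr partial is (Q \<circ> cot_inv A c) (cot_coord c z))"
  unfolding L_op_eq[OF assms]
  by (rule L_expl_eq_sum[OF open_cyl[OF chart_open(2)[OF assms(4)]] _ C_inf_smooth[OF assms(2,4)]]) (use assms in simp)

lemma L_op_diff_ops:
  assumes "f \<in> Diff A"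
  shows "L_op A G f \<in> diff_ops A 3"
  unfolding diff_ops_def mem_Collect_eq
proof (intro conjI ballI)
  have sm: "smooth_on (cyl (snd c ` fst c)) (L_coef (conn_pull id c) (conn_pull f c) is)" if "c \<in> A" for c "is"
    by (rule smooth_on_Lcoef[OF chart_open(2)[OF that] conn_pull_smooth[OF id_Diff that] conn_pull_smooth[OF assms that]])
  show "L_op A G f Q \<in> C_inf A" if Q: "Q \<in> C_inf A" for Q
    unfolding C_inf_def mem_Collect_eq
  proof (intro conjI ballI allI impI)
    show "L_op A G f Q z = 0" if "z \<notin> cotangent A" for z using that by (simp add: L_op_def)
    fix c assume c: "c \<in> A"
    note o = open_cyl[OF chart_open(2)[OF c]]
    show "smooth_on (cot_coord c ` cot_dom A c) (L_op A G f Q \<circ> cot_inv A c)"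
      unfolding cot_coord_image[OF c]
    proof (rule smooth_on_cong[OF o])
      show "smooth_on (cyl (snd c ` fst c)) (\<lambda>w. \<Sum>is\<in>{is. length is \<le> 3}. L_coef (conn_pull id c) (conn_pull f c) is w
        * foldr partial is (Q \<circ> cot_inv A c) w)"
        by (intro smooth_on_sum smooth_on_mult o sm c smooth_on_foldr_partial C_inf_smooth Q)
      show "(\<Sum>is\<in>{is. length is \<le> 3}. L_coef (conn_pull id c) (conn_pull f c) is w * foldr partial is (Q \<circ> cot_inv A c) w)
        = (L_op A G f Q \<circ> cot_inv A c) w" if "w \<in> cyl (snd c ` fst c)" for w
      proof -
        have b: "base_part w \<in> snd c ` fst c" using that by simp
        show ?thesis using L_op_sum[OF assms Q cot_inv_right(2)[OF c b] c cot_inv_right(4)[OF c b]]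
          by (simp add: cot_inv_right(1)[OF c b])
      qed
    qed
  qed
  fix c assume c: "c \<in> A"
  show "\<exists>a :: ('n + 'n) list \<Rightarrow> real^('n + 'n) \<Rightarrow> real.
        (\<forall>is. length is \<le> 3 \<longrightarrow> smooth_on (cot_coord c ` cot_dom A c) (a is)) \<and>
        (\<forall>Q\<in>C_inf A. \<forall>z\<in>cot_dom A c.
           L_op A G f Q z = (\<Sum>is\<in>{is. length is \<le> 3}.
              a is (cot_coord c z) * foldr partial is (Q \<circ> cot_inv A c) (cot_coord c z)))"
    using sm[OF c] L_op_sum[OF assms _ cot_domD(1) c cot_domD(2)]
    by (intro exI[of _ "L_coef (conn_pull id c) (conn_pull f c)"]) (simp add: cot_coord_image[OF c])
qed

theorem L_op_one_cocycle: "one_cocycle A 3 (\<lambda>f. L_op A G (inv f))"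
  unfolding one_cocycle_def using L_op_diff_ops[OF inv_Diff] L_op_cocycle by blast

end


section \<open>A compactly supported diffeomorphism with prescribed second derivative\<close>

text \<open>The function exp (-1/t) times powers of 1/t: the derivative of a member is a linear
  combination of members, which is what the induction for smoothness needs.\<close>

definition flat_exp :: "nat \<Rightarrow> real \<Rightarrow> real" where
  "flat_exp m t = (if t > 0 then inverse t ^ m / exp (inverse t) else 0)"

lemma flat_exp_deriv:
  "(flat_exp m has_real_derivative (- real m * flat_exp (m + 1) t + flat_exp (m + 2) t)) (at t)"
proof -
  consider "t > 0" | "t < 0" | "t = 0" by linarith
  then show ?thesis
  proof cases
    case 1
    have "((\<lambda>t. inverse t ^ m / exp (inverse t)) has_real_derivative
      (- real m * (inverse t ^ (m + 1) / exp (inverse t)) + inverse t ^ (m + 2) / exp (inverse t))) (at t)"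
      using 1 by (cases m) (auto intro!: derivative_eq_intros simp: field_simps power2_eq_square,
        metis One_nat_def Suc_pred not_gr_zero power_Suc)
    then have "((\<lambda>t. inverse t ^ m / exp (inverse t)) has_real_derivative
      (- real m * flat_exp (m + 1) t + flat_exp (m + 2) t)) (at t)"
      using 1 by (simp add: flat_exp_def)
    then show ?thesis
      by (rule has_field_derivative_transform_within_open[of _ _ _ "{0<..}"]) (use 1 in \<open>auto simp: flat_exp_def\<close>)
  next
    case 2
    have "((\<lambda>t. 0) has_real_derivative (- real m * flat_exp (m + 1) t + flat_exp (m + 2) t)) (at t)"
      using 2 by (simp add: flat_exp_def)
    then show ?thesis
      by (rule has_field_derivative_transform_within_open[of _ _ _ "{..<0}"]) (use 2 in \<open>auto simp: flat_exp_def\<close>)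
  next
    case 3
    \<comment> \<open>From the right the difference quotient has one more power of 1/h, and the
      exponential wins; from the left it is zero.\<close>
    have "((\<lambda>h. flat_exp m h / h) \<longlongrightarrow> 0) (at 0)"
    proof (rule filterlim_split_at)
      have "((\<lambda>h. inverse h ^ (m + 1) / exp (inverse h)) \<longlongrightarrow> 0) (at_right (0::real))"
        by (rule filterlim_compose[OF tendsto_power_div_exp_0 filterlim_inverse_at_top_right])
      then show "((\<lambda>h. flat_exp m h / h) \<longlongrightarrow> 0) (at_right 0)"
        by (rule Lim_transform_eventually)
          (auto simp: eventually_at_filter flat_exp_def field_simps)
      have "((\<lambda>h. 0) \<longlongrightarrow> 0) (at_left (0::real))" by simp
      then show "((\<lambda>h. flat_exp m h / h) \<longlongrightarrow> 0) (at_left 0)"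
        by (rule Lim_transform_eventually) (auto simp: eventually_at_filter flat_exp_def)
    qed
    then show ?thesis using 3 by (simp add: DERIV_def flat_exp_def)
  qed
qed

lemma smooth_on_flat_exp: "smooth_on UNIV (flat_exp m)"
  unfolding smooth_on_def
proof
  fix k show "Ck_on k UNIV (flat_exp m)"
  proof (induction k arbitrary: m)
    case 0
    then show ?case
      using DERIV_isCont[OF flat_exp_deriv] by (simp add: continuous_on_eq_continuous_at)
  next
    case (Suc k)
    have d: "(flat_exp m has_derivative (\<lambda>v. (- real m * flat_exp (m + 1) t + flat_exp (m + 2) t) * v)) (at t)" for t
      using flat_exp_deriv[of m t] by (simp add: has_field_derivative_def)
    have "Ck_on k UNIV (dd v (flat_exp m))" for v
    proof (rule Ck_on_cong[OF open_UNIV])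
      show "Ck_on k UNIV (\<lambda>t. (- real m * flat_exp (m + 1) t + flat_exp (m + 2) t) * v)"
        by (intro Ck_on_bilinear[OF bounded_bilinear_mult open_UNIV] Ck_on_add open_UNIV Ck_on_const Suc)
    qed (simp add: dd_eqI[OF d])
    then show ?case using d by (auto simp: Ck_on_Suc differentiable_def)
  qed
qed

definition bump :: "real^'n::finite \<Rightarrow> real \<Rightarrow> real^'n \<Rightarrow> real" where
  "bump u0 r x = flat_exp 0 (r\<^sup>2 - (x - u0) \<bullet> (x - u0))"

lemma smooth_on_bump: "smooth_on UNIV (bump u0 r)"
  unfolding bump_def
  by (rule smooth_on_compose[OF open_UNIV open_UNIV _ smooth_on_flat_exp])
    (intro UNIV_I smooth_on_diff smooth_on_inner smooth_on_const smooth_on_ident open_UNIV)+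

lemma bump_center: "r > 0 \<Longrightarrow> bump u0 r u0 > 0"
  by (simp add: bump_def flat_exp_def)

lemma bump_outside: "x \<notin> cball u0 r \<Longrightarrow> r > 0 \<Longrightarrow> bump u0 r x = 0"
proof -
  assume "x \<notin> cball u0 r" "r > 0"
  then have "r < norm (x - u0)" by (simp add: dist_norm norm_minus_commute)
  then have "r\<^sup>2 < (x - u0) \<bullet> (x - u0)" using \<open>r > 0\<close>
    by (simp add: power2_norm_eq_inner[symmetric] power_strict_mono)
  then show ?thesis by (simp add: bump_def flat_exp_def)
qed

text \<open>On every line in direction \<open>e\<close> the map acts as t + g with slope at least
  1/2, which gives injectivity; boundedness of \<open>g\<close> and the intermediate value theorem
  give surjectivity. The derivative of the inverse is a smooth function evaluated at the inverse, so
  regularity is gained one order at a time.\<close>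

lemma shear_diffeo:
  fixes g :: "real^'n::finite \<Rightarrow> real"
  assumes g: "smooth_on UNIV g" and K: "\<And>x. \<bar>g x\<bar> \<le> M" "\<And>x. \<bar>dd e g x\<bar> \<le> 1 / 2"
  shows "diffeo_on (\<lambda>x. x + g x *\<^sub>R e) (inv (\<lambda>x. x + g x *\<^sub>R e)) UNIV UNIV"
proof -
  let ?\<theta> = "\<lambda>x. x + g x *\<^sub>R e" and ?\<psi> = "inv (\<lambda>x. x + g x *\<^sub>R e)"
  have gd: "g differentiable (at x)" for x by (rule smooth_on_differentiable[OF g UNIV_I])
  have line: "((\<lambda>t. g (y + t *\<^sub>R e)) has_real_derivative dd e g (y + t *\<^sub>R e)) (at t)" for y t
  proof -
    have "((\<lambda>t. y + t *\<^sub>R e) has_derivative (\<lambda>r. r *\<^sub>R e)) (at t)"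
      by (auto intro!: derivative_eq_intros)
    from has_derivative_compose[OF this has_derivative_dd[OF gd]] show ?thesis
      by (simp add: has_field_derivative_def dd_scaleR_left[OF gd] mult_commute_abs)
  qed
  have sm: "smooth_on UNIV ?\<theta>"
    by (intro smooth_on_add smooth_on_scaleR smooth_on_ident smooth_on_const g open_UNIV)
  have inj: "inj ?\<theta>"
  proof (rule injI)
    fix x y assume eq: "x + g x *\<^sub>R e = y + g y *\<^sub>R e"
    define s where "s = g y - g x"
    have x: "x = y + s *\<^sub>R e" using eq by (simp add: s_def algebra_simps)
    have "s = 0"
    proof (rule ccontr)
      assume s: "s \<noteq> 0"
      have l: "((\<lambda>t. g (y + t *\<^sub>R e)) has_derivative (\<lambda>v. dd e g (y + t *\<^sub>R e) * v)) (at t)" for t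
        using line[of y t] by (simp add: has_field_derivative_def)
      have "norm (g (y + s *\<^sub>R e) - g (y + 0 *\<^sub>R e)) \<le> 1 / 2 * norm (s - 0)"
      proof (rule differentiable_bound[of UNIV "\<lambda>t. g (y + t *\<^sub>R e)" "\<lambda>t v. dd e g (y + t *\<^sub>R e) * v"])
        show "onorm ((*) (dd e g (y + t *\<^sub>R e))) \<le> 1 / 2" for t
          using mult_right_mono[OF K(2)[of "y + t *\<^sub>R e"] abs_ge_zero] by (intro onorm_bound) (simp_all add: abs_mult)
        show "((\<lambda>t. g (y + t *\<^sub>R e)) has_derivative (\<lambda>v. dd e g (y + t *\<^sub>R e) * v)) (at t within UNIV)" for t
          by (rule l)
      qed (rule convex_UNIV UNIV_I)+
      then have "\<bar>g x - g y\<bar> \<le> \<bar>s\<bar> / 2" unfolding x[symmetric] by simp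
      then have "\<bar>s\<bar> \<le> \<bar>s\<bar> / 2" by (simp add: s_def abs_minus_commute)
      then show False using s by simp
    qed
    then show "x = y" using x by simp
  qed
  have surj: "surj ?\<theta>"
    unfolding surj_def
  proof
    fix y
    \<comment> \<open>A zero t of \<open>F\<close> yields the preimage y - t e, and the bound M on g
      gives the sign change on [-M, M].\<close>
    define F where "F t = t - g (y - t *\<^sub>R e)" for t
    have M: "M \<ge> 0" using K(1)[of y] by linarith
    have c: "continuous_on {-M..M} F" unfolding F_def
      by (intro continuous_intros continuous_on_compose2[OF smooth_on_continuous_on[OF g]]) auto
    have "F (- M) \<le> 0" "0 \<le> F M" using K(1)[of "y - (-M) *\<^sub>R e"] K(1)[of "y - M *\<^sub>R e"] by (auto simp: F_def)
    then obtain t where "F t = 0" using IVT'[of F "-M" 0 M] c M by auto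
    then have "y = (y - t *\<^sub>R e) + g (y - t *\<^sub>R e) *\<^sub>R e" by (simp add: F_def algebra_simps)
    then show "\<exists>x. y = x + g x *\<^sub>R e" by blast
  qed
  have l: "?\<psi> (?\<theta> x) = x" for x by (rule inv_f_f[OF inj])
  have r: "?\<theta> (?\<psi> x) = x" for x using surj_f_inv_f[OF surj] by simp
  define a where "a x = inverse (1 + dd e g x)" for x
  have nz: "1 + dd e g x \<noteq> 0" for x using K(2)[of x] by auto
  have a: "smooth_on UNIV a" unfolding a_def
    by (intro smooth_on_inverse smooth_on_add smooth_on_const smooth_on_dd g open_UNIV nz)
  \<comment> \<open>The derivative v + dg(v) e is a rank-one perturbation of the identity; its
    inverse subtracts dg(v) / (1 + dg(e)) times e.\<close>
  have der: "(?\<psi> has_derivative (\<lambda>v. v - (dd v g (?\<psi> y) * a (?\<psi> y)) *\<^sub>R e)) (at y)" for y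
  proof -
    let ?x = "?\<psi> y"
    have "(?\<psi> has_derivative (\<lambda>v. v - (dd v g ?x * a ?x) *\<^sub>R e)) (at (?\<theta> ?x))"
    proof (rule has_derivative_inverse_strong[where f = ?\<theta> and f' = "\<lambda>v. v + dd v g ?x *\<^sub>R e", OF open_UNIV UNIV_I])
      show "continuous_on UNIV ?\<theta>" by (rule smooth_on_continuous_on[OF sm])
      show "?\<psi> (?\<theta> x) = x" for x by (rule l)
      show "(?\<theta> has_derivative (\<lambda>v. v + dd v g ?x *\<^sub>R e)) (at ?x)"
        by (intro has_derivative_add has_derivative_ident has_derivative_scaleR_left has_derivative_dd gd)
      have "dd (v - (dd v g ?x * a ?x) *\<^sub>R e) g ?x = dd v g ?x * a ?x" for v
      proof -
        have "dd (v - (dd v g ?x * a ?x) *\<^sub>R e) g ?x = dd v g ?x - (dd v g ?x * a ?x) * dd e g ?x"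
          by (simp add: linear_diff[OF dd_linear[OF gd]] dd_scaleR_left[OF gd])
        also have "\<dots> = dd v g ?x * (1 - a ?x * dd e g ?x)" by (simp add: algebra_simps)
        also have "1 - a ?x * dd e g ?x = a ?x" using nz[of ?x] by (simp add: a_def field_simps)
        finally show ?thesis .
      qed
      then show "(\<lambda>v. v + dd v g ?x *\<^sub>R e) \<circ> (\<lambda>v. v - (dd v g ?x * a ?x) *\<^sub>R e) = id"
        by (simp add: fun_eq_iff)
    qed
    then show ?thesis by (simp add: r)
  qed
  have sm': "Ck_on k UNIV ?\<psi>" for k
  proof (induction k)
    case 0
    have "?\<psi> differentiable (at y)" for y using der by (auto simp: differentiable_def)
    then show ?case by (auto intro!: continuous_at_imp_continuous_on differentiable_imp_continuous_within)
  next
    case (Suc k)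
    have "Ck_on k UNIV (dd v ?\<psi>)" for v
    proof (rule Ck_on_cong[OF open_UNIV])
      have "smooth_on UNIV (\<lambda>x. v - (dd v g x * a x) *\<^sub>R e)"
        by (intro smooth_on_diff smooth_on_scaleR smooth_on_mult smooth_on_const smooth_on_dd g a open_UNIV)
      then show "Ck_on k UNIV (\<lambda>y. v - (dd v g (?\<psi> y) * a (?\<psi> y)) *\<^sub>R e)"
        unfolding smooth_on_def using Ck_on_compose[OF open_UNIV open_UNIV UNIV_I _ Suc] by blast
    qed (simp add: dd_eqI[OF der])
    then show ?case using der by (auto simp: Ck_on_Suc differentiable_def)
  qed
  show ?thesis unfolding diffeo_on_def using sm sm' l r by (simp add: smooth_on_def)
qed


section \<open>Vanishing to finite order\<close>

text \<open>The number \<open>k\<close> counts orders including order zero: iterated derivatives of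
  order less than \<open>k\<close> are zero at the point. An operator of order 3 therefore does not
  see functions with k = 4.\<close>

primrec vanishes :: "nat \<Rightarrow> 'a::real_normed_vector \<Rightarrow> ('a \<Rightarrow> 'b::real_normed_vector) \<Rightarrow> bool" where
  "vanishes 0 w f \<longleftrightarrow> True"
| "vanishes (Suc k) w f \<longleftrightarrow> f w = 0 \<and> (\<forall>v. vanishes k w (dd v f))"

lemma vanishes_cong:
  assumes "open U" "w \<in> U" "\<And>y. y \<in> U \<Longrightarrow> f y = g y" "vanishes k w f"
  shows "vanishes k w g"
  using assms(3,4)
proof (induction k arbitrary: f g)
  case (Suc k)
  have "vanishes k w (dd v g)" for v
    by (rule Suc.IH[of "dd v f"]) (use Suc.prems dd_cong[OF assms(1) _ Suc.prems(1)] in auto)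
  then show ?case using Suc.prems assms(2) by auto
qed simp

lemma vanishes_Suc: "vanishes (Suc k) w f \<Longrightarrow> vanishes k w f"
  by (induction k arbitrary: f) auto

lemma vanishes_zero: "vanishes k w (\<lambda>x. 0)"
  by (induction k) auto

lemma vanishes_add:
  assumes "open U" "w \<in> U"
  shows "smooth_on U f \<Longrightarrow> smooth_on U g \<Longrightarrow> vanishes k w f \<Longrightarrow> vanishes k w g \<Longrightarrow> vanishes k w (\<lambda>x. f x + g x)"
proof (induction k arbitrary: f g)
  case (Suc k)
  have "vanishes k w (dd v (\<lambda>x. f x + g x))" for v
  proof (rule vanishes_cong[OF assms])
    show "vanishes k w (\<lambda>x. dd v f x + dd v g x)"
      by (rule Suc.IH) (use Suc.prems in \<open>auto intro: smooth_on_dd\<close>)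
    show "dd v f y + dd v g y = dd v (\<lambda>x. f x + g x) y" if "y \<in> U" for y
      using dd_add[of f y g v] smooth_on_differentiable[OF Suc.prems(1) that] smooth_on_differentiable[OF Suc.prems(2) that] by simp
  qed
  then show ?case using Suc.prems by auto
qed simp

lemma vanishes_sum:
  assumes "open U" "w \<in> U" "\<And>i. i \<in> I \<Longrightarrow> smooth_on U (f i)" "\<And>i. i \<in> I \<Longrightarrow> vanishes k w (f i)"
  shows "vanishes k w (\<lambda>x. \<Sum>i\<in>I. f i x)"
  using assms(3,4)
  by (induction I rule: infinite_finite_induct)
    (auto intro!: vanishes_zero vanishes_add[OF assms(1,2)] smooth_on_sum[OF assms(1)])

text \<open>The Leibniz rule by induction on the total order, since a derivative may lower the order
  of either factor.\<close>

lemma vanishes_mult: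
  fixes f g :: "'a::real_normed_vector \<Rightarrow> real"
  assumes "open U" "w \<in> U"
  shows "smooth_on U f \<Longrightarrow> smooth_on U g \<Longrightarrow> vanishes k w f \<Longrightarrow> vanishes l w g \<Longrightarrow> vanishes (k + l) w (\<lambda>x. f x * g x)"
proof (induction "k + l" arbitrary: k l f g)
  case (Suc n)
  note sm = smooth_on_dd[OF Suc.prems(1)] smooth_on_dd[OF Suc.prems(2)]
  have v1: "vanishes n w (\<lambda>x. dd v f x * g x)" for v
  proof (cases k)
    \<comment> \<open>With k = 0 nothing is lost by differentiating \<open>f\<close>; the order of
      \<open>g\<close> is weakened by one to match \<open>n\<close>.\<close>
    case 0
    then obtain l' where "l = Suc l'" "n = 0 + l'" using Suc.hyps(2) by auto
    moreover have "vanishes l' w g" using vanishes_Suc Suc.prems(4) \<open>l = Suc l'\<close> by blast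
    ultimately show ?thesis using Suc.hyps(1)[of 0 l' "dd v f" g] Suc.prems sm by simp
  next
    case (Suc k')
    then have "n = k' + l" using Suc.hyps(2) by simp
    then show ?thesis using Suc.hyps(1)[of k' l "dd v f" g] Suc.prems sm \<open>k = Suc k'\<close> by auto
  qed
  have v2: "vanishes n w (\<lambda>x. f x * dd v g x)" for v
  proof (cases l)
    case 0
    then obtain k' where "k = Suc k'" "n = k' + 0" using Suc.hyps(2) by auto
    moreover have "vanishes k' w f" using vanishes_Suc Suc.prems(3) \<open>k = Suc k'\<close> by blast
    ultimately show ?thesis using Suc.hyps(1)[of k' 0 f "dd v g"] Suc.prems sm by simp
  next
    case (Suc l')
    then have "n = k + l'" using Suc.hyps(2) by simp
    then show ?thesis using Suc.hyps(1)[of k l' f "dd v g"] Suc.prems sm \<open>l = Suc l'\<close> by auto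
  qed
  have "vanishes n w (dd v (\<lambda>x. f x * g x))" for v
  proof (rule vanishes_cong[OF assms])
    show "vanishes n w (\<lambda>x. dd v f x * g x + f x * dd v g x)"
      by (rule vanishes_add[OF assms _ _ v1 v2]; rule smooth_on_mult[OF assms(1)]; fact)
    show "dd v f y * g y + f y * dd v g y = dd v (\<lambda>x. f x * g x) y" if "y \<in> U" for y
      using dd_mult[of f y g v] smooth_on_differentiable[OF Suc.prems(1) that] smooth_on_differentiable[OF Suc.prems(2) that] by simp
  qed
  moreover have "f w * g w = 0"
  proof (cases k)
    case 0
    then show ?thesis using Suc.hyps(2) Suc.prems(4) by (cases l) auto
  next
    case (Suc k')
    then show ?thesis using Suc.prems(3) by auto
  qed
  ultimately show ?case unfolding Suc.hyps(2)[symmetric] by simp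
qed simp

text \<open>\<open>foldr\<close> applies the last index of the list first, so the induction removes
  indices from the end.\<close>

lemma vanishes_foldr_partial:
  assumes "vanishes k w f" "length is < k"
  shows "foldr partial is f w = 0"
  using assms
proof (induction "is" arbitrary: k f rule: rev_induct)
  case Nil
  then show ?case by (cases k) auto
next
  case (snoc i "is")
  then obtain k' where "k = Suc k'" by (cases k) auto
  then show ?case using snoc by (auto simp: partial_dd)
qed

lemma foldr_partial_diff:
  fixes f g :: "real^'m::finite \<Rightarrow> real"
  assumes "open U" "w \<in> U" "smooth_on U f" "smooth_on U g"
  shows "foldr partial is (\<lambda>x. f x - g x) w = foldr partial is f w - foldr partial is g w"
  using assms(2)
proof (induction "is" arbitrary: w)
  case (Cons i "is")
  have "dd v (foldr partial is (\<lambda>x. f x - g x)) w = dd v (\<lambda>w. foldr partial is f w - foldr partial is g w) w" for v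
    by (rule dd_cong[OF assms(1) Cons.prems Cons.IH])
  then have "partial i (foldr partial is (\<lambda>x. f x - g x)) w = partial i (foldr partial is f) w - partial i (foldr partial is g) w"
    unfolding partial_dd[of i]
    by (simp add: dd_diff smooth_on_differentiable[OF smooth_on_foldr_partial Cons.prems] assms)
  then show ?case by simp
qed simp


section \<open>Non-triviality\<close>

context manifold
begin

definition chart_ext :: "('a, 'n) chart \<Rightarrow> (real^'n \<Rightarrow> real^'n) \<Rightarrow> 'a \<Rightarrow> 'a" where
  "chart_ext c \<theta> x = (if x \<in> fst c then chart_inv c (\<theta> (snd c x)) else x)"

text \<open>The Hausdorff property enters here: the image of the ball is compact, hence closed, and
  its complement is an open set on which extended maps are trivial.\<close>

lemma closed_chart_cball:
  assumes "c \<in> A" "cball u0 r \<subseteq> snd c ` fst c"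
  shows "closed (chart_inv c ` cball u0 r)" "chart_inv c ` cball u0 r \<subseteq> fst c"
proof -
  have "continuous_on (cball u0 r) (chart_inv c)"
    using homeomorphism_cont2[OF chart_homeo[OF assms(1)]] assms(2) continuous_on_subset by blast
  then show "closed (chart_inv c ` cball u0 r)"
    by (intro compact_imp_closed compact_continuous_image compact_cball)
  show "chart_inv c ` cball u0 r \<subseteq> fst c" using chart_inv_in[OF assms(1)] assms(2) by blast
qed

text \<open>Two open sets cover the manifold: the chart domain, where the map is \<theta> in
  coordinates, and the complement of the compact ball, where it is the identity.\<close>

lemma chart_ext_smooth_map:
  assumes c: "c \<in> A" and r: "cball u0 r \<subseteq> snd c ` fst c" and \<theta>: "smooth_on UNIV \<theta>"
    and out: "\<And>x. x \<notin> cball u0 r \<Longrightarrow> \<theta> x = x" and inside: "\<And>x. x \<in> cball u0 r \<Longrightarrow> \<theta> x \<in> cball u0 r"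
  shows "smooth_map A (chart_ext c \<theta>)"
proof -
  let ?K = "chart_inv c ` cball u0 r" and ?F = "chart_ext c \<theta>"
  note K = closed_chart_cball[OF c r]
  have U: "\<theta> u \<in> snd c ` fst c" if "u \<in> snd c ` fst c" for u
    using out[of u] inside[of u] r that by (cases "u \<in> cball u0 r") auto
  have Fc: "?F x \<in> fst c" "snd c (?F x) = \<theta> (snd c x)" if "x \<in> fst c" for x
    using U[of "snd c x"] that c chart_inv_in[OF c U] by (auto simp: chart_ext_def)
  have FK: "?F x = x" if "x \<notin> ?K" for x
  proof (cases "x \<in> fst c")
    case True
    then have "snd c x \<notin> cball u0 r" using that c by (metis chart_inv_left imageI)
    then show ?thesis using True c out by (simp add: chart_ext_def)
  qed (simp add: chart_ext_def)
  have "continuous_on (fst c) ?F"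
  proof -
    have "continuous_on (fst c) (\<lambda>x. chart_inv c (\<theta> (snd c x)))"
      using U by (intro continuous_on_compose2[OF homeomorphism_cont2[OF chart_homeo[OF c]]]
          continuous_on_compose2[OF smooth_on_continuous_on[OF \<theta>]] homeomorphism_cont1[OF chart_homeo[OF c]]) auto
    then show ?thesis by (rule continuous_on_eq) (simp add: chart_ext_def)
  qed
  moreover have "continuous_on (- ?K) ?F"
    by (rule continuous_on_eq[OF continuous_on_id]) (simp add: FK)
  ultimately have "continuous_on (fst c \<union> - ?K) ?F"
    using K by (intro continuous_on_open_Un chart_open(1)[OF c]) auto
  moreover have "fst c \<union> - ?K = UNIV" using K(2) by blast
  ultimately have cont: "continuous_on UNIV ?F" by simp
  show ?thesis unfolding smooth_map_def
  proof (intro conjI cont ballI)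
    fix d d' assume d: "d \<in> A" "d' \<in> A"
    show "smooth_on (snd d ` (fst d \<inter> ?F -` fst d')) (local_map ?F d d')"
    proof (rule smooth_on_local)
      fix u assume "u \<in> snd d ` (fst d \<inter> ?F -` fst d')"
      then obtain x where x: "u = snd d x" "x \<in> fst d" "?F x \<in> fst d'" by auto
      show "\<exists>T. open T \<and> u \<in> T \<and> smooth_on T (local_map ?F d d')"
      proof (cases "x \<in> fst c")
        case True
        \<comment> \<open>Near such a point the map factors as the change from d to c, then
          \<theta>, then the change from c to d'.\<close>
        define W where "W = dmn id d c \<inter> dmn ?F d d'"
        have W: "open W" unfolding W_def
          by (intro open_Int open_dmn cont c d) (simp add: continuous_on_id)
        have W1: "local_map id d c v \<in> UNIV" "\<theta> (local_map id d c v) \<in> dmn id c d'"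
          "local_map id c d' (\<theta> (local_map id d c v)) = local_map ?F d d' v" if v: "v \<in> W" for v
        proof -
          let ?y = "chart_inv d v"
          have y: "?y \<in> fst c" "?F ?y \<in> fst d'" using v c d by (auto simp: W_def dmn_iff)
          have e: "\<theta> (local_map id d c v) = snd c (?F ?y)" using Fc(2)[OF y(1)] by (simp add: local_map_def)
          show "\<theta> (local_map id d c v) \<in> dmn id c d'" using y Fc(1)[OF y(1)] c unfolding e by (simp add: dmn_iff)
          show "local_map id c d' (\<theta> (local_map id d c v)) = local_map ?F d d' v"
            unfolding e using Fc(1)[OF y(1)] c by (simp add: local_map_def)
        qed simp
        have s1: "smooth_on W (local_map id d c)"
          by (rule smooth_on_subset[OF DiffD(6)[OF id_Diff d(1) c]]) (simp add: W_def)
        have s2: "smooth_on W (\<lambda>v. \<theta> (local_map id d c v))"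
          by (rule smooth_on_compose[OF W open_UNIV UNIV_I \<theta> s1])
        have "smooth_on W (\<lambda>v. local_map id c d' (\<theta> (local_map id d c v)))"
          by (rule smooth_on_compose[OF W open_dmn[OF continuous_on_id[folded id_def] c d(2)] W1(2) DiffD(6)[OF id_Diff c d(2)] s2])
        then have "smooth_on W (local_map ?F d d')" by (rule smooth_on_cong[OF W]) (rule W1(3))
        moreover have "u \<in> W" using x True d by (simp add: W_def dmn_in)
        ultimately show ?thesis using W by blast
      next
        case False
        \<comment> \<open>Outside the chart domain, hence off the ball, the map is locally the
          identity, whose coordinate expression is a transition map.\<close>
        define W where "W = dmn id d d' \<inter> snd d ` (fst d \<inter> - ?K)"
        have W: "open W" unfolding W_def
          by (intro open_Int open_dmn d open_chart_image chart_open(1)) (use K in \<open>auto simp: continuous_on_id\<close>)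
        have "smooth_on W (local_map id d d')"
          by (rule smooth_on_subset[OF DiffD(6)[OF id_Diff d]]) (simp add: W_def)
        then have "smooth_on W (local_map ?F d d')"
        proof (rule smooth_on_cong[OF W])
          show "local_map id d d' v = local_map ?F d d' v" if "v \<in> W" for v
            using that d FK by (auto simp: W_def local_map_def)
        qed
        moreover have "u \<in> W"
        proof -
          have "x \<notin> ?K" using False K(2) by blast
          then show ?thesis using x FK[of x] d by (auto simp: W_def dmn_def)
        qed
        ultimately show ?thesis using W by blast
      qed
    qed
  qed
qed

lemma chart_ext_Diff:
  assumes c: "c \<in> A" and r: "cball u0 r \<subseteq> snd c ` fst c" and \<theta>: "diffeo_on \<theta> \<psi> UNIV UNIV"
    and out: "\<And>x. x \<notin> cball u0 r \<Longrightarrow> \<theta> x = x"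
  shows "chart_ext c \<theta> \<in> Diff A" "inv (chart_ext c \<theta>) = chart_ext c \<psi>"
    "u \<in> snd c ` fst c \<Longrightarrow> local_map (chart_ext c \<theta>) c c u = \<theta> u"
    "u \<in> snd c ` fst c \<Longrightarrow> local_map (chart_ext c \<psi>) c c u = \<psi> u"
    "dmn (chart_ext c \<theta>) c c = snd c ` fst c"
proof -
  have inv: "\<psi> (\<theta> x) = x" "\<theta> (\<psi> x) = x" for x using \<theta> by (auto simp: diffeo_on_def)
  have out': "\<psi> x = x" if "x \<notin> cball u0 r" for x using inv(1)[of x] out[OF that] by simp
  \<comment> \<open>If \<theta> x lay outside the ball it would be a fixed point, and injectivity
    would give \<theta> x = x, which lies inside.\<close>
  have ins: "\<theta> x \<in> cball u0 r" if "x \<in> cball u0 r" for x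
    using out[of "\<theta> x"] inv(1) that by metis
  have ins': "\<psi> x \<in> cball u0 r" if "x \<in> cball u0 r" for x
    using out'[of "\<psi> x"] inv(2) that by metis
  have U: "\<theta> u \<in> snd c ` fst c" "\<psi> u \<in> snd c ` fst c" if "u \<in> snd c ` fst c" for u
    using out[of u] ins[of u] out'[of u] ins'[of u] r that by (cases "u \<in> cball u0 r"; auto)+
  have comp: "chart_ext c \<psi> (chart_ext c \<theta> x) = x" "chart_ext c \<theta> (chart_ext c \<psi> x) = x" for x
    using U[of "snd c x"] c inv chart_inv_in[OF c] by (auto simp: chart_ext_def)
  then have o: "chart_ext c \<psi> \<circ> chart_ext c \<theta> = id" "chart_ext c \<theta> \<circ> chart_ext c \<psi> = id" by (auto simp: fun_eq_iff)
  show i: "inv (chart_ext c \<theta>) = chart_ext c \<psi>" by (rule inv_unique_comp[OF o(2,1)])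
  have "smooth_on UNIV \<theta>" "smooth_on UNIV \<psi>" using \<theta> by (simp_all add: diffeo_on_def)
  then have "smooth_map A (chart_ext c \<theta>)" "smooth_map A (chart_ext c \<psi>)"
    using chart_ext_smooth_map[OF c r] out out' ins ins' by blast+
  then show "chart_ext c \<theta> \<in> Diff A" unfolding Diff_def using i o_bij[OF o] by simp
  show "local_map (chart_ext c \<theta>) c c u = \<theta> u" if "u \<in> snd c ` fst c" for u
    using that U(1)[OF that] c chart_inv_in[OF c that] by (simp add: local_map_def chart_ext_def)
  show "local_map (chart_ext c \<psi>) c c u = \<psi> u" if "u \<in> snd c ` fst c" for u
    using that U(2)[OF that] c chart_inv_in[OF c that] by (simp add: local_map_def chart_ext_def)
  show "dmn (chart_ext c \<theta>) c c = snd c ` fst c"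
    using U c chart_inv_in[OF c] by (auto simp: dmn_def chart_ext_def)
qed

lemma chart_function_C_inf:
  assumes c: "c \<in> A" and r: "cball u0 r \<subseteq> snd c ` fst c" and q: "smooth_on (cyl (snd c ` fst c)) q"
    and out: "\<And>w. base_part w \<notin> cball u0 r \<Longrightarrow> q w = 0"
  shows "(\<lambda>z. if z \<in> cotangent A \<and> fst z \<in> fst c then q (cot_coord c z) else 0) \<in> C_inf A" (is "?Q \<in> _")
  unfolding C_inf_def mem_Collect_eq
proof (intro conjI ballI allI impI)
  let ?K = "chart_inv c ` cball u0 r"
  note K = closed_chart_cball[OF c r]
  show "?Q z = 0" if "z \<notin> cotangent A" for z using that by simp
  fix d assume d: "d \<in> A"
  show "smooth_on (cot_coord d ` cot_dom A d) (?Q \<circ> cot_inv A d)"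
    unfolding cot_coord_image[OF d]
  proof (rule smooth_on_local)
    fix w assume "w \<in> cyl (snd d ` fst d)"
    then have w: "base_part w \<in> snd d ` fst d" by simp
    let ?x = "chart_inv d (base_part w)"
    show "\<exists>T. open T \<and> w \<in> T \<and> smooth_on T (?Q \<circ> cot_inv A d)"
    proof (cases "?x \<in> fst c")
      case True
      note D = local_diffeo[OF id_Diff d c]
      have sub: "dmn (inv id) c d \<subseteq> snd c ` fst c" by (auto simp: dmn_def)
      have "smooth_on (cyl (dmn (inv id) c d)) q" by (rule smooth_on_subset[OF q]) (use sub in auto)
      then have "smooth_on (cyl (dmn id d c)) (\<lambda>w. q (lct id d c w))" by (rule smooth_on_ctl_compose[OF D])
      then have "smooth_on (cyl (dmn id d c)) (?Q \<circ> cot_inv A d)"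
      proof (rule smooth_on_cong[OF open_cyl[OF diffeo_onD(1)[OF D]]])
        fix v assume v: "v \<in> cyl (dmn id d c)"
        then have b: "base_part v \<in> snd d ` fst d" "chart_inv d (base_part v) \<in> fst c" using d by (auto simp: dmn_iff)
        note I = cot_inv_right[OF d b(1)]
        have "cot_coord c (cot_inv A d v) = lct id d c v"
          using cot_coord_change[OF I(2) d c I(4)] I b by simp
        then show "q (lct id d c v) = (?Q \<circ> cot_inv A d) v" using I b by simp
      qed
      moreover have "w \<in> cyl (dmn id d c)" using True w d by (simp add: dmn_iff)
      ultimately show ?thesis using open_cyl[OF diffeo_onD(1)[OF D]] by blast
    next
      case False
      let ?W = "cyl (snd d ` (fst d \<inter> - ?K))"
      have W: "open ?W"
        by (intro open_cyl open_chart_image d open_Int chart_open(1)) (use K in auto)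
      have "smooth_on ?W (?Q \<circ> cot_inv A d)"
      proof (rule smooth_on_cong[OF W smooth_on_const[of _ 0]])
        fix v assume "v \<in> ?W"
        then obtain y where y: "base_part v = snd d y" "y \<in> fst d" "y \<notin> ?K" by auto
        have b: "base_part v \<in> snd d ` fst d" using y by simp
        have "q (cot_coord c (cot_inv A d v)) = 0" if "y \<in> fst c"
        proof (rule out)
          have "snd c y \<notin> cball u0 r" using y(3) that c by (metis chart_inv_left imageI)
          then show "base_part (cot_coord c (cot_inv A d v)) \<notin> cball u0 r"
            using cot_inv_right(3)[OF d b] y d by simp
        qed
        then show "0 = (?Q \<circ> cot_inv A d) v" using cot_inv_right(3)[OF d b] y d by simp
      qed
      moreover have "w \<in> ?W" using w False K(2) d by (auto intro!: image_eqI[of _ _ ?x])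
      ultimately show ?thesis using W by blast
    qed
  qed
qed

end

lemma vanishes_mult_right:
  fixes f g :: "'a::real_normed_vector \<Rightarrow> real"
  shows "open U \<Longrightarrow> w \<in> U \<Longrightarrow> smooth_on U f \<Longrightarrow> smooth_on U g \<Longrightarrow> vanishes l w g \<Longrightarrow> vanishes l w (\<lambda>x. f x * g x)"
  using vanishes_mult[of U w f g 0 l] by simp

lemma bounded_support:
  fixes f :: "real^'n::finite \<Rightarrow> real"
  assumes "continuous_on UNIV f" "\<And>x. x \<notin> cball u0 r \<Longrightarrow> f x = 0"
  obtains K where "K > 0" "\<And>x. \<bar>f x\<bar> \<le> K"
proof -
  have "bounded (f ` cball u0 r)"
    by (intro compact_imp_bounded compact_continuous_image compact_cball continuous_on_subset[OF assms(1)]) simp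
  then obtain K where K: "K > 0" "\<And>x. x \<in> cball u0 r \<Longrightarrow> \<bar>f x\<bar> \<le> K"
    unfolding bounded_pos by auto
  then have "\<bar>f x\<bar> \<le> K" for x using assms(2)[of x] by (cases "x \<in> cball u0 r") auto
  then show ?thesis using that K(1) by blast
qed

text \<open>The square of a coordinate leaves the value and first derivative at \<open>u0\<close>
  unchanged but not the second derivative; the bump confines the displacement to the chart, and a
  small \<epsilon> keeps the map invertible.\<close>

lemma exists_shear:
  fixes u0 :: "real^'n::finite" and a :: 'n
  assumes r: "r > 0"
  obtains \<epsilon> \<theta> \<psi> where "\<epsilon> > 0" "\<theta> = (\<lambda>x. x + (\<epsilon> * (bump u0 r x * ((x $ a - u0 $ a) * (x $ a - u0 $ a)))) *\<^sub>R axis a 1)"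
    "diffeo_on \<theta> \<psi> UNIV UNIV" "\<And>x. x \<notin> cball u0 r \<Longrightarrow> \<theta> x = x"
    "\<theta> u0 = u0" "\<And>v. dd v \<theta> u0 = v" "dd (axis a 1) (dd (axis a 1) \<theta>) u0 = (2 * \<epsilon> * bump u0 r u0) *\<^sub>R axis a 1"
proof -
  define X where "X x = x $ a - u0 $ a" for x :: "real^'n"
  define \<rho> where "\<rho> x = bump u0 r x * (X x * X x)" for x
  let ?e = "axis a 1 :: real^'n"
  have sX: "smooth_on UNIV X" unfolding X_def
    by (intro smooth_on_diff smooth_on_component smooth_on_ident smooth_on_const open_UNIV)
  have dX: "dd v X x = v $ a" for v x
    unfolding X_def
    by (subst dd_diff) (simp_all add: bounded_linear_imp_differentiable[OF bounded_linear_vec_nth] dd_bounded_linear[OF bounded_linear_vec_nth])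
  note sb = smooth_on_bump[of u0 r]
  have s\<rho>: "smooth_on UNIV \<rho>" unfolding \<rho>_def by (intro smooth_on_mult sX sb open_UNIV)
  have X0: "vanishes 1 u0 X" by (simp add: X_def)
  have XX: "vanishes 2 u0 (\<lambda>x. X x * X x)"
    using vanishes_mult[OF open_UNIV UNIV_I sX sX X0 X0] by (simp add: numeral_2_eq_2)
  have \<rho>2: "vanishes 2 u0 \<rho>" unfolding \<rho>_def
    by (rule vanishes_mult_right[OF open_UNIV UNIV_I sb smooth_on_mult[OF open_UNIV sX sX] XX])
  have \<rho>0: "\<rho> u0 = 0" "dd v \<rho> u0 = 0" for v using \<rho>2 by (simp_all add: numeral_2_eq_2)
  have d: "X differentiable (at x)" "bump u0 r differentiable (at x)" "dd v (bump u0 r) differentiable (at x)" "\<rho> differentiable (at x)"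
    "dd v \<rho> differentiable (at x)" for x v
    using smooth_on_differentiable[OF _ UNIV_I] sX sb s\<rho> smooth_on_dd by blast+
  have d2: "(\<lambda>x. X x * X x) differentiable (at x)" for x
    by (rule smooth_on_differentiable[OF smooth_on_mult[OF open_UNIV sX sX] UNIV_I])
  have e1: "dd ?e \<rho> = (\<lambda>x. dd ?e (bump u0 r) x * (X x * X x) + (2 * bump u0 r x) * X x)"
    unfolding \<rho>_def by (rule ext) (simp add: dd_mult[OF d(2) d2] dd_mult[OF d(1) d(1)] dX)
  have \<rho>'': "dd ?e (dd ?e \<rho>) u0 = 2 * bump u0 r u0"
  proof -
    have "vanishes 2 u0 (\<lambda>x. dd ?e (bump u0 r) x * (X x * X x))"
      by (rule vanishes_mult_right[OF open_UNIV UNIV_I smooth_on_dd[OF sb] smooth_on_mult[OF open_UNIV sX sX] XX])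
    then have 1: "dd ?e (\<lambda>x. dd ?e (bump u0 r) x * (X x * X x)) u0 = 0" by (simp add: numeral_2_eq_2)
    have b2: "(\<lambda>x. 2 * bump u0 r x) differentiable (at x)" for x
      by (rule smooth_on_differentiable[OF smooth_on_mult[OF open_UNIV smooth_on_const sb] UNIV_I])
    have 2: "dd ?e (\<lambda>x. (2 * bump u0 r x) * X x) u0 = 2 * bump u0 r u0"
      by (subst dd_mult[OF b2 d(1)]) (simp add: dX X_def)
    show ?thesis unfolding e1
      by (subst dd_add) (simp_all add: 1 2 differentiable_bilinear[OF bounded_bilinear_mult] d d2 b2)
  qed
  have out: "\<rho> x = 0" if "x \<notin> cball u0 r" for x using bump_outside[OF that r] by (simp add: \<rho>_def)
  have out': "dd ?e \<rho> x = 0" if "x \<notin> cball u0 r" for x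
  proof -
    have "dd ?e \<rho> x = dd ?e (\<lambda>x. 0) x"
      by (rule dd_cong[of "- cball u0 r"]) (use that out in auto)
    then show ?thesis by simp
  qed
  obtain K1 where K1: "K1 > 0" "\<And>x. \<bar>\<rho> x\<bar> \<le> K1"
    using bounded_support[OF smooth_on_continuous_on[OF s\<rho>] out] by blast
  obtain K2 where K2: "K2 > 0" "\<And>x. \<bar>dd ?e \<rho> x\<bar> \<le> K2"
    using bounded_support[OF smooth_on_continuous_on[OF smooth_on_dd[OF s\<rho>]] out'] by blast
  \<comment> \<open>Half the inverse of a bound on the derivative of \<rho> along the shear, so that
    the slope of \<open>g\<close> stays within 1/2.\<close>
  define \<epsilon> where "\<epsilon> = 1 / (2 * K2)"
  have \<epsilon>: "\<epsilon> > 0" using K2 by (simp add: \<epsilon>_def)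
  define g where "g x = \<epsilon> * \<rho> x" for x
  have sg: "smooth_on UNIV g" unfolding g_def by (intro smooth_on_mult smooth_on_const s\<rho> open_UNIV)
  have dg: "dd v g = (\<lambda>x. \<epsilon> * dd v \<rho> x)" for v
    unfolding g_def by (rule ext) (rule dd_linear_compose[OF bounded_linear_mult_right d(4)])
  have gb: "\<bar>g x\<bar> \<le> \<epsilon> * K1" "\<bar>dd ?e g x\<bar> \<le> 1 / 2" for x
  proof -
    show "\<bar>g x\<bar> \<le> \<epsilon> * K1" using K1(2)[of x] \<epsilon> by (simp add: g_def abs_mult)
    have "\<bar>dd ?e g x\<bar> \<le> \<epsilon> * K2" using K2(2)[of x] \<epsilon> by (simp add: dg abs_mult)
    also have "\<epsilon> * K2 = 1 / 2" using K2(1) by (simp add: \<epsilon>_def)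
    finally show "\<bar>dd ?e g x\<bar> \<le> 1 / 2" .
  qed
  define \<theta> where "\<theta> = (\<lambda>x. x + g x *\<^sub>R ?e)"
  have gd: "g differentiable (at x)" "dd v g differentiable (at x)" for x v
    using smooth_on_differentiable[OF _ UNIV_I] sg smooth_on_dd by blast+
  have sc: "bounded_linear (\<lambda>s. s *\<^sub>R ?e)" by (rule bounded_linear_scaleR_left)
  have gde: "(\<lambda>x. g x *\<^sub>R ?e) differentiable (at x)" "(\<lambda>x. dd v g x *\<^sub>R ?e) differentiable (at x)" for x v
    by (rule differentiable_bilinear[OF bounded_bilinear_scaleR]; simp add: gd)+
  have d\<theta>: "dd v \<theta> = (\<lambda>x. v + dd v g x *\<^sub>R ?e)" for v
    unfolding \<theta>_def
    by (rule ext, subst dd_add) (simp_all add: gde dd_linear_compose[OF sc gd(1)] dd_bounded_linear[OF bounded_linear_ident])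
  show ?thesis
  proof (rule that[OF \<epsilon>])
    show "\<theta> = (\<lambda>x. x + (\<epsilon> * (bump u0 r x * ((x $ a - u0 $ a) * (x $ a - u0 $ a)))) *\<^sub>R axis a 1)"
      by (simp add: \<theta>_def g_def \<rho>_def X_def)
    show "diffeo_on \<theta> (inv \<theta>) UNIV UNIV" unfolding \<theta>_def by (rule shear_diffeo[OF sg gb])
    show "\<theta> x = x" if "x \<notin> cball u0 r" for x using out[OF that] by (simp add: \<theta>_def g_def)
    show "\<theta> u0 = u0" by (simp add: \<theta>_def g_def \<rho>0)
    show "dd v \<theta> u0 = v" for v by (simp add: d\<theta> dg \<rho>0)
    have "dd ?e (dd ?e \<theta>) u0 = dd ?e (dd ?e g) u0 *\<^sub>R ?e"
      unfolding d\<theta> by (subst dd_add) (simp_all add: gde dd_linear_compose[OF sc gd(2)])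
    also have "dd ?e (dd ?e g) u0 = \<epsilon> * dd ?e (dd ?e \<rho>) u0"
      unfolding dg by (rule dd_linear_compose[OF bounded_linear_mult_right d(5)])
    finally show "dd ?e (dd ?e \<theta>) u0 = (2 * \<epsilon> * bump u0 r u0) *\<^sub>R ?e"
      by (simp add: \<rho>'' mult_ac)
  qed
qed


context manifold_with_connection
begin

text \<open>With Q' the composite of Q with the lift of F, the coboundary equation for
  \<open>inv F\<close> reads L(F) Q' = B Q - B Q' at the fixed point \<open>z0\<close>. Both B and
  L(F) have order at most 3 and cannot tell Q' from Q there, so L(F) Q would vanish at
  \<open>z0\<close>.\<close>

theorem L_op_nontrivial: "\<not> trivial_cocycle A 3 (\<lambda>f. L_op A G (inv f))"
proof
  assume "trivial_cocycle A 3 (\<lambda>f. L_op A G (inv f))"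
  then obtain B where B: "B \<in> diff_ops A 3"
    and eq: "\<And>f Q z. f \<in> Diff A \<Longrightarrow> Q \<in> C_inf A \<Longrightarrow> z \<in> cotangent A \<Longrightarrow> L_op A G (inv f) Q z = act_op A f B Q z - B Q z"
    unfolding trivial_cocycle_def by blast
  \<comment> \<open>Any point, and below any coordinate direction, will do; types are inhabited, so
    \<open>undefined\<close> names one.\<close>
  define x0 :: 'a where "x0 = undefined"
  define c where "c = chart_at A x0"
  define u0 where "u0 = snd c x0"
  define a :: 'n where "a = undefined"
  let ?e = "axis a 1 :: real^'n"
  have c: "c \<in> A" "x0 \<in> fst c" unfolding c_def by (rule chart_at)+
  have u0: "u0 \<in> snd c ` fst c" using c by (simp add: u0_def)
  obtain r where r: "r > 0" "cball u0 r \<subseteq> snd c ` fst c"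
    using open_contains_cball[of "snd c ` fst c"] chart_open(2)[OF c(1)] u0 by blast
  let ?\<chi> = "bump u0 r"
  obtain \<epsilon> \<theta> \<psi> where \<epsilon>: "\<epsilon> > 0"
    and \<theta>: "\<theta> = (\<lambda>x. x + (\<epsilon> * (?\<chi> x * ((x $ a - u0 $ a) * (x $ a - u0 $ a)))) *\<^sub>R ?e)"
    and diff: "diffeo_on \<theta> \<psi> UNIV UNIV" and out: "\<And>x. x \<notin> cball u0 r \<Longrightarrow> \<theta> x = x"
    and \<theta>0: "\<theta> u0 = u0" and d\<theta>: "\<And>v. dd v \<theta> u0 = v" and dd\<theta>: "dd ?e (dd ?e \<theta>) u0 = (2 * \<epsilon> * ?\<chi> u0) *\<^sub>R ?e"
    using exists_shear[OF r(1)] by blast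
  note D = diffeo_onD[OF diff]
  have d\<psi>: "dd v \<psi> u0 = v" for v using dd_inverse[OF diff UNIV_I, of v u0] by (simp add: d\<theta> \<theta>0)
  define F where "F = chart_ext c \<theta>"
  have cx: "F \<in> Diff A" "inv F = chart_ext c \<psi>"
    "u \<in> snd c ` fst c \<Longrightarrow> local_map F c c u = \<theta> u"
    "u \<in> snd c ` fst c \<Longrightarrow> local_map (chart_ext c \<psi>) c c u = \<psi> u"
    "dmn F c c = snd c ` fst c" for u
    unfolding F_def by (rule chart_ext_Diff[OF c(1) r(2) diff]; (erule out | assumption))+
  have F: "F \<in> Diff A" by (rule cx(1))
  let ?S = "snd c ` fst c"
  let ?U = "cyl ?S"
  have oS: "open ?S" by (rule chart_open(2)[OF c(1)])
  have oU: "open ?U" by (rule open_cyl[OF oS])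
  have DF: "diffeo_on (local_map F c c) (local_map (inv F) c c) ?S (dmn (inv F) c c)"
    using local_diffeo[OF F c(1) c(1)] unfolding cx(5) .
  \<comment> \<open>The zero covector over \<open>u0\<close>: it is fixed by the lift of a map that
    fixes the base point, and coefficients linear in \<xi> vanish at it.\<close>
  define w0 where "w0 = bvec u0"
  have w0: "base_part w0 = u0" "fibre_part w0 = 0" "w0 \<in> ?U" using u0 by (simp_all add: w0_def)
  obtain z0 where z0: "z0 \<in> cotangent A" "fst z0 = x0" "cot_coord c z0 = w0"
    using cot_coord_surj[OF c] w0(1) u0_def by blast
  have z0c: "fst z0 \<in> fst c" "z0 \<in> cot_dom A c" using z0 c by (simp_all add: cot_dom_def)
  have lct0: "lct F c c w0 = w0"
  proof (rule base_fibre_eqI)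
    show "base_part (lct F c c w0) = base_part w0" using u0 by (simp add: w0 cx(3) \<theta>0)
    show "fibre_part (lct F c c w0) = fibre_part w0"
      by (simp add: vec_eq_iff fibre_ctl_component w0)
  qed
  have F0: "F x0 = x0" using c \<theta>0 by (simp add: F_def chart_ext_def u0_def)
  have lift0: "cot_lift A F z0 = z0"
  proof (rule cotangent_eqI[OF cot_lift_cotangent[OF F z0(1)] z0(1) c(1)])
    show "fst (cot_lift A F z0) \<in> fst c" "fst (cot_lift A F z0) = fst z0" using F0 z0 c by simp_all
    show "cot_coord c (cot_lift A F z0) = cot_coord c z0"
      using cot_lift_coord[OF F z0(1) c(1) c(1) z0c(1)] F0 z0 c lct0 by simp
  qed

  define X where "X w = base_part w $ a - u0 $ a" for w :: "real^('n + 'n)"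
  define Y where "Y w = fibre_part w $ a" for w :: "real^('n + 'n)"
  define b where "b w = ?\<chi> (base_part w)" for w :: "real^('n + 'n)"
  \<comment> \<open>The cubic test function, multiplied by a bump in the base variables so that it
    extends by zero to the bundle.\<close>
  define qf where "qf w = b w * (X w * (Y w * Y w))" for w
  have UU: "open (UNIV :: (real^('n + 'n)) set)" by simp
  have sX: "smooth_on UNIV X" unfolding X_def
    by (intro smooth_on_diff smooth_on_component smooth_on_base smooth_on_const open_UNIV)
  have sY: "smooth_on UNIV Y" unfolding Y_def
    by (intro smooth_on_component smooth_on_fibre open_UNIV)
  have sb: "smooth_on UNIV b" unfolding b_def
    by (rule smooth_on_compose[OF UU open_UNIV UNIV_I smooth_on_bump smooth_on_base])
  have sq: "smooth_on UNIV qf" unfolding qf_def by (intro smooth_on_mult sX sY sb open_UNIV)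
  define Q where "Q z = (if z \<in> cotangent A \<and> fst z \<in> fst c then qf (cot_coord c z) else 0)" for z
  have Q: "Q \<in> C_inf A" unfolding Q_def
    by (rule chart_function_C_inf[OF c(1) r(2) smooth_on_subset[OF sq subset_UNIV]])
      (simp add: qf_def b_def bump_outside[OF _ r(1)])
  define Q' where "Q' = act_fun A (inv F) Q"
  have Q': "Q' \<in> C_inf A" unfolding Q'_def by (rule act_fun_C_inf[OF inv_Diff[OF F] Q])
  have QQ': "act_fun A F Q' = Q"
  proof
    fix z show "act_fun A F Q' z = Q z"
    proof (cases "z \<in> cotangent A")
      case True
      then have "act_fun A F Q' z = Q' (cot_lift A (inv F) z)" by (rule act_fun_eq[OF F])
      also have "\<dots> = Q (cot_lift A F (cot_lift A (inv F) z))"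
        unfolding Q'_def by (rule act_inv_eq[OF F cot_lift_cotangent[OF inv_Diff[OF F] True]])
      also have "\<dots> = Q z" by (simp add: cot_lift_inv(2)[OF F True])
      finally show ?thesis .
    next
      case False
      then show ?thesis by (simp add: act_fun_def Q_def)
    qed
  qed
  \<comment> \<open>Conjugation turns Q' back into Q before B is applied, and the fixed point
    removes the outer composition.\<close>
  have act: "act_op A (inv F) B Q' z0 = B Q z0"
    unfolding act_op_def o_def DiffD(5)[OF F] QQ' using act_inv_eq[OF F z0(1)] lift0 by simp
  let ?q = "Q \<circ> cot_inv A c" and ?q' = "Q' \<circ> cot_inv A c"
  have q: "?q w = qf w" if "w \<in> ?U" for w
    using cot_inv_right[OF c(1), of w] that by (simp add: Q_def)
  have q': "?q' w = qf (lct F c c w)" if "w \<in> ?U" for w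
  proof -
    have w: "base_part w \<in> ?S" "w \<in> cyl (dmn F c c)" using that by (simp_all add: cx(5))
    have l: "lct F c c w \<in> ?U" using diffeo_onD(5)[OF diffeo_on_ctl[OF DF] that] by (auto simp: dmn_def)
    have "?q' w = Q (cot_lift A F (cot_inv A c w))"
      using act_inv_eq[OF F cot_inv_right(2)[OF c(1) w(1)]] by (simp add: Q'_def)
    also have "\<dots> = ?q (lct F c c w)" using cot_inv_lct[OF F c(1) c(1) w(2)] by simp
    also have "\<dots> = qf (lct F c c w)" by (rule q[OF l])
    finally show ?thesis .
  qed

  \<comment> \<open>The difference of the two functions is telescoped over the bump, the base factor
    and the two fibre factors; each summand vanishes to total order 4.\<close>
  have jets: "foldr partial is ?q' w0 = foldr partial is ?q w0" if len: "length is \<le> 3" for "is"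
  proof -
    let ?\<Phi> = "lct F c c"
    have s\<Phi>: "smooth_on ?U ?\<Phi>" by (rule diffeo_onD(3)[OF diffeo_on_ctl[OF DF]])
    have on: "smooth_on ?U f" if "smooth_on UNIV f" for f :: "real^('n + 'n) \<Rightarrow> real"
      by (rule smooth_on_subset[OF that]) simp
    define Y' where "Y' w = fibre_part (?\<Phi> w) $ a" for w
    define X' where "X' w = X (?\<Phi> w)" for w
    define b' where "b' w = b (?\<Phi> w)" for w
    have sY': "smooth_on ?U Y'" unfolding Y'_def
      by (rule smooth_on_component[OF oU smooth_on_linear_compose[OF bounded_linear_fibre_part oU s\<Phi>]])
    have sX': "smooth_on ?U X'" unfolding X'_def by (rule smooth_on_compose[OF oU UU UNIV_I sX s\<Phi>])
    have sb': "smooth_on ?U b'" unfolding b'_def by (rule smooth_on_compose[OF oU UU UNIV_I sb s\<Phi>])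
    note sm = on[OF sX] on[OF sY] on[OF sb] sY' sX' sb' oU w0(3)
    have one: "vanishes 1 w0 f \<longleftrightarrow> f w0 = 0" for f :: "real^('n + 'n) \<Rightarrow> real" by simp
    have vX: "vanishes 1 w0 X" unfolding one by (simp add: X_def w0)
    have vY: "vanishes 1 w0 Y" unfolding one by (simp add: Y_def w0)
    have vX': "vanishes 1 w0 X'" unfolding one by (simp add: X'_def lct0 X_def w0)
    have vY': "vanishes 1 w0 Y'" unfolding one by (simp add: Y'_def lct0 w0)
    have vb: "vanishes 1 w0 (\<lambda>w. b' w - b w)" unfolding one by (simp add: b'_def lct0)
    have vYY: "vanishes 1 w0 (\<lambda>w. Y' w + Y w)" unfolding one by (simp add: Y'_def Y_def lct0 w0)
    have vm: "vanishes (k + l) w0 (\<lambda>w. f w * g w)" if "smooth_on ?U f" "smooth_on ?U g" "vanishes k w0 f" "vanishes l w0 g"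
      for k l and f g :: "real^('n + 'n) \<Rightarrow> real"
      by (rule vanishes_mult[OF oU w0(3) that])
    \<comment> \<open>The displacement of the shear is quadratic in X.\<close>
    have vX2: "vanishes 2 w0 (\<lambda>w. X' w - X w)"
    proof (rule vanishes_cong[OF oU w0(3)])
      show "(\<epsilon> * b w) * (X w * X w) = X' w - X w" if "w \<in> ?U" for w
      proof -
        have "base_part (?\<Phi> w) = \<theta> (base_part w)" using that by (simp add: cx(3))
        then show ?thesis by (simp add: X'_def X_def \<theta> b_def)
      qed
      have "vanishes (1 + 1) w0 (\<lambda>w. X w * X w)" by (rule vm[OF sm(1,1) vX vX])
      then have XX: "vanishes 2 w0 (\<lambda>w. X w * X w)" by (simp only: one_add_one)
      show "vanishes 2 w0 (\<lambda>w. (\<epsilon> * b w) * (X w * X w))"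
        by (rule vanishes_mult_right[OF oU w0(3) _ _ XX]; intro smooth_on_mult smooth_on_const sm)
    qed
    \<comment> \<open>The fibre coordinate changes by \<xi> applied to d\<psi> - 1; one factor
      vanishes at the zero covector, the other because d\<psi> is the identity at
      \<open>u0\<close>.\<close>
    have vY2: "vanishes 2 w0 (\<lambda>w. Y' w - Y w)"
    proof (rule vanishes_cong[OF oU w0(3)])
      let ?n = "\<lambda>k w. dd ?e \<psi> (\<theta> (base_part w)) $ k - ?e $ k"
      show "(\<Sum>k\<in>UNIV. fibre_part w $ k * ?n k w) = Y' w - Y w" if w: "w \<in> ?U" for w
      proof -
        let ?y = "local_map F c c (base_part w)"
        have y: "?y = \<theta> (base_part w)" using w by (simp add: cx(3))
        have yS: "?y \<in> ?S" using diffeo_onD(5)[OF DF] w by (auto simp: dmn_def)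
        have "dd ?e (local_map (inv F) c c) ?y = dd ?e \<psi> ?y"
          by (rule dd_cong[OF oS yS]) (simp add: cx(2) cx(4))
        then have "Y' w = fibre_part w \<bullet> dd ?e \<psi> (\<theta> (base_part w))"
          by (simp add: Y'_def fibre_ctl_component y)
        then show ?thesis
          using inner_axis_vec(1)[of "fibre_part w" a]
          by (simp add: Y_def inner_vec_def right_diff_distrib sum_subtractf)
      qed
      have s1: "smooth_on ?U (\<lambda>w. fibre_part w $ k)" for k
        by (rule smooth_on_component[OF oU smooth_on_fibre])
      have s2: "smooth_on ?U (?n k)" for k
      proof -
        have "smooth_on UNIV (\<lambda>x. dd ?e \<psi> (\<theta> x))"
          by (rule smooth_on_compose[OF D(1,2) UNIV_I smooth_on_dd[OF D(4)] D(3)])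
        from smooth_on_cyl[OF oS smooth_on_subset[OF smooth_on_component[OF open_UNIV this, of k] subset_UNIV]]
        show ?thesis by (intro smooth_on_diff smooth_on_const oU)
      qed
      have "vanishes (1 + 1) w0 (\<lambda>w. fibre_part w $ k * ?n k w)" for k
        by (rule vm[OF s1 s2]) (simp_all add: w0 \<theta>0 d\<psi>)
      then have "vanishes 2 w0 (\<lambda>w. fibre_part w $ k * ?n k w)" for k by (simp only: one_add_one)
      then show "vanishes 2 w0 (\<lambda>w. \<Sum>k\<in>UNIV. fibre_part w $ k * ?n k w)"
        by (intro vanishes_sum[OF oU w0(3)] smooth_on_mult[OF oU] s1 s2)
    qed
    have "vanishes 4 w0 (\<lambda>w. ?q' w - ?q w)"
    proof (rule vanishes_cong[OF oU w0(3)])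
      show "(b' w - b w) * (X' w * (Y' w * Y' w)) + b w * ((X' w - X w) * (Y' w * Y' w) + X w * ((Y' w - Y w) * (Y' w + Y w)))
        = ?q' w - ?q w" if "w \<in> ?U" for w
        unfolding q[OF that] q'[OF that] by (simp add: qf_def b'_def X'_def Y'_def Y_def algebra_simps)
      have A: "vanishes (1 + (1 + (1 + 1))) w0 (\<lambda>w. (b' w - b w) * (X' w * (Y' w * Y' w)))"
        by (intro vm smooth_on_mult smooth_on_diff sm vb vX' vY')
      have B: "vanishes (2 + (1 + 1)) w0 (\<lambda>w. (X' w - X w) * (Y' w * Y' w))"
        by (intro vm smooth_on_mult smooth_on_diff sm vX2 vY')
      have C: "vanishes (1 + (2 + 1)) w0 (\<lambda>w. X w * ((Y' w - Y w) * (Y' w + Y w)))"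
        by (intro vm smooth_on_mult smooth_on_diff smooth_on_add sm vX vY2 vYY)
      have A4: "vanishes 4 w0 (\<lambda>w. (b' w - b w) * (X' w * (Y' w * Y' w)))" using A by (simp add: numeral_eq_Suc del: vanishes.simps)
      have B4: "vanishes 4 w0 (\<lambda>w. (X' w - X w) * (Y' w * Y' w))" using B by (simp add: numeral_eq_Suc del: vanishes.simps)
      have C4: "vanishes 4 w0 (\<lambda>w. X w * ((Y' w - Y w) * (Y' w + Y w)))" using C by (simp add: numeral_eq_Suc del: vanishes.simps)
      have BC: "vanishes 4 w0 (\<lambda>w. (X' w - X w) * (Y' w * Y' w) + X w * ((Y' w - Y w) * (Y' w + Y w)))"
        by (rule vanishes_add[OF oU w0(3) _ _ B4 C4]; intro smooth_on_mult smooth_on_diff smooth_on_add sm)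
      have "vanishes 4 w0 (\<lambda>w. b w * ((X' w - X w) * (Y' w * Y' w) + X w * ((Y' w - Y w) * (Y' w + Y w))))"
        by (rule vanishes_mult_right[OF oU w0(3) _ _ BC]; intro smooth_on_mult smooth_on_diff smooth_on_add sm)
      then show "vanishes 4 w0 (\<lambda>w. (b' w - b w) * (X' w * (Y' w * Y' w)) + b w * ((X' w - X w) * (Y' w * Y' w) + X w * ((Y' w - Y w) * (Y' w + Y w))))"
        by (intro vanishes_add[OF oU w0(3)] A4 smooth_on_mult smooth_on_diff smooth_on_add sm)
    qed
    then have "foldr partial is (\<lambda>w. ?q' w - ?q w) w0 = 0"
      by (rule vanishes_foldr_partial) (use len in simp)
    then show ?thesis
      using foldr_partial_diff[OF oU w0(3) C_inf_smooth[OF Q' c(1)] C_inf_smooth[OF Q c(1)], of "is"] by simp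
  qed

  obtain co where co: "\<And>Q z. Q \<in> C_inf A \<Longrightarrow> z \<in> cot_dom A c \<Longrightarrow>
      B Q z = (\<Sum>is\<in>{is :: ('n + 'n) list. length is \<le> 3}. co is (cot_coord c z) * foldr partial is (Q \<circ> cot_inv A c) (cot_coord c z))"
    using B c(1) unfolding diff_ops_def by blast
  have "B Q' z0 = B Q z0"
    unfolding co[OF Q z0c(2)] co[OF Q' z0c(2)] z0(3) by (rule sum.cong[OF refl]) (simp add: jets)
  then have "L_op A G F Q' z0 = 0"
    using eq[OF inv_Diff[OF F] Q' z0(1)] act DiffD(5)[OF F] by simp
  moreover have "L_op A G F Q' z0 = L_op A G F Q z0"
    unfolding L_op_sum[OF F Q z0(1) c(1) z0c(1)] L_op_sum[OF F Q' z0(1) c(1) z0c(1)] z0(3)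
    by (rule sum.cong[OF refl]) (simp add: jets)
  ultimately have "L_expl (conn_pull id c) (conn_pull F c) ?q w0 = 0"
    using L_op_eq[OF F Q z0(1) c(1) z0c(1)] z0(3) by simp
  moreover have "L_expl (conn_pull id c) (conn_pull F c) ?q w0 = L_expl (conn_pull id c) (conn_pull F c) qf w0"
    by (rule L_expl_cong[OF open_UNIV UNIV_I refl refl oU w0(3) q])
  moreover have "L_expl (conn_pull id c) (conn_pull F c) qf w0 = 6 * ?\<chi> u0 * (2 * \<epsilon> * ?\<chi> u0)"
  proof -
    have sm: "f differentiable (at w)" if "smooth_on UNIV f" for f :: "real^('n + 'n) \<Rightarrow> real" and w
      by (rule smooth_on_differentiable[OF that UNIV_I])
    note d = sm[OF sX] sm[OF sY] sm[OF sb]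
    have bX: "(\<lambda>w. b w * X w) differentiable (at w)" for w by (rule sm[OF smooth_on_mult[OF UU sb sX]])
    have dY: "dd v Y w = fibre_part v $ a" for v w
      unfolding Y_def
      by (rule fun_cong[OF dd_bounded_linear[OF bounded_linear_compose[OF bounded_linear_vec_nth bounded_linear_fibre_part]]])
    have xd: "(\<lambda>x::real^'n. x $ a - u0 $ a) differentiable (at x)" "?\<chi> differentiable (at x)" for x
      by (auto intro!: smooth_on_differentiable[OF _ UNIV_I] smooth_on_bump smooth_on_diff smooth_on_component smooth_on_ident smooth_on_const)
    have dx: "dd v (\<lambda>x::real^'n. x $ a - u0 $ a) x = v $ a" for v x
      by (subst dd_diff) (simp_all add: bounded_linear_imp_differentiable[OF bounded_linear_vec_nth] dd_bounded_linear[OF bounded_linear_vec_nth])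
    have dX: "dd v X w = base_part v $ a" for v w
      unfolding X_def dd_cyl[OF xd(1)] by (rule dx)
    have db: "dd v b w = dd (base_part v) ?\<chi> (base_part w)" for v w
      unfolding b_def by (rule dd_cyl[OF xd(2)])
    have db0: "dd (axis (Inr k) 1) b w = 0" "dd (axis (Inr k) 1) X w = 0" for k w
      unfolding db dX using linear_0[OF dd_linear[OF xd(2)]] by simp_all
    have bX0: "dd (axis (Inr k) 1) (\<lambda>w. b w * X w) w = 0" for k w
      by (simp add: dd_mult[OF d(3,1)] db0)
    have qf: "qf = (\<lambda>w. (b w * X w) * (Y w * Y w))" by (simp add: fun_eq_iff qf_def)
    have YY: "(\<lambda>w. Y w * Y w) differentiable (at w)" for w by (rule sm[OF smooth_on_mult[OF UU sY sY]])
    have 1: "dd (axis (Inr k) 1) qf = (\<lambda>w. (2 * axis k 1 $ a) * ((b w * X w) * Y w))" for k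
      unfolding qf by (rule ext) (simp add: dd_mult[OF bX YY] dd_mult[OF d(2,2)] bX0 dY)
    have bXY: "(\<lambda>w. (b w * X w) * Y w) differentiable (at w)" for w
      by (rule sm[OF smooth_on_mult[OF UU smooth_on_mult[OF UU sb sX] sY]])
    have 2: "vhess qf j k = (\<lambda>w. (2 * axis k 1 $ a * axis j 1 $ a) * (b w * X w))" for j k
      unfolding vhess_def 1
      by (rule ext) (simp add: dd_linear_compose[OF bounded_linear_mult_right bXY] dd_mult[OF bX d(2)] bX0 dY)
    \<comment> \<open>The fibre Hessian is a multiple of X, so it vanishes at \<open>w0\<close> and
      only its base derivative survives.\<close>
    have H0: "vhess qf j k w0 = 0" for j k by (simp add: 2 X_def w0)
    have 3: "dd (bvec v) (vhess qf j k) w0 = (2 * axis k 1 $ a * axis j 1 $ a) * (?\<chi> u0 * v $ a)" for v j k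
      unfolding 2 dd_linear_compose[OF bounded_linear_mult_right bX] dd_mult[OF d(3,1)] dX
      by (simp add: X_def b_def w0)
    \<comment> \<open>Since d\<theta> and d\<psi> are the identity at \<open>u0\<close>, the symbols
      change there exactly by the second derivative of \<theta>.\<close>
    have G: "conn_pull F c a a a u0 - conn_pull id c a a a u0 = 2 * \<epsilon> * ?\<chi> u0"
    proof -
      have u: "u0 \<in> dmn F c c" using u0 by (simp add: cx(5))
      have "conn_pull F c a a a u0 = pullback_conn (local_map F c c) (G c) a a a u0"
        by (rule conn_pull_eq[OF F c(1) c(1) u])
      also have "\<dots> = pullback_conn \<theta> (G c) a a a u0"
        by (rule pullback_conn_cong[OF oS u0]) (simp_all add: cx(3))
      also have "\<dots> = dd (cvec (G c) u0 ?e ?e + (2 * \<epsilon> * ?\<chi> u0) *\<^sub>R ?e) \<psi> u0 $ a"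
        unfolding pullback_conn_eq[OF diff UNIV_I] \<theta>0 d\<theta> dd\<theta> ..
      also have "\<dots> = G c a a a u0 + 2 * \<epsilon> * ?\<chi> u0"
        by (simp add: d\<psi> cvec_axis)
      finally show ?thesis using conn_pull_id[OF c(1) u0] by simp
    qed
    have s: "(axis k 1 :: real^'n) $ a = (if k = a then 1 else 0)" for k by (auto simp: axis_def)
    \<comment> \<open>The sum with third fibre derivatives disappears with the covector of
      \<open>w0\<close>, the one with the Hessian by \<open>H0\<close>.\<close>
    have "L_expl (conn_pull id c) (conn_pull F c) qf w0 = 3 * (\<Sum>j\<in>UNIV. \<Sum>k\<in>UNIV. (2 * axis k 1 $ a * axis j 1 $ a)
       * (?\<chi> u0 * (conn_pull F c a j k u0 - conn_pull id c a j k u0)))"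
      unfolding L_expl_def Let_def w0 H0 3 by (simp add: cvec_axis)
    also have "\<dots> = 6 * ?\<chi> u0 * (conn_pull F c a a a u0 - conn_pull id c a a a u0)"
    proof -
      have "(2 * axis k 1 $ a * axis j 1 $ a) * (?\<chi> u0 * (conn_pull F c a j k u0 - conn_pull id c a j k u0))
        = (if k = a then (if j = a then 2 * (?\<chi> u0 * (conn_pull F c a a a u0 - conn_pull id c a a a u0)) else 0) else 0)" for j k
        by (simp add: s)
      then show ?thesis by simp
    qed
    finally show ?thesis unfolding G .
  qed
  ultimately show False using bump_center[OF r(1), of u0] \<epsilon> by simp
qed

end


theorem theorem1:
  fixes A :: "('a::{t2_space,second_countable_topology}, 'n::finite) chart set"
    and G :: "('a, 'n) chart \<Rightarrow> 'n christoffel"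
  assumes "smooth_atlas A"
    and "symmetric_connection A G"
  shows "one_cocycle A 3 (\<lambda>f. L_op A G (inv f)) \<and>
         \<not> trivial_cocycle A 3 (\<lambda>f. L_op A G (inv f))"
proof -
  interpret manifold_with_connection A G
    by (unfold_locales) (fact assms)+
  show ?thesis using L_op_one_cocycle L_op_nontrivial by blast
qed

end
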